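(* Let $F$ be a field and let $x_1,\dots,x_m$ ($m\ge2$) be distinct elements of $F^\times$. The image $\Phi(\tau(x_1,\dots,x_m))$ of the tree sum $\tau(x_1,\dots,x_m)$ under the forest cycling map is an admissible cycle with decomposable boundary.
   Context: **Trees.** A plane tree is a finite tree whose internal vertices have valency $\ge 3$, with a cyclic order of the incident edges at each vertex; the other vertices have valency 1 and are external. It is planted if one external vertex is distinguished as root; the other external vertices are leaves. An $R$-deco tree is a planted plane tree with a map from its external vertices to $R$. Edges are directed away from the root. An orientation is an ordering of the edges up to even permutation; a planted plane tree has a canonical orientation, given by the order in which edges are first met when walking around the tree starting at the root edge and following the cyclic orders (so leaves are also linearly ordered). A tree is trivalent if all internal vertices have valency 3. **Tree sum.** $\tau(x_1,\dots,x_m)$ is the sum of all trivalent $R$-deco trees (with canonical orientation) having $m-1$ leaves, decorated in order by $x_1,\dots,x_{m-1}$, and with root decorated by $x_m$. **Cycles.** $\square_F=\mathbb P^1_F\setminus\{1\}$, $\square_F^k=(\square_F)^k$, with faces given by setting some coordinates equal to $0$ or $\infty$. A closed irreducible subvariety of codimension $p$ in $\square_F^k$ is admissible if it meets every face in codimension $p$ or not at all; an admissible cycle is a linear combination of these. $\mathcal N_c^n(F,p)=\big(\mathrm{Cycle}^p\langle F,2p-n\rangle\otimes\varepsilon_{2p-n}\big)_{G(2p-n)}$, where $\mathrm{Cycle}^p\langle F,k\rangle$ is the group of admissible codimension $p$ cycles in $\square_F^k$ (taken with rational coefficients), $G(k)=S_k\ltimes(\mathbb Z/2)^k$ permutes and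 inverts coordinates, and $\varepsilon_k$ is its sign character. The boundary on cycles in $\square_F^k$ is $\partial=\sum_{i=1}^{k}(-1)^{i-1}(\partial^i_0-\partial^i_\infty)$, $\partial_\epsilon^i$ being intersection with $\{z_i=\epsilon\}$. The product is induced by concatenation of coordinates. An element of $\mathcal N_c=\bigoplus_p\mathcal N^\bullet_c(F,p)$ is decomposable if it is a linear combination (possibly zero) of products of two elements of $\bigoplus_{p>0}\mathcal N^\bullet_c(F,p)$. **Forest cycling map $\Phi$.** For an oriented $F^\times$-deco tree assign to each internal vertex $v$ an independent variable $y_v$ (parameter in $\mathbb P^1_F$) and to each external vertex its decoration; to each edge directed from $v$ to $w$ assign the coordinate $1-\frac{y_v}{y_w}$; list the coordinates in an order of the edges representing the orientation. $\Phi$ of the tree is the so parametrized cycle in the cube $\square_F^{\#\text{edges}}$. $\Phi$ is extended linearly. *)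

theory Defs
  imports
    "HOL-Algebra.QuotRing"
    "HOL-Library.Poly_Mapping"
    "HOL-Library.Extended_Nat"
    "HOL-Library.Countable"
    "HOL-Computational_Algebra.Fraction_Field"
    "HOL-Combinatorics.Permutations"
begin

section \<open>The cube as an affine variety\<close>

text \<open>
  The coordinate function \<open>u = z / (z - 1)\<close> identifies \<open>\<P>\<^sup>1 - {1}\<close> with the affine line; it
  sends \<open>z = 0\<close> to \<open>u = 0\<close> and \<open>z = \<infinity>\<close> to \<open>u = 1\<close>. So the coordinate ring of the \<open>k\<close>-dimensional
  cube is the polynomial ring in \<open>u\<^sub>0, \<dots>, u\<^bsub>k-1\<^esub>\<close>, and closed irreducible subvarieties are
  prime ideals of it. Coordinates are numbered from 0.
\<close>

type_synonym 'a mpoly = "(nat \<Rightarrow>\<^sub>0 nat) \<Rightarrow>\<^sub>0 'a"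

definition Const :: "'a::zero \<Rightarrow> 'a mpoly" where
  "Const a = Poly_Mapping.single 0 a"

definition Var :: "nat \<Rightarrow> 'a::zero_neq_one mpoly" where
  "Var i = Poly_Mapping.single (Poly_Mapping.single i 1) 1"

definition peval :: "('a::zero \<Rightarrow> 'b::comm_semiring_1) \<Rightarrow> (nat \<Rightarrow> 'b) \<Rightarrow> 'a mpoly \<Rightarrow> 'b" where
  "peval c \<phi> f =
     (\<Sum>m\<in>Poly_Mapping.keys f. c (Poly_Mapping.lookup f m) *
        (\<Prod>i\<in>Poly_Mapping.keys m. \<phi> i ^ Poly_Mapping.lookup m i))"

definition cube_ring :: "nat \<Rightarrow> 'a::field mpoly ring" where
  "cube_ring k = \<lparr>carrier = {f. \<forall>m\<in>Poly_Mapping.keys f. Poly_Mapping.keys m \<subseteq> {..<k}},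
     monoid.mult = (*), one = 1, zero = 0, add = (+)\<rparr>"

lemma cube_ring_cring: "cring (cube_ring k :: 'a::field mpoly ring)"
proof -
  let ?C = "{f :: 'a mpoly. \<forall>m\<in>Poly_Mapping.keys f. Poly_Mapping.keys m \<subseteq> {..<k}}"
  have add: "f + g \<in> ?C" if "f \<in> ?C" "g \<in> ?C" for f g
    using that Poly_Mapping.keys_add[of f g] by blast
  have mult: "f * g \<in> ?C" if "f \<in> ?C" "g \<in> ?C" for f g
  proof -
    have "Poly_Mapping.keys m \<subseteq> {..<k}" if m: "m \<in> Poly_Mapping.keys (f * g)" for m
    proof -
      obtain a b where "m = a + b" "a \<in> Poly_Mapping.keys f" "b \<in> Poly_Mapping.keys g"
        using m Poly_Mapping.keys_mult[of f g] by blast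
      then show ?thesis
        using \<open>f \<in> ?C\<close> \<open>g \<in> ?C\<close> Poly_Mapping.keys_add[of a b] by blast
    qed
    then show ?thesis by blast
  qed
  have uminus: "- f \<in> ?C" if "f \<in> ?C" for f
    using that by simp
  have one: "1 \<in> ?C" and zero: "0 \<in> ?C"
    by (simp_all add: Poly_Mapping.keys_one)
  have inv: "\<exists>g\<in>?C. g + f = 0" if "f \<in> ?C" for f
    using uminus[OF that] by (intro bexI[of _ "- f"]) auto
  let ?R = "cube_ring k :: 'a mpoly ring"
  have car: "?C = carrier ?R" by (simp add: cube_ring_def)
  have ops: "x \<otimes>\<^bsub>?R\<^esub> y = x * y" "\<one>\<^bsub>?R\<^esub> = 1" "x \<oplus>\<^bsub>?R\<^esub> y = x + y" "\<zero>\<^bsub>?R\<^esub> = 0" for x y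
    by (simp_all add: cube_ring_def)
  have "abelian_group ?R"
  proof (rule abelian_groupI)
    show "\<exists>y\<in>carrier ?R. y \<oplus>\<^bsub>?R\<^esub> x = \<zero>\<^bsub>?R\<^esub>" if "x \<in> carrier ?R" for x
      using inv that unfolding ops car by blast
  qed (use add zero in \<open>simp_all only: ops car ac_simps add_0_left add_0_right\<close>)
  moreover have "comm_monoid ?R"
    by (rule comm_monoidI)
      (use mult one in \<open>simp_all only: ops car ac_simps mult_1_left mult_1_right\<close>)
  ultimately show ?thesis
    by (rule cringI) (simp only: ops distrib_right)
qed

section \<open>Codimension and multiplicities\<close>

text \<open>The codimension of \<open>V(P)\<close> in \<open>V(L)\<close>, for prime ideals \<open>L \<subseteq> P\<close>.\<close>

definition codim :: "('r, 'x) ring_scheme \<Rightarrow> 'r set \<Rightarrow> 'r set \<Rightarrow> enat" where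
  "codim R L P = (SUP n \<in> {n. \<exists>c. c 0 = L \<and> c n = P \<and>
     (\<forall>i\<le>n. primeideal (c i) R) \<and> (\<forall>i<n. c i \<subset> c (Suc i))}. enat n)"

text \<open>The length of a commutative ring as a module over itself.\<close>

definition ring_length :: "('r, 'x) ring_scheme \<Rightarrow> enat" where
  "ring_length R = (SUP n \<in> {n. \<exists>c :: nat \<Rightarrow> 'r set.
     (\<forall>i\<le>n. ideal (c i) R) \<and> (\<forall>i<n. c i \<subset> c (Suc i))}. enat n)"

definition minimal_primes :: "('r, 'x) ring_scheme \<Rightarrow> 'r set \<Rightarrow> 'r set set" where
  "minimal_primes R I = {M. primeideal M R \<and> I \<subseteq> M \<and>
     (\<forall>N. primeideal N R \<and> I \<subseteq> N \<and> N \<subseteq> M \<longrightarrow> N = M)}"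

text \<open>The extension of an ideal \<open>I\<close> to the localization at a prime ideal \<open>M\<close>; the localization
  itself is \<open>loc_ring\<close>, realized inside the fraction field.\<close>

definition loc_ideal :: "nat \<Rightarrow> 'a::field mpoly set \<Rightarrow> 'a mpoly set \<Rightarrow> 'a mpoly fract set" where
  "loc_ideal k M I = {Fract f g | f g. f \<in> I \<and> g \<in> carrier (cube_ring k) - M}"

definition loc_ring :: "nat \<Rightarrow> 'a::field mpoly set \<Rightarrow> 'a mpoly fract ring" where
  "loc_ring k M = \<lparr>carrier = loc_ideal k M (carrier (cube_ring k)),
     monoid.mult = (*), one = 1, zero = 0, add = (+)\<rparr>"

definition multiplicity_at :: "nat \<Rightarrow> 'a::field mpoly set \<Rightarrow> 'a mpoly set \<Rightarrow> nat" where
  "multiplicity_at k I M = the_enat (ring_length (loc_ring k M Quot loc_ideal k M I))"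

section \<open>Cycles\<close>

text \<open>A pair \<open>(k, P)\<close> stands for the subvariety \<open>V(P)\<close> of the \<open>k\<close>-dimensional cube.\<close>

type_synonym 'a subvariety = "nat \<times> 'a mpoly set"
type_synonym 'a cyc = "'a subvariety \<Rightarrow>\<^sub>0 rat"

definition scale :: "rat \<Rightarrow> ('x \<Rightarrow>\<^sub>0 rat) \<Rightarrow> ('x \<Rightarrow>\<^sub>0 rat)" where
  "scale c Z = Poly_Mapping.map ((*) c) Z"

lemma lookup_scale [simp]: "Poly_Mapping.lookup (scale c Z) x = c * Poly_Mapping.lookup Z x"
  by (simp add: scale_def Poly_Mapping.map.rep_eq when_def)

lemma vector_space_scale: "vector_space (scale :: rat \<Rightarrow> ('x \<Rightarrow>\<^sub>0 rat) \<Rightarrow> ('x \<Rightarrow>\<^sub>0 rat))"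
  by unfold_locales (auto intro!: poly_mapping_eqI simp: lookup_add algebra_simps)

abbreviation qspan :: "('x \<Rightarrow>\<^sub>0 rat) set \<Rightarrow> ('x \<Rightarrow>\<^sub>0 rat) set" where
  "qspan \<equiv> Modules.module.span scale"

definition lin_ext :: "('x \<Rightarrow> ('y \<Rightarrow>\<^sub>0 rat)) \<Rightarrow> ('x \<Rightarrow>\<^sub>0 rat) \<Rightarrow> ('y \<Rightarrow>\<^sub>0 rat)" where
  "lin_ext h Z = (\<Sum>x\<in>Poly_Mapping.keys Z. scale (Poly_Mapping.lookup Z x) (h x))"

text \<open>The cycle of the closed subscheme defined by an ideal \<open>I\<close>: its irreducible components,
  counted with the lengths of the local rings at their generic points.\<close>

definition fund_cycle :: "nat \<Rightarrow> 'a::field mpoly set \<Rightarrow> 'a cyc" where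
  "fund_cycle k I = (\<Sum>M\<in>minimal_primes (cube_ring k) I.
     Poly_Mapping.single (k, M) (of_nat (multiplicity_at k I M)))"

datatype endpoint = Zero | Infty

fun u_value :: "endpoint \<Rightarrow> 'a::field" where
  "u_value Zero = 0"
| "u_value Infty = 1"

text \<open>A face of the cube is given by a partial map from coordinates to \<open>{0, \<infinity>}\<close>.\<close>

definition face_ideal :: "nat \<Rightarrow> (nat \<rightharpoonup> endpoint) \<Rightarrow> 'a::field mpoly set" where
  "face_ideal k \<sigma> = genideal (cube_ring k) {Var i - Const (u_value e) | i e. \<sigma> i = Some e}"

definition admissible_subvariety :: "nat \<Rightarrow> nat \<Rightarrow> 'a::field mpoly set \<Rightarrow> bool" where
  "admissible_subvariety k p P \<longleftrightarrow>
     primeideal P (cube_ring k) \<and> codim (cube_ring k) {0} P = enat p \<and>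
     (\<forall>\<sigma>. dom \<sigma> \<subseteq> {..<k} \<longrightarrow>
        (\<forall>M \<in> minimal_primes (cube_ring k) (P \<union> face_ideal k \<sigma>).
           codim (cube_ring k) (face_ideal k \<sigma>) M = enat p))"

definition cycle_group :: "nat \<Rightarrow> nat \<Rightarrow> 'a::field cyc set" where
  "cycle_group p k = {Z. \<forall>(k', P) \<in> Poly_Mapping.keys Z. k' = k \<and> admissible_subvariety k p P}"

definition admissible_cycle :: "'a::field cyc \<Rightarrow> bool" where
  "admissible_cycle Z \<longleftrightarrow> (\<exists>p k. Z \<in> cycle_group p k)"

text \<open>The direct sum of the groups of admissible cycles over all \<open>k\<close> and all \<open>p \<in> A\<close>.\<close>

definition adm_cycles :: "nat set \<Rightarrow> 'a::field cyc set" where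
  "adm_cycles A =
     {Z. \<forall>(k, P) \<in> Poly_Mapping.keys Z. \<exists>p\<in>A. admissible_subvariety k p P}"

text \<open>
  Intersection with \<open>z\<^sub>i = 0\<close> or \<open>z\<^sub>i = \<infinity>\<close>, as a cycle in the cube with the \<open>i\<close>-th coordinate
  removed. If \<open>V(P)\<close> is not contained in this divisor, then \<open>u\<^sub>i - \<epsilon>\<close> is a nonzerodivisor on the
  coordinate ring of \<open>V(P)\<close>, so the intersection multiplicities are lengths of local rings.
\<close>

definition face_map :: "nat \<Rightarrow> endpoint \<Rightarrow> 'a::field mpoly \<Rightarrow> 'a mpoly" where
  "face_map i e = peval Const
     (\<lambda>j. if j < i then Var j else if j = i then Const (u_value e) else Var (j - 1))"

definition boundary :: "'a::field cyc \<Rightarrow> 'a cyc" where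
  "boundary = lin_ext (\<lambda>(k, P). \<Sum>i<k. scale ((-1) ^ i)
     (fund_cycle (k - 1) (face_map i Zero ` P) - fund_cycle (k - 1) (face_map i Infty ` P)))"

section \<open>The algebra of cycles modulo the action of the hyperoctahedral groups\<close>

text \<open>The permutation \<open>\<pi>\<close> followed by the inversion of the coordinates in \<open>S\<close>;
  \<open>z \<mapsto> 1/z\<close> is \<open>u \<mapsto> 1 - u\<close>.\<close>

definition cube_aut :: "(nat \<Rightarrow> nat) \<Rightarrow> nat set \<Rightarrow> 'a::field mpoly \<Rightarrow> 'a mpoly" where
  "cube_aut \<pi> S = peval Const (\<lambda>i. if i \<in> S then 1 - Var (\<pi> i) else Var (\<pi> i))"

definition hyp_sign :: "(nat \<Rightarrow> nat) \<Rightarrow> nat set \<Rightarrow> rat" where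
  "hyp_sign \<pi> S = of_int (sign \<pi>) * (-1) ^ card S"

definition alt_relations :: "'a::field cyc set" where
  "alt_relations = qspan {Poly_Mapping.single (k, cube_aut \<pi> S ` P) (hyp_sign \<pi> S)
       - Poly_Mapping.single (k, P) 1 | k p P \<pi> S.
     admissible_subvariety k p P \<and> \<pi> permutes {..<k} \<and> S \<subseteq> {..<k}}"

text \<open>Elements of \<open>N\<^sub>c\<close> are the classes of this equivalence relation.\<close>

definition nc_rel :: "('a::field cyc \<times> 'a cyc) set" where
  "nc_rel = {(Z, W). Z \<in> adm_cycles UNIV \<and> W \<in> adm_cycles UNIV \<and> Z - W \<in> alt_relations}"

definition nc_class :: "'a::field cyc \<Rightarrow> 'a cyc set" where
  "nc_class Z = nc_rel `` {Z}"

text \<open>The exterior product; over an imperfect field \<open>V(P) \<times> V(Q)\<close> need be neither irreducible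
  nor reduced.\<close>

definition prod_ideal :: "nat \<Rightarrow> nat \<Rightarrow> 'a::field mpoly set \<Rightarrow> 'a mpoly set \<Rightarrow> 'a mpoly set" where
  "prod_ideal k l P Q =
     genideal (cube_ring (k + l)) (P \<union> peval Const (\<lambda>i. Var (k + i)) ` Q)"

definition cyc_mult :: "'a::field cyc \<Rightarrow> 'a cyc \<Rightarrow> 'a cyc" where
  "cyc_mult Z W =
     lin_ext (\<lambda>(k, P). lin_ext (\<lambda>(l, Q). fund_cycle (k + l) (prod_ideal k l P Q)) W) Z"

definition decomposable :: "'a::field cyc set \<Rightarrow> bool" where
  "decomposable X \<longleftrightarrow> X \<in> adm_cycles UNIV // nc_rel \<and>
     (\<exists>D \<in> qspan {cyc_mult Z W | Z W. Z \<in> adm_cycles {0<..} \<and> W \<in> adm_cycles {0<..}}.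
        X = nc_class D)"

section \<open>Trees\<close>

text \<open>
  The part of a planted plane tree away from the root; a vertex \<open>Node ts\<close> has valency
  \<open>length ts + 1\<close>. Only trivalent trees occur below, so valency at least 3 is not imposed
  on the type.
\<close>

datatype 'r plane_tree = Leaf 'r | Node "'r plane_tree list"

datatype 'r deco_tree = Planted (root_deco: 'r) (body: "'r plane_tree")

fun leaves :: "'r plane_tree \<Rightarrow> 'r list" where
  "leaves (Leaf x) = [x]"
| "leaves (Node ts) = concat (map leaves ts)"

fun trivalent :: "'r plane_tree \<Rightarrow> bool" where
  "trivalent (Leaf x) \<longleftrightarrow> True"
| "trivalent (Node ts) \<longleftrightarrow> length ts = 2 \<and> (\<forall>t\<in>set ts. trivalent t)"

definition trivalent_trees :: "'r list \<Rightarrow> 'r deco_tree set" where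
  "trivalent_trees xs =
     {T. trivalent (body T) \<and> leaves (body T) = butlast xs \<and> root_deco T = last xs}"

text \<open>Every tree carries its canonical orientation, represented by the edge order \<open>edge_list\<close> below.\<close>

definition tree_sum :: "'r list \<Rightarrow> ('r deco_tree \<Rightarrow>\<^sub>0 rat)" where
  "tree_sum xs = (\<Sum>T\<in>trivalent_trees xs. Poly_Mapping.single T 1)"

lemma trivalent_leaves_nonempty: "trivalent t \<Longrightarrow> leaves t \<noteq> []"
proof (induction t)
  case (Node ts)
  then obtain a b where "ts = [a, b]" by (auto simp: length_Suc_conv numeral_2_eq_2)
  with Node show ?case by auto
qed simp

lemma finite_trivalent_trees: "finite (trivalent_trees xs)"
proof -
  have fin: "finite {t :: 'r plane_tree. trivalent t \<and> leaves t = ys}" for ys :: "'r list"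
  proof (induction "length ys" arbitrary: ys rule: less_induct)
    case less
    let ?B = "\<lambda>zs. {t. trivalent t \<and> leaves t = zs}"
    let ?I = "{i. 0 < i \<and> i < length ys}"
    let ?U = "Leaf ` set ys \<union>
      (\<Union>i\<in>?I. (\<lambda>(a, b). Node [a, b]) ` (?B (take i ys) \<times> ?B (drop i ys)))"
    have "?B ys \<subseteq> ?U"
    proof
      fix t assume t: "t \<in> ?B ys"
      show "t \<in> ?U"
      proof (cases t)
        case (Leaf x)
        with t show ?thesis by auto
      next
        case (Node ts)
        with t obtain a b where ab: "ts = [a, b]"
          by (auto simp: length_Suc_conv numeral_2_eq_2)
        have a: "trivalent a" and b: "trivalent b" and ys: "ys = leaves a @ leaves b"
          using t Node ab by auto
        define i where "i = length (leaves a)"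
        have i: "i \<in> ?I"
          using trivalent_leaves_nonempty[OF a] trivalent_leaves_nonempty[OF b] ys
          by (auto simp: i_def)
        have "(a, b) \<in> ?B (take i ys) \<times> ?B (drop i ys)"
          using a b ys by (auto simp: i_def)
        then have "Node [a, b] \<in> (\<lambda>(a, b). Node [a, b]) ` (?B (take i ys) \<times> ?B (drop i ys))"
          by (rule rev_image_eqI) simp
        with i show ?thesis unfolding Node ab by (intro UnI2 UN_I)
      qed
    qed
    moreover have "finite ?U"
    proof (intro finite_UnI finite_UN_I finite_imageI finite_cartesian_product)
      show "finite (?B (take i ys))" "finite (?B (drop i ys))" if "i \<in> ?I" for i
        using that by (auto intro!: less)
    qed simp_all
    ultimately show ?case by (rule finite_subset)
  qed
  have "trivalent_trees xs \<subseteq> Planted (last xs) ` {t. trivalent t \<and> leaves t = butlast xs}"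
  proof
    fix T assume "T \<in> trivalent_trees xs"
    then show "T \<in> Planted (last xs) ` {t. trivalent t \<and> leaves t = butlast xs}"
      by (cases T) (auto simp: trivalent_trees_def)
  qed
  then show ?thesis by (rule finite_subset) (intro finite_imageI fin)
qed

section \<open>The forest cycling map\<close>

text \<open>
  Vertices other than the root are addressed by the list of child positions on the path from the
  root, last position first. The parameters \<open>y\<^sub>v\<close> of the internal vertices are independent variables
  in a rational function field over the base field.
\<close>

fun vertex_value :: "nat list \<Rightarrow> 'a::field plane_tree \<Rightarrow> 'a mpoly fract" where
  "vertex_value a (Leaf x) = Fract (Const x) 1"
| "vertex_value a (Node ts) = Fract (Var (to_nat a)) 1"

text \<open>The pairs \<open>(y\<^sub>v, y\<^sub>w)\<close> for the edges from \<open>v\<close> to \<open>w\<close>, in the order in which they are first met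
  when walking around the tree.\<close>

lemma size_zip_less [termination_simp]:
  "(i, t) \<in> set (zip ns ts) \<Longrightarrow> size t < Suc (size_list size ts)"
  by (rule le_imp_less_Suc) (rule size_list_estimation'[OF set_zip_rightD order_refl])

fun edges_below :: "nat list \<Rightarrow> 'a::field plane_tree \<Rightarrow> ('a mpoly fract \<times> 'a mpoly fract) list" where
  "edges_below a (Leaf x) = []"
| "edges_below a (Node ts) =
     concat (map (\<lambda>(i, t). (vertex_value a (Node ts), vertex_value (i # a) t) # edges_below (i # a) t)
       (zip [0..<length ts] ts))"

fun edge_list :: "'a::field deco_tree \<Rightarrow> ('a mpoly fract \<times> 'a mpoly fract) list" where
  "edge_list (Planted r t) = (Fract (Const r) 1, vertex_value [] t) # edges_below [] t"

fun edge_coord_z :: "'a::field mpoly fract \<times> 'a mpoly fract \<Rightarrow> 'a mpoly fract" where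
  "edge_coord_z (y, y') = 1 - y / y'"

definition edge_coord_u :: "'a::field mpoly fract \<times> 'a mpoly fract \<Rightarrow> 'a mpoly fract" where
  "edge_coord_u e = edge_coord_z e / (edge_coord_z e - 1)"

text \<open>
  The closed subvariety of the cube parametrized by a list of rational functions is defined by the
  polynomials that vanish on them. For a tree with decorations in the group of units, the \<open>y\<^sub>v\<close> can be
  recovered successively from the coordinates, beginning at the root, so the parametrization has
  degree 1 onto its image and the cycle has multiplicity 1.
\<close>

definition parametrized_cycle :: "'a::field mpoly fract list \<Rightarrow> 'a cyc" where
  "parametrized_cycle us = Poly_Mapping.single
     (length us, {f \<in> carrier (cube_ring (length us)).
        peval (\<lambda>c. Fract (Const c) 1) (\<lambda>i. us ! i) f = 0}) 1"

definition Phi :: "('a::field deco_tree \<Rightarrow>\<^sub>0 rat) \<Rightarrow> 'a cyc" where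
  "Phi = lin_ext (\<lambda>T. parametrized_cycle (map edge_coord_u (edge_list T)))"

end

theory Submission
  imports Defs
begin

text \<open>
  In terms of \<open>t = 1 - u\<close>, the coordinate of an edge from \<open>v\<close> to \<open>w\<close> is the quotient of the parameters
  of \<open>w\<close> and \<open>v\<close>. Multiplying these along the path from the root to \<open>v\<close>, or from \<open>v\<close> to a leaf, shows
  that the parameter of \<open>v\<close> and its inverse are polynomial functions on the variety of the tree. Hence
  this variety does not meet the faces at infinity, and its intersection with the face at 0 of an edge
  is the variety of the tree in which this edge is contracted; it is empty if the contraction
  identifies two different decorations. All these varieties are tori of the expected dimension, which
  gives admissibility.

  In the boundary of the tree sum, every tree with one vertex of valency 4 arises from two trivalent
  trees, with opposite signs. Contracting the root edge, or the edge at a leaf, divides the tree at the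
  vertex that is lost into two trees, so these terms are products up to a permutation of the
  coordinates.
\<close>

section \<open>Polynomial evaluation\<close>

text \<open>The boundary is defined by ideals and lengths of local rings, so a set-theoretic
  description of the faces does not suffice: the image of the ideal of a tree in the ring of a face
  must be shown to be prime or the unit ideal. What makes this work is that the parameters and their
  inverses, being polynomial functions, satisfy the relations of the contracted tree already modulo
  the ideal of the tree and the face equation; clearing denominators then transfers every relation
  that holds at the generic point of the contracted tree. The same argument shows that products of
  such varieties are integral over any field, perfect or not.

  A contraction can merge an internal vertex with a leaf, so trees are replaced by networks, lists
  of edges between labels that are constants or parameters. A contraction is a relabelling that
  keeps the edge as a loop with coordinate 0; the cube and its ring stay fixed while several faces
  are imposed.

  Varieties are given by points over one rational function field, where faces, products and
  permutations are operations on lists. Codimension is a supremum over chains of primes; it is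
  bounded by counting algebraically independent elements.\<close>

definition semiring_hom :: "('a::comm_semiring_1 \<Rightarrow> 'b::comm_semiring_1) \<Rightarrow> bool" where
  "semiring_hom c \<longleftrightarrow> c 0 = 0 \<and> c 1 = 1 \<and> (\<forall>x y. c (x + y) = c x + c y) \<and> (\<forall>x y. c (x * y) = c x * c y)"

lemma semiring_homD:
  assumes "semiring_hom c"
  shows "c 0 = 0" "c 1 = 1" "c (x + y) = c x + c y" "c (x * y) = c x * c y"
  using assms by (auto simp: semiring_hom_def)

definition monom_val :: "(nat \<Rightarrow> 'b::comm_semiring_1) \<Rightarrow> (nat \<Rightarrow>\<^sub>0 nat) \<Rightarrow> 'b" where
  "monom_val \<phi> m = (\<Prod>i\<in>Poly_Mapping.keys m. \<phi> i ^ Poly_Mapping.lookup m i)"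

lemma monom_val_superset:
  assumes "finite A" "Poly_Mapping.keys m \<subseteq> A"
  shows "monom_val \<phi> m = (\<Prod>i\<in>A. \<phi> i ^ Poly_Mapping.lookup m i)"
  unfolding monom_val_def using assms
  by (intro prod.mono_neutral_left) (auto simp: in_keys_iff)

lemma monom_val_0 [simp]: "monom_val \<phi> 0 = 1"
  by (simp add: monom_val_def)

lemma monom_val_single [simp]: "monom_val \<phi> (Poly_Mapping.single i e) = \<phi> i ^ e"
  by (simp add: monom_val_def)

lemma monom_val_add: "monom_val \<phi> (a + b) = monom_val \<phi> a * monom_val \<phi> b"
proof -
  let ?A = "Poly_Mapping.keys a \<union> Poly_Mapping.keys b"
  have "Poly_Mapping.keys (a + b) \<subseteq> ?A" by (rule Poly_Mapping.keys_add)
  then have "monom_val \<phi> (a + b) = (\<Prod>i\<in>?A. \<phi> i ^ Poly_Mapping.lookup (a + b) i)"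
    by (intro monom_val_superset) auto
  also have "\<dots> = (\<Prod>i\<in>?A. \<phi> i ^ Poly_Mapping.lookup a i) * (\<Prod>i\<in>?A. \<phi> i ^ Poly_Mapping.lookup b i)"
    by (simp add: lookup_add power_add prod.distrib)
  also have "\<dots> = monom_val \<phi> a * monom_val \<phi> b"
    by (subst (1 2) monom_val_superset[where A = ?A]) auto
  finally show ?thesis .
qed

lemma peval_alt:
  "peval c \<phi> f = (\<Sum>m\<in>Poly_Mapping.keys f. c (Poly_Mapping.lookup f m) * monom_val \<phi> m)"
  by (simp add: peval_def monom_val_def)

lemma peval_superset:
  assumes "finite A" "Poly_Mapping.keys f \<subseteq> A" "c 0 = 0"
  shows "peval c \<phi> f = (\<Sum>m\<in>A. c (Poly_Mapping.lookup f m) * monom_val \<phi> m)"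
  unfolding peval_alt using assms
  by (intro sum.mono_neutral_left) (auto simp: in_keys_iff)

lemma peval_add:
  assumes "semiring_hom c" shows "peval c \<phi> (f + g) = peval c \<phi> f + peval c \<phi> g"
proof -
  let ?A = "Poly_Mapping.keys f \<union> Poly_Mapping.keys g"
  have k: "Poly_Mapping.keys (f + g) \<subseteq> ?A" by (rule Poly_Mapping.keys_add)
  show ?thesis
    using semiring_homD[OF assms] k
    by (simp add: peval_superset[where A = ?A] lookup_add distrib_right sum.distrib)
qed

lemma peval_0 [simp]: "peval c \<phi> 0 = 0"
  by (simp add: peval_alt)

lemma peval_sum:
  assumes "semiring_hom c" shows "peval c \<phi> (\<Sum>x\<in>A. F x) = (\<Sum>x\<in>A. peval c \<phi> (F x))"
  by (induction A rule: infinite_finite_induct) (simp_all add: peval_add[OF assms])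

lemma peval_single:
  assumes "semiring_hom c" shows "peval c \<phi> (Poly_Mapping.single m a) = c a * monom_val \<phi> m"
  using semiring_homD[OF assms] by (cases "a = 0") (simp_all add: peval_alt)

lemma sum_single_keys: "(\<Sum>m\<in>Poly_Mapping.keys f. Poly_Mapping.single m (Poly_Mapping.lookup f m)) = f"
  by (rule poly_mapping_eqI) (simp add: lookup_sum lookup_single when_def in_keys_iff)

lemma peval_mult:
  assumes "semiring_hom c" shows "peval c \<phi> (f * g) = peval c \<phi> f * peval c \<phi> g"
proof -
  let ?l = "Poly_Mapping.lookup" and ?k = "Poly_Mapping.keys"
  have "f * g = (\<Sum>m\<in>?k f. Poly_Mapping.single m (?l f m)) * (\<Sum>n\<in>?k g. Poly_Mapping.single n (?l g n))"
    by (simp add: sum_single_keys)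
  also have "\<dots> = (\<Sum>m\<in>?k f. \<Sum>n\<in>?k g. Poly_Mapping.single (m + n) (?l f m * ?l g n))"
    by (simp add: sum_product mult_single)
  finally have "peval c \<phi> (f * g) =
      (\<Sum>m\<in>?k f. \<Sum>n\<in>?k g. (c (?l f m) * monom_val \<phi> m) * (c (?l g n) * monom_val \<phi> n))"
    using semiring_homD[OF assms]
    by (simp add: peval_sum[OF assms] peval_single[OF assms] monom_val_add mult_ac)
  then show ?thesis by (simp add: peval_alt sum_product)
qed

lemma peval_Const: "semiring_hom c \<Longrightarrow> peval c \<phi> (Const a) = c a"
  by (simp add: Const_def peval_single)

lemma peval_Var: "semiring_hom c \<Longrightarrow> peval c \<phi> (Var i) = \<phi> i"
  by (simp add: Var_def peval_single semiring_homD)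

lemma Const_0 [simp]: "Const 0 = 0" and Const_1 [simp]: "Const 1 = 1"
  by (simp_all add: Const_def)

lemma Const_inject [simp]: "Const a = Const b \<longleftrightarrow> a = b"
  by (metis Const_def lookup_single_eq)

lemma semiring_hom_Const: "semiring_hom (Const :: 'a::comm_semiring_1 \<Rightarrow> 'a mpoly)"
  by (simp add: semiring_hom_def Const_def single_add mult_single)

lemmas Const_add = semiring_homD(3)[OF semiring_hom_Const]
lemmas Const_mult = semiring_homD(4)[OF semiring_hom_Const]

lemma peval_1: "semiring_hom c \<Longrightarrow> peval c \<phi> 1 = 1"
  using peval_Const[of c \<phi> 1] by (simp add: semiring_homD)

lemma peval_uminus:
  fixes c :: "'a::comm_ring_1 \<Rightarrow> 'b::comm_ring_1"
  assumes "semiring_hom c" shows "peval c \<phi> (- f) = - peval c \<phi> f"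
  using peval_add[OF assms, of \<phi> "- f" f] by (simp add: eq_neg_iff_add_eq_0)

lemma peval_diff:
  fixes c :: "'a::comm_ring_1 \<Rightarrow> 'b::comm_ring_1"
  assumes "semiring_hom c" shows "peval c \<phi> (f - g) = peval c \<phi> f - peval c \<phi> g"
  using peval_add[OF assms, of \<phi> "f - g" g] by simp

lemma Const_diff: "Const (a - b) = Const a - Const (b::'a::comm_ring_1)"
  by (simp add: Const_def single_diff)

lemma peval_power: "semiring_hom c \<Longrightarrow> peval c \<phi> (f ^ n) = peval c \<phi> f ^ n"
  by (induction n) (simp_all add: peval_1 peval_mult)

lemma peval_prod: "semiring_hom c \<Longrightarrow> peval c \<phi> (\<Prod>x\<in>A. F x) = (\<Prod>x\<in>A. peval c \<phi> (F x))"
  by (induction A rule: infinite_finite_induct) (simp_all add: peval_1 peval_mult)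

lemmas peval_simps = peval_add peval_mult peval_diff peval_uminus peval_Const peval_Var peval_1
  peval_power peval_sum peval_prod

lemma peval_peval:
  fixes c :: "'a::comm_ring_1 \<Rightarrow> 'b::comm_ring_1"
  assumes "semiring_hom c"
  shows "peval c \<phi> (peval Const \<psi> f) = peval c (\<lambda>i. peval c \<phi> (\<psi> i)) f"
  by (simp add: peval_alt[of Const] peval_alt[of c "\<lambda>i. peval c \<phi> (\<psi> i)"] monom_val_def
      peval_simps[OF assms])

lemma Var_power: "Var i ^ e = Poly_Mapping.single (Poly_Mapping.single i e) 1"
  by (induction e) (simp_all add: Var_def mult_single single_add[symmetric])

lemma single_eq_prod_Var:
  fixes a :: "'a::comm_semiring_1"
  shows "Poly_Mapping.single m a = Const a * monom_val Var m"
proof -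
  have "Poly_Mapping.single (\<Sum>i\<in>A. Poly_Mapping.single i (e i)) (1::'a) = (\<Prod>i\<in>A. Var i ^ e i)"
    for A and e :: "nat \<Rightarrow> nat"
    by (induction A rule: infinite_finite_induct)
      (simp_all add: Var_power mult_single[of _ "1::'a" _ 1, unfolded mult_1_left, symmetric])
  from this[of "Poly_Mapping.lookup m" "Poly_Mapping.keys m"]
  have "Poly_Mapping.single m (1::'a) = monom_val Var m"
    by (simp add: sum_single_keys monom_val_def)
  moreover have "Poly_Mapping.single m a = Const a * Poly_Mapping.single m 1"
    by (simp add: Const_def mult_single)
  ultimately show ?thesis by simp
qed

lemma peval_Const_Var [simp]: "peval Const Var f = f"
  by (simp add: peval_alt sum_single_keys flip: single_eq_prod_Var)

lemma cube_ring_simps [simp]: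
  "monoid.mult (cube_ring k) = (*)" "one (cube_ring k) = 1" "zero (cube_ring k) = 0"
  "add (cube_ring k) = (+)"
  by (simp_all add: cube_ring_def)

lemma mem_cube_ring:
  "f \<in> carrier (cube_ring k) \<longleftrightarrow> (\<forall>m\<in>Poly_Mapping.keys f. Poly_Mapping.keys m \<subseteq> {..<k})"
  by (simp add: cube_ring_def)

context
  fixes k :: nat
begin

interpretation R: cring "cube_ring k :: 'a::field mpoly ring"
  by (rule cube_ring_cring)

lemma cube_ring_add: "f \<in> carrier (cube_ring k) \<Longrightarrow> g \<in> carrier (cube_ring k) \<Longrightarrow>
    f + g \<in> carrier (cube_ring k)" for f g :: "'a::field mpoly"
  using R.a_closed[of f g] by simp

lemma cube_ring_mult: "f \<in> carrier (cube_ring k) \<Longrightarrow> g \<in> carrier (cube_ring k) \<Longrightarrow>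
    f * g \<in> carrier (cube_ring k)" for f g :: "'a::field mpoly"
  using R.m_closed[of f g] by simp

end

lemma cube_ring_uminus: "f \<in> carrier (cube_ring k) \<Longrightarrow> - f \<in> carrier (cube_ring k)"
  by (simp add: mem_cube_ring)

lemma cube_ring_diff: "f \<in> carrier (cube_ring k) \<Longrightarrow> g \<in> carrier (cube_ring k) \<Longrightarrow>
    f - g \<in> carrier (cube_ring k)"
  using cube_ring_add[of f k "- g"] cube_ring_uminus[of g k] by simp

lemma cube_ring_Const: "Const a \<in> carrier (cube_ring k)"
  by (simp add: mem_cube_ring Const_def)

lemma cube_ring_0: "0 \<in> carrier (cube_ring k)" and cube_ring_1: "1 \<in> carrier (cube_ring k)"
  by (simp_all add: mem_cube_ring)

lemma cube_ring_Var: "i < k \<Longrightarrow> Var i \<in> carrier (cube_ring k)"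
  by (simp add: mem_cube_ring Var_def)

lemma cube_ring_sum: "(\<And>x. x \<in> A \<Longrightarrow> F x \<in> carrier (cube_ring k)) \<Longrightarrow> sum F A \<in> carrier (cube_ring k)"
  by (induction A rule: infinite_finite_induct) (auto intro: cube_ring_0 cube_ring_add)

lemma cube_ring_prod: "(\<And>x. x \<in> A \<Longrightarrow> F x \<in> carrier (cube_ring k)) \<Longrightarrow> prod F A \<in> carrier (cube_ring k)"
  by (induction A rule: infinite_finite_induct) (auto intro: cube_ring_1 cube_ring_mult)

lemma cube_ring_power: "f \<in> carrier (cube_ring k) \<Longrightarrow> f ^ n \<in> carrier (cube_ring k)"
  by (induction n) (auto intro: cube_ring_1 cube_ring_mult)

lemmas cube_ring_closed = cube_ring_add cube_ring_mult cube_ring_uminus cube_ring_diff cube_ring_Const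
  cube_ring_0 cube_ring_1 cube_ring_Var cube_ring_sum cube_ring_prod cube_ring_power

lemma cube_ring_mono: "f \<in> carrier (cube_ring k) \<Longrightarrow> k \<le> l \<Longrightarrow> f \<in> carrier (cube_ring l)"
  by (fastforce simp: mem_cube_ring)

text \<open>The ring is generated by the constants and the variables below \<open>k\<close>.
  Membership of both operands is carried through the steps, so properties that only make sense
  inside the ring can be proved this way.\<close>

lemma cube_ring_induct [consumes 1, case_names Const Var add mult]:
  assumes f: "f \<in> carrier (cube_ring k)"
    and P: "\<And>a. P (Const a)" "\<And>i. i < k \<Longrightarrow> P (Var i)"
      "\<And>f g. f \<in> carrier (cube_ring k) \<Longrightarrow> g \<in> carrier (cube_ring k) \<Longrightarrow> P f \<Longrightarrow> P g \<Longrightarrow> P (f + g)"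
      "\<And>f g. f \<in> carrier (cube_ring k) \<Longrightarrow> g \<in> carrier (cube_ring k) \<Longrightarrow> P f \<Longrightarrow> P g \<Longrightarrow> P (f * g)"
  shows "P f"
proof -
  let ?Q = "\<lambda>f. f \<in> carrier (cube_ring k) \<and> P f"
  have Q0: "?Q 0" using P(1)[of 0] cube_ring_0 by simp
  have Q1: "?Q 1" using P(1)[of 1] cube_ring_1 by simp
  have Qadd: "?Q f \<Longrightarrow> ?Q g \<Longrightarrow> ?Q (f + g)" and Qmult: "?Q f \<Longrightarrow> ?Q g \<Longrightarrow> ?Q (f * g)" for f g
    using P(3,4) by (auto intro: cube_ring_closed)
  have Qsum: "?Q (sum F A)" if "\<And>x. x \<in> A \<Longrightarrow> ?Q (F x)" for F :: "(nat \<Rightarrow>\<^sub>0 nat) \<Rightarrow> 'a mpoly" and A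
    using that by (induction A rule: infinite_finite_induct) (use Q0 Qadd in auto)
  have Qpow: "?Q (g ^ n)" if "?Q g" for g n
    using that by (induction n) (use Q1 Qmult in auto)
  have Qprod: "?Q (prod F A)" if "\<And>x. x \<in> A \<Longrightarrow> ?Q (F x)" for F :: "nat \<Rightarrow> 'a mpoly" and A
    using that by (induction A rule: infinite_finite_induct) (use Q1 Qmult in auto)
  have "?Q (Poly_Mapping.single m (Poly_Mapping.lookup f m))" if "m \<in> Poly_Mapping.keys f" for m
    unfolding single_eq_prod_Var monom_val_def
    using f[unfolded mem_cube_ring] that
    by (intro Qmult Qprod Qpow) (auto intro!: P(1,2) cube_ring_Const cube_ring_Var)
  then have "?Q (\<Sum>m\<in>Poly_Mapping.keys f. Poly_Mapping.single m (Poly_Mapping.lookup f m))"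
    by (rule Qsum)
  then show ?thesis by (simp add: sum_single_keys)
qed

lemma peval_cong:
  assumes "f \<in> carrier (cube_ring k)" "\<And>i. i < k \<Longrightarrow> \<phi> i = \<psi> i"
  shows "peval c \<phi> f = peval c \<psi> f"
  unfolding peval_def using assms by (intro sum.cong prod.cong refl arg_cong2[where f = times] arg_cong2[where f = power])
    (auto simp: mem_cube_ring subset_iff)

lemma peval_closed:
  assumes f: "f \<in> carrier (cube_ring k)" and "\<And>i. i < k \<Longrightarrow> \<phi> i \<in> carrier (cube_ring l)"
  shows "peval Const \<phi> f \<in> carrier (cube_ring l)"
  using f unfolding peval_def mem_cube_ring[of f]
  by (intro cube_ring_closed assms(2)) auto

section \<open>Ideals of subrings\<close>

definition eqv :: "'r::comm_ring_1 set \<Rightarrow> 'r \<Rightarrow> 'r \<Rightarrow> bool" where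
  "eqv N x y \<longleftrightarrow> x - y \<in> N"

text \<open>The carrier of \<open>cube_ring k\<close> is a proper subset of its type, and its ideals
  are ideals of that subset only; so congruences come with side conditions of membership in
  \<open>S\<close>. The other use is with \<open>S\<close> a whole field and \<open>N\<close> zero,
  where congruence is equality.\<close>

locale subring_ideal =
  fixes S N :: "'r::comm_ring_1 set"
  assumes one_S: "1 \<in> S" and diff_S: "x \<in> S \<Longrightarrow> y \<in> S \<Longrightarrow> x - y \<in> S"
    and mult_S: "x \<in> S \<Longrightarrow> y \<in> S \<Longrightarrow> x * y \<in> S"
    and N_S: "x \<in> N \<Longrightarrow> x \<in> S" and zero_N: "0 \<in> N"
    and add_N: "x \<in> N \<Longrightarrow> y \<in> N \<Longrightarrow> x + y \<in> N"
    and mult_N: "x \<in> S \<Longrightarrow> y \<in> N \<Longrightarrow> x * y \<in> N"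
begin

lemma zero_S: "0 \<in> S"
  using diff_S[OF one_S one_S] by simp

lemma uminus_S: "x \<in> S \<Longrightarrow> - x \<in> S"
  using diff_S[OF zero_S, of x] by simp

lemma add_S: "x \<in> S \<Longrightarrow> y \<in> S \<Longrightarrow> x + y \<in> S"
  using diff_S[of x "- y"] uminus_S[of y] by simp

lemma uminus_N: "x \<in> N \<Longrightarrow> - x \<in> N"
  using mult_N[OF uminus_S[OF one_S], of x] by simp

lemma mult_N': "y \<in> N \<Longrightarrow> x \<in> S \<Longrightarrow> y * x \<in> N"
  using mult_N[of x y] by (simp add: mult.commute)

abbreviation eqv_N :: "'r \<Rightarrow> 'r \<Rightarrow> bool" (infix "\<approx>" 50) where
  "x \<approx> y \<equiv> eqv N x y"

lemma eqv_refl [simp]: "x \<approx> x"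
  by (simp add: eqv_def zero_N)

lemma eqv_sym: "x \<approx> y \<Longrightarrow> y \<approx> x"
  using uminus_N[of "x - y"] by (simp add: eqv_def)

lemma eqv_trans [trans]: "x \<approx> y \<Longrightarrow> y \<approx> z \<Longrightarrow> x \<approx> z"
  using add_N[of "x - y" "y - z"] by (simp add: eqv_def)

lemma eqv_add: "x \<approx> y \<Longrightarrow> x' \<approx> y' \<Longrightarrow> x + x' \<approx> y + y'"
  using add_N[of "x - y" "x' - y'"] by (simp add: eqv_def algebra_simps)

lemma eqv_diff: "x \<approx> y \<Longrightarrow> x' \<approx> y' \<Longrightarrow> x - x' \<approx> y - y'"
  using eqv_add[of x y "- x'" "- y'"] eqv_sym[of x' y'] by (simp add: eqv_def)

lemma eqv_mult:
  assumes "x \<approx> y" "x' \<approx> y'" "x' \<in> S" "y \<in> S"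
  shows "x * x' \<approx> y * y'"
proof -
  have "(x - y) * x' + y * (x' - y') \<in> N"
    using assms by (intro add_N mult_N mult_N') (auto simp: eqv_def)
  then show ?thesis by (simp add: eqv_def algebra_simps)
qed

text \<open>\<open>x\<close> is the difference of \<open>(x * y) * h\<close> and
  \<open>x * (y * h - 1)\<close>, both in \<open>N\<close>. This removes a denominator that was
  multiplied in earlier.\<close>

lemma unit_cancel:
  assumes "x * y \<in> N" "y * h \<approx> 1" "x \<in> S" "h \<in> S"
  shows "x \<in> N"
proof -
  have "(x * y) * h - x * (y * h - 1) \<in> N"
    using assms(1) add_N[OF mult_N'[OF assms(1,4)] uminus_N[OF mult_N[OF assms(3) assms(2)[unfolded eqv_def]]]]
    by simp
  then show ?thesis by (simp add: algebra_simps)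
qed

lemma sum_S: "(\<And>i. i \<in> A \<Longrightarrow> F i \<in> S) \<Longrightarrow> sum F A \<in> S"
  by (induction A rule: infinite_finite_induct) (auto intro: zero_S add_S)

lemma power_S: "x \<in> S \<Longrightarrow> x ^ n \<in> S"
  by (induction n) (auto intro: one_S mult_S)

lemma prod_S: "(\<And>i. i \<in> A \<Longrightarrow> F i \<in> S) \<Longrightarrow> prod F A \<in> S"
  by (induction A rule: infinite_finite_induct) (auto intro: one_S mult_S)

lemma peval_S:
  assumes "\<And>a. c a \<in> S" "\<And>i. \<phi> i \<in> S" shows "peval c \<phi> f \<in> S"
  unfolding peval_def by (intro sum_S mult_S prod_S power_S assms)

lemma prod_list_S: "(\<And>x. x \<in> set xs \<Longrightarrow> x \<in> S) \<Longrightarrow> prod_list xs \<in> S"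
  by (induction xs) (auto intro: one_S mult_S)

end

section \<open>Networks\<close>

definition fconst :: "'a::field \<Rightarrow> 'a mpoly fract" where
  "fconst c = Fract (Const c) 1"

lemma semiring_hom_fconst: "semiring_hom fconst"
  by (simp add: semiring_hom_def fconst_def Const_add Const_mult Fract_of_int_eq
      Zero_fract_def One_fract_def)

lemma fconst_inject [simp]: "fconst a = fconst b \<longleftrightarrow> a = b"
  by (simp add: fconst_def eq_fract)

lemma fconst_0 [simp]: "fconst 0 = 0" and fconst_1 [simp]: "fconst 1 = 1"
  using semiring_homD[OF semiring_hom_fconst] by auto

lemma fconst_eq_0 [simp]: "fconst a = 0 \<longleftrightarrow> a = 0"
  using fconst_inject[of a 0] by simp

text \<open>Vertices are named by their parameter or their decoration. External vertices can be
  identified with their decorations because these are distinct, and a vertex that acquires a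
  decoration by contraction is just another constant.\<close>

datatype 'a label = Cst 'a | Par nat

type_synonym 'a network = "('a label \<times> 'a label) list"

definition labels :: "'a network \<Rightarrow> 'a label set" where
  "labels es = fst ` set es \<union> snd ` set es"

lemma labels_nth: "i < length es \<Longrightarrow> es ! i = (v, w) \<Longrightarrow> v \<in> labels es \<and> w \<in> labels es"
  unfolding labels_def by (metis UnI1 UnI2 fst_conv imageI nth_mem snd_conv)

definition relabel :: "('a label \<Rightarrow> 'b label) \<Rightarrow> 'a network \<Rightarrow> 'b network" where
  "relabel h es = map (map_prod h h) es"

lemma length_relabel [simp]: "length (relabel h es) = length es"
  by (simp add: relabel_def)

lemma nth_relabel [simp]: "i < length es \<Longrightarrow> relabel h es ! i = (h (fst (es ! i)), h (snd (es ! i)))"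
  by (cases "es ! i") (simp add: relabel_def)

lemma labels_relabel [simp]: "labels (relabel h es) = h ` labels es"
  by (auto simp: labels_def relabel_def image_Un image_image)

lemma set_relabel: "set (relabel h es) = map_prod h h ` set es"
  by (simp add: relabel_def)

text \<open>Not a valuation in the sense of number theory, but a point of the torus of nonzero
  parameters over the rational function field.\<close>

definition valuation :: "('a::field label \<Rightarrow> 'a mpoly fract) \<Rightarrow> bool" where
  "valuation \<alpha> \<longleftrightarrow> (\<forall>c. \<alpha> (Cst c) = fconst c) \<and> (\<forall>n. \<alpha> (Par n) \<noteq> 0)"

text \<open>From \<open>z = 1 - v/w\<close> and \<open>u = z / (z - 1)\<close> one gets
  \<open>u = 1 - w/v\<close>; so \<open>1 - u\<close> is multiplicative along paths.\<close>

definition coords :: "('a::field label \<Rightarrow> 'a mpoly fract) \<Rightarrow> 'a network \<Rightarrow> 'a mpoly fract list" where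
  "coords \<alpha> es = map (\<lambda>(v, w). 1 - \<alpha> w / \<alpha> v) es"

lemma length_coords [simp]: "length (coords \<alpha> es) = length es"
  by (simp add: coords_def)

lemma nth_coords: "i < length es \<Longrightarrow> coords \<alpha> es ! i = 1 - \<alpha> (snd (es ! i)) / \<alpha> (fst (es ! i))"
  by (simp add: coords_def case_prod_beta)

lemma coords_relabel: "coords \<alpha> (relabel h es) = coords (\<alpha> \<circ> h) es"
  by (simp add: coords_def relabel_def case_prod_beta)

text \<open>The field is large enough to contain the generic point \<open>coords generic es\<close>,
  and the ideal is determined by that point alone; the whole set is what behaves well under sections
  and products.\<close>

definition points :: "'a::field network \<Rightarrow> 'a mpoly fract list set" where
  "points es = {coords \<alpha> es | \<alpha>. valuation \<alpha>}"

definition vanishing :: "nat \<Rightarrow> 'a::field mpoly fract list set \<Rightarrow> 'a mpoly set" where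
  "vanishing k X = {f \<in> carrier (cube_ring k). \<forall>x\<in>X. peval fconst ((!) x) f = 0}"

definition label_poly :: "'a::field label \<Rightarrow> 'a mpoly" where
  "label_poly l = (case l of Cst c \<Rightarrow> Const c | Par n \<Rightarrow> Var n)"

lemma label_poly_simps [simp]: "label_poly (Cst c) = Const c" "label_poly (Par n) = Var n"
  by (simp_all add: label_poly_def)

definition generic :: "'a::field label \<Rightarrow> 'a mpoly fract" where
  "generic l = Fract (label_poly l) 1"

lemma Var_nonzero [simp]: "Var n \<noteq> (0 :: 'a::zero_neq_one mpoly)"
  by (metis Var_def lookup_single_eq lookup_zero zero_neq_one)

lemma generic_Cst: "generic (Cst c) = fconst c"
  by (simp add: generic_def fconst_def)

lemma Fract_1_eq_0 [simp]: "Fract (f :: 'b::idom) 1 = 0 \<longleftrightarrow> f = 0"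
  by (simp add: Zero_fract_def eq_fract)

lemma valuation_generic: "valuation generic"
  by (auto simp: valuation_def generic_Cst) (simp add: generic_def)

lemma valuation_nonzero:
  assumes "valuation \<alpha>" "l \<noteq> Cst 0" shows "\<alpha> l \<noteq> 0"
  using assms by (cases l) (auto simp: valuation_def)

lemma generic_prod_list: "prod_list (map generic D) = Fract (prod_list (map label_poly D)) 1"
  by (induction D) (simp_all add: generic_def One_fract_def)

text \<open>A polynomial relation between the generic coordinates becomes, after clearing denominators, a
  polynomial identity in the parameters, so it can be specialized to any ring.\<close>

lemma (in subring_ideal) relation_transfer:
  fixes c :: "'a::field \<Rightarrow> 'r" and G :: "'a label \<Rightarrow> 'r"
  assumes c: "semiring_hom c" "\<And>a. c a \<in> S"
    and f: "f \<in> carrier (cube_ring (length es))" "peval fconst ((!) (coords generic es)) f = 0"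
    and nz: "Cst 0 \<notin> labels es"
    and b: "\<And>i. b i \<in> S" and G: "\<And>l. G l \<in> S"
    and const: "\<And>a. Cst a \<in> labels es \<Longrightarrow> G (Cst a) \<approx> c a"
    and inv: "\<And>l. l \<in> labels es \<Longrightarrow> \<exists>h\<in>S. G l * h \<approx> 1"
    and rel: "\<And>i v w. i < length es \<Longrightarrow> es ! i = (v, w) \<Longrightarrow> b i * G v \<approx> G v - G w"
  shows "peval c b f \<in> N"
proof -
  define ev where "ev = peval c (\<lambda>n. G (Par n))"
  have ev_S: "ev F \<in> S" for F
    unfolding ev_def by (intro peval_S c G)
  note ev_simps = peval_simps[OF c(1), of "\<lambda>n. G (Par n)", folded ev_def]
  have ev_label: "G l \<approx> ev (label_poly l)" if "l \<in> labels es" for l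
    using that const by (cases l) (auto simp: ev_simps)
  have GD_S: "prod_list (map G D) \<in> S" for D
    by (intro prod_list_S) (auto intro: G)
  have ev_prod: "prod_list (map G D) \<approx> ev (prod_list (map label_poly D))" if "set D \<subseteq> labels es" for D
    using that by (induction D) (auto simp: ev_simps intro!: eqv_mult ev_label ev_S GD_S)
  have inv_prod: "\<exists>h\<in>S. prod_list (map G D) * h \<approx> 1" if "set D \<subseteq> labels es" for D
    using that
  proof (induction D)
    case Nil
    show ?case by (rule bexI[of _ 1]) (auto intro: one_S)
  next
    case (Cons l D)
    then obtain h h' where "h \<in> S" "G l * h \<approx> 1" "h' \<in> S" "prod_list (map G D) * h' \<approx> 1"
      using inv by fastforce
    then have "(G l * h) * (prod_list (map G D) * h') \<approx> 1 * 1"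
      by (intro eqv_mult mult_S one_S GD_S)
    then show ?case using \<open>h \<in> S\<close> \<open>h' \<in> S\<close>
      by (intro bexI[of _ "h * h'"]) (auto simp: mult_ac intro: mult_S)
  qed
  have pb_S: "peval c b g \<in> S" for g
    by (intro peval_S c b)
  \<comment> \<open>The list \<open>D\<close> records denominators: labels by whose product the
    value has to be multiplied to become the polynomial \<open>F\<close>. The same \<open>D\<close>
    and \<open>F\<close> serve for the generic point and for the specialization modulo
    \<open>N\<close>.\<close>
  have "\<exists>D F. set D \<subseteq> labels es \<and>
      peval fconst ((!) (coords generic es)) f * prod_list (map generic D) = Fract F 1 \<and>
      peval c b f * prod_list (map G D) \<approx> ev F"
    using f(1)
  proof (induction rule: cube_ring_induct)
    case (Const a)
    show ?case
      by (rule exI[of _ "[]"], rule exI[of _ "Const a"])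
        (simp add: ev_simps peval_Const[OF c(1)] peval_Const[OF semiring_hom_fconst] fconst_def[symmetric])
  next
    case (Var i)
    obtain v w where vw: "es ! i = (v, w)" by fastforce
    then have l: "v \<in> labels es" "w \<in> labels es" using labels_nth Var by blast+
    then have "generic v \<noteq> 0" using nz valuation_nonzero[OF valuation_generic] by metis
    then have "coords generic es ! i * generic v = generic v - generic w"
      using Var vw by (simp add: nth_coords field_simps)
    also have "\<dots> = Fract (label_poly v - label_poly w) 1"
      by (simp add: generic_def)
    finally have "coords generic es ! i * generic v = Fract (label_poly v - label_poly w) 1" .
    moreover have "b i * G v \<approx> ev (label_poly v - label_poly w)"
      unfolding ev_simps using rel[OF Var vw] eqv_diff[OF ev_label[OF l(1)] ev_label[OF l(2)]]
      by (rule eqv_trans)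
    ultimately show ?case using l
      by (intro exI[of _ "[v]"] exI[of _ "label_poly v - label_poly w"])
        (simp add: peval_Var[OF c(1)] peval_Var[OF semiring_hom_fconst])
  next
    case (add p q)
    then obtain D F D' F' where D: "set D \<subseteq> labels es" "set D' \<subseteq> labels es"
      and 1: "peval fconst ((!) (coords generic es)) p * prod_list (map generic D) = Fract F 1"
        "peval fconst ((!) (coords generic es)) q * prod_list (map generic D') = Fract F' 1"
      and 2: "peval c b p * prod_list (map G D) \<approx> ev F" "peval c b q * prod_list (map G D') \<approx> ev F'"
      by metis
    let ?F = "F * prod_list (map label_poly D') + F' * prod_list (map label_poly D)"
    have "peval fconst ((!) (coords generic es)) (p + q) * prod_list (map generic (D @ D'))
        = (peval fconst ((!) (coords generic es)) p * prod_list (map generic D)) * prod_list (map generic D')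
          + (peval fconst ((!) (coords generic es)) q * prod_list (map generic D')) * prod_list (map generic D)"
      by (simp add: peval_add[OF semiring_hom_fconst] algebra_simps)
    also have "\<dots> = Fract ?F 1"
      by (simp only: 1) (simp add: generic_prod_list)
    finally have A: "peval fconst ((!) (coords generic es)) (p + q) * prod_list (map generic (D @ D')) = Fract ?F 1" .
    have "(peval c b p * prod_list (map G D)) * prod_list (map G D')
        + (peval c b q * prod_list (map G D')) * prod_list (map G D) \<approx> ev ?F"
      unfolding ev_simps using D
      by (intro eqv_add eqv_mult 2 ev_prod GD_S ev_S)
    then have B: "peval c b (p + q) * prod_list (map G (D @ D')) \<approx> ev ?F"
      by (simp add: peval_add[OF c(1)] algebra_simps)
    show ?case using A B D by (intro exI[of _ "D @ D'"] exI[of _ ?F]) simp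
  next
    case (mult p q)
    then obtain D F D' F' where D: "set D \<subseteq> labels es" "set D' \<subseteq> labels es"
      and 1: "peval fconst ((!) (coords generic es)) p * prod_list (map generic D) = Fract F 1"
        "peval fconst ((!) (coords generic es)) q * prod_list (map generic D') = Fract F' 1"
      and 2: "peval c b p * prod_list (map G D) \<approx> ev F" "peval c b q * prod_list (map G D') \<approx> ev F'"
      by metis
    have "peval fconst ((!) (coords generic es)) (p * q) * prod_list (map generic (D @ D'))
        = (peval fconst ((!) (coords generic es)) p * prod_list (map generic D))
          * (peval fconst ((!) (coords generic es)) q * prod_list (map generic D'))"
      by (simp add: peval_mult[OF semiring_hom_fconst] mult_ac)
    also have "\<dots> = Fract (F * F') 1"
      unfolding 1 by simp
    finally have A: "peval fconst ((!) (coords generic es)) (p * q) * prod_list (map generic (D @ D')) = Fract (F * F') 1" .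
    have "(peval c b p * prod_list (map G D)) * (peval c b q * prod_list (map G D')) \<approx> ev (F * F')"
      unfolding ev_simps by (intro eqv_mult 2 mult_S pb_S GD_S ev_S)
    then have B: "peval c b (p * q) * prod_list (map G (D @ D')) \<approx> ev (F * F')"
      by (simp add: peval_mult[OF c(1)] mult_ac)
    show ?case using A B D by (intro exI[of _ "D @ D'"] exI[of _ "F * F'"]) simp
  qed
  then obtain D F where D: "set D \<subseteq> labels es" and F: "Fract F 1 = 0"
    and N: "peval c b f * prod_list (map G D) \<approx> ev F"
    using f(2) by auto
  have "ev F = 0" using F by (simp add: ev_def)
  then have "peval c b f * prod_list (map G D) \<in> N"
    using N by (simp add: eqv_def)
  then show ?thesis
    using inv_prod[OF D] unit_cancel pb_S by blast
qed

text \<open>The generic point specializes to every other one: \<open>relation_transfer\<close> is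
  applied to the whole field with the zero ideal, where the nonzero labels are invertible.\<close>

lemma vanishing_points:
  assumes nz: "Cst 0 \<notin> labels es"
  shows "vanishing (length es) (points es) =
    {f \<in> carrier (cube_ring (length es)). peval fconst ((!) (coords generic es)) f = 0}"
proof (intro equalityI subsetI)
  fix f assume "f \<in> vanishing (length es) (points es)"
  then show "f \<in> {f \<in> carrier (cube_ring (length es)). peval fconst ((!) (coords generic es)) f = 0}"
    using valuation_generic by (auto simp: vanishing_def points_def)
next
  fix f assume f: "f \<in> {f \<in> carrier (cube_ring (length es)). peval fconst ((!) (coords generic es)) f = 0}"
  interpret subring_ideal UNIV "{0 :: 'a mpoly fract}"
    by unfold_locales auto
  have inv: "\<exists>h. x * h = 1" if "x \<noteq> 0" for x :: "'a mpoly fract"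
    using that by (intro exI[of _ "inverse x"]) simp
  have "peval fconst ((!) (coords \<alpha> es)) f = 0" if \<alpha>: "valuation \<alpha>" for \<alpha>
  proof -
    have "\<alpha> l \<noteq> 0" if "l \<in> labels es" for l
      using that nz valuation_nonzero[OF \<alpha>] by metis
    then have "peval fconst ((!) (coords \<alpha> es)) f \<in> {0}"
      using f \<alpha> nz
      by (intro relation_transfer[where es = es and G = \<alpha>])
        (auto simp: semiring_hom_fconst eqv_def valuation_def nth_coords left_diff_distrib labels_nth
          intro!: inv)
    then show ?thesis by simp
  qed
  then show "f \<in> vanishing (length es) (points es)"
    using f by (auto simp: vanishing_def points_def)
qed

lemma ideal_subring_ideal:
  assumes "ideal N (cube_ring k)"
  shows "subring_ideal (carrier (cube_ring k)) N"
proof -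
  interpret ideal N "cube_ring k" by fact
  show ?thesis
  proof
    show "x \<in> N \<Longrightarrow> y \<in> N \<Longrightarrow> x + y \<in> N" for x y
      using additive_subgroup.a_closed[OF is_additive_subgroup, of x y] by simp
    show "x \<in> carrier (cube_ring k) \<Longrightarrow> y \<in> N \<Longrightarrow> x * y \<in> N" for x y
      using I_l_closed[of y x] by simp
    show "0 \<in> N" using additive_subgroup.zero_closed[OF is_additive_subgroup] by simp
  qed (auto intro: cube_ring_closed a_Hcarr)
qed

section \<open>Prime ideals and algebraic independence\<close>

text \<open>Gaussian elimination by induction on the equations. If row \<open>i\<close> has a pivot
  \<open>p\<close>, this unknown is eliminated from the other rows, which leaves one equation and
  one unknown fewer.\<close>

lemma homogeneous_system_solution:
  fixes a :: "'i \<Rightarrow> 'b \<Rightarrow> 'k::field"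
  assumes "finite A" "finite B" "card A < card B"
  shows "\<exists>x. (\<exists>b\<in>B. x b \<noteq> 0) \<and> (\<forall>i\<in>A. (\<Sum>b\<in>B. a i b * x b) = 0)"
  using assms
proof (induction A arbitrary: a B rule: finite_induct)
  case empty
  then obtain b where "b \<in> B" by fastforce
  then show ?case by (intro exI[of _ "\<lambda>_. 1"]) auto
next
  case (insert i A)
  show ?case
  proof (cases "\<forall>b\<in>B. a i b = 0")
    case True
    have "card A < card B" using insert by simp
    then obtain x where "\<exists>b\<in>B. x b \<noteq> 0" "\<forall>i\<in>A. (\<Sum>b\<in>B. a i b * x b) = 0"
      using insert.IH[of B a] insert.prems(1) by blast
    then show ?thesis using True by (intro exI[of _ x]) auto
  next
    case False
    then obtain p where p: "p \<in> B" "a i p \<noteq> 0" by blast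
    define B' where "B' = B - {p}"
    have B': "finite B'" "B = insert p B'" "p \<notin> B'" "card A < card B'"
      using insert p by (auto simp: B'_def card_Diff_singleton)
    obtain x where x: "\<exists>b\<in>B'. x b \<noteq> 0"
      "\<forall>j\<in>A. (\<Sum>b\<in>B'. (a j b - a j p * a i b / a i p) * x b) = 0"
      using insert.IH[OF B'(1,4), of "\<lambda>j b. a j b - a j p * a i b / a i p"] by blast
    define s where "s = (\<Sum>b\<in>B'. a i b * x b)"
    \<comment> \<open>The value at the pivot is forced by row \<open>i\<close>; in the other rows it
      contributes exactly the correction of the eliminated coefficients.\<close>
    define y where "y = x(p := - s / a i p)"
    have y: "y b = x b" if "b \<in> B'" for b using that B' by (auto simp: y_def)
    have sum_y: "(\<Sum>b\<in>B. a j b * y b) = (\<Sum>b\<in>B'. a j b * x b) - a j p * s / a i p" for j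
      using B' y by (simp add: y_def sum.insert)
    have "(\<Sum>b\<in>B. a i b * y b) = 0"
      unfolding sum_y using p by (simp add: s_def)
    moreover have "(\<Sum>b\<in>B. a j b * y b) = 0" if "j \<in> A" for j
    proof -
      have "0 = (\<Sum>b\<in>B'. (a j b - a j p * a i b / a i p) * x b)" using x that by simp
      also have "\<dots> = (\<Sum>b\<in>B'. a j b * x b) - a j p * s / a i p"
        by (simp add: s_def algebra_simps sum_subtractf sum_distrib_left sum_divide_distrib)
      finally show ?thesis using sum_y by simp
    qed
    ultimately show ?thesis using x(1) B' y by (intro exI[of _ y]) auto
  qed
qed

lemma cube_ring_idealI:
  assumes "I \<subseteq> carrier (cube_ring k)" "0 \<in> I" "\<And>x y. x \<in> I \<Longrightarrow> y \<in> I \<Longrightarrow> x + y \<in> I"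
    and mult: "\<And>x y. x \<in> I \<Longrightarrow> y \<in> carrier (cube_ring k) \<Longrightarrow> y * x \<in> I"
  shows "ideal I (cube_ring k :: 'a::field mpoly ring)"
proof -
  interpret R: cring "cube_ring k :: 'a mpoly ring" by (rule cube_ring_cring)
  have "\<ominus>\<^bsub>cube_ring k\<^esub> x \<in> I" if x: "x \<in> I" for x
  proof -
    have "- x \<in> I" using mult[OF x cube_ring_uminus[OF cube_ring_1]] by simp
    moreover have "\<ominus>\<^bsub>cube_ring k\<^esub> x = - x"
      using x assms(1) by (intro R.minus_equality) (auto intro: cube_ring_closed)
    ultimately show ?thesis by simp
  qed
  then have "subgroup I (add_monoid (cube_ring k))"
    using assms by (intro subgroup.intro) (auto simp: a_inv_def)
  then show ?thesis
    using assms by (intro idealI) (auto simp: mult.commute R.ring_axioms)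
qed

lemma cube_ring_idealD:
  assumes "ideal I (cube_ring k)"
  shows "I \<subseteq> carrier (cube_ring k)" "0 \<in> I" "\<And>x y. x \<in> I \<Longrightarrow> y \<in> I \<Longrightarrow> x + y \<in> I"
    "\<And>x y. x \<in> I \<Longrightarrow> y \<in> carrier (cube_ring k) \<Longrightarrow> y * x \<in> I" "\<And>x y. x \<in> I \<Longrightarrow> y \<in> I \<Longrightarrow> x - y \<in> I"
proof -
  interpret subring_ideal "carrier (cube_ring k)" I using assms by (rule ideal_subring_ideal)
  show "I \<subseteq> carrier (cube_ring k)" "0 \<in> I" "\<And>x y. x \<in> I \<Longrightarrow> y \<in> I \<Longrightarrow> x + y \<in> I"
    "\<And>x y. x \<in> I \<Longrightarrow> y \<in> carrier (cube_ring k) \<Longrightarrow> y * x \<in> I"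
    using N_S zero_N add_N mult_N by auto
  show "x - y \<in> I" if "x \<in> I" "y \<in> I" for x y using add_N[OF that(1) uminus_N[OF that(2)]] by simp
qed

lemma primeideal_kernel:
  fixes h :: "'a::field mpoly \<Rightarrow> 'b::idom"
  assumes "\<And>x y. h (x + y) = h x + h y" "\<And>x y. h (x * y) = h x * h y" "h 1 = 1"
  shows "primeideal {f \<in> carrier (cube_ring k). h f = 0} (cube_ring k)"
proof (rule primeidealI)
  have "h 0 + h 0 = h 0 + 0" using assms(1)[of 0 0] by (simp only: add_0_right)
  then have "h 0 = 0" by (simp only: add_left_cancel)
  then show "ideal {f \<in> carrier (cube_ring k). h f = 0} (cube_ring k)"
    using assms by (intro cube_ring_idealI) (auto intro: cube_ring_closed)
  show "cring (cube_ring k :: 'a mpoly ring)" by (rule cube_ring_cring)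
  have "1 \<notin> {f \<in> carrier (cube_ring k). h f = 0}" using assms(3) by simp
  then show "carrier (cube_ring k) \<noteq> {f \<in> carrier (cube_ring k). h f = 0}"
    using cube_ring_1[of k] by metis
qed (use assms in auto)

lemma primeidealD:
  assumes "primeideal P (cube_ring k :: 'a::field mpoly ring)"
  shows "ideal P (cube_ring k)" "1 \<notin> P"
    "\<And>x y. x * y \<in> P \<Longrightarrow> x \<in> carrier (cube_ring k) \<Longrightarrow> y \<in> carrier (cube_ring k) \<Longrightarrow> x \<in> P \<or> y \<in> P"
proof -
  interpret primeideal P "cube_ring k" by fact
  show I: "ideal P (cube_ring k)" by (rule is_ideal)
  show "1 \<notin> P"
    using I_notcarr cube_ring_idealD(1,4)[OF I] by fastforce
  show "x \<in> P \<or> y \<in> P" if "x * y \<in> P" "x \<in> carrier (cube_ring k)" "y \<in> carrier (cube_ring k)" for x y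
    using I_prime[of x y] that by simp
qed

section \<open>Algebraic independence modulo a prime, in place of transcendence degree\<close>

definition alg_indep_mod :: "nat \<Rightarrow> (nat \<Rightarrow> 'a::field mpoly) \<Rightarrow> 'a mpoly set \<Rightarrow> bool" where
  "alg_indep_mod n F P \<longleftrightarrow> (\<forall>H\<in>carrier (cube_ring n). peval Const F H \<in> P \<longrightarrow> H = 0)"

text \<open>Division by the last variable. The formula for the coefficients of the quotient lets an
  induction follow one monomial of \<open>H\<close> while its exponent in this variable
  drops.\<close>

lemma split_off_variable:
  assumes "H \<in> carrier (cube_ring (Suc n))"
  obtains H0 H1 where "H0 \<in> carrier (cube_ring n)" "H1 \<in> carrier (cube_ring (Suc n))"
    "H = H0 + Var n * H1"
    "\<And>m. Poly_Mapping.lookup H1 m = Poly_Mapping.lookup H (Poly_Mapping.single n 1 + m)"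
proof -
  let ?l = Poly_Mapping.lookup and ?k = Poly_Mapping.keys and ?s = Poly_Mapping.single
  define A where "A = {m \<in> ?k H. ?l m n = 0}"
  define B where "B = {m \<in> ?k H. ?l m n \<noteq> 0}"
  define H0 where "H0 = (\<Sum>m\<in>A. ?s m (?l H m))"
  define H1 where "H1 = (\<Sum>m\<in>B. ?s (m - ?s n 1) (?l H m))"
  have AB: "?k H = A \<union> B" "A \<inter> B = {}" "finite A" "finite B" by (auto simp: A_def B_def)
  have shift: "?s n 1 + (m - ?s n 1) = m" if "m \<in> B" for m
    using that by (intro poly_mapping_eqI) (auto simp: lookup_add lookup_minus lookup_single when_def B_def)
  have "H0 \<in> carrier (cube_ring n)"
  proof -
    have "?s m (?l H m) \<in> carrier (cube_ring n)" if "m \<in> A" for m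
    proof -
      have "?k m \<subseteq> {..<Suc n}" "?l m n = 0" using that assms by (auto simp: mem_cube_ring A_def)
      then have "?k m \<subseteq> {..<n}" by (metis in_keys_iff lessThan_Suc subset_insert)
      then show ?thesis by (auto simp: mem_cube_ring)
    qed
    then show ?thesis unfolding H0_def by (rule cube_ring_sum)
  qed
  moreover have "H1 \<in> carrier (cube_ring (Suc n))"
  proof -
    have "?s (m - ?s n 1) (?l H m) \<in> carrier (cube_ring (Suc n))" if "m \<in> B" for m
    proof -
      have "?k m \<subseteq> {..<Suc n}" using that assms by (auto simp: mem_cube_ring B_def)
      moreover have "?k (m - ?s n 1) \<subseteq> ?k m" by (auto simp: in_keys_iff lookup_minus)
      ultimately show ?thesis by (auto simp: mem_cube_ring)
    qed
    then show ?thesis unfolding H1_def by (rule cube_ring_sum)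
  qed
  moreover have H: "H = H0 + Var n * H1"
  proof -
    have "Var n * H1 = (\<Sum>m\<in>B. ?s m (?l H m))"
      unfolding H1_def Var_def sum_distrib_left
      by (intro sum.cong refl) (simp only: mult_single shift mult_1_left)
    moreover have "H = (\<Sum>m\<in>A \<union> B. ?s m (?l H m))"
      using sum_single_keys[of H] AB(1) by simp
    ultimately show ?thesis using AB by (simp add: H0_def sum.union_disjoint)
  qed
  moreover have "?l H1 m = ?l H (?s n 1 + m)" for m
  proof -
    have inj: "?s n 1 + x = ?s n 1 + m \<longleftrightarrow> x = m" for x :: "nat \<Rightarrow>\<^sub>0 nat" by simp
    have "?l H0 (?s n 1 + m) = 0"
      unfolding H0_def lookup_sum
      by (intro sum.neutral ballI) (auto simp: lookup_single when_def A_def lookup_add)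
    moreover have "?l (Var n * H1) (?s n 1 + m) = ?l H1 m"
    proof -
      have "Var n * H1 = (\<Sum>x\<in>?k H1. ?s (?s n 1 + x) (?l H1 x))"
        by (subst (1) sum_single_keys[of H1, symmetric])
          (simp add: Var_def sum_distrib_left mult_single)
      then have "?l (Var n * H1) (?s n 1 + m) = (\<Sum>x\<in>?k H1. ?l H1 x when x = m)"
        by (simp add: lookup_sum lookup_single)
      then show ?thesis by (simp add: when_def in_keys_iff)
    qed
    moreover have "?l H x = ?l H0 x + ?l (Var n * H1) x" for x
      using arg_cong[OF H, of "\<lambda>q. ?l q x"] by (simp only: lookup_add)
    ultimately show ?thesis by simp
  qed
  ultimately show ?thesis by (rule that)
qed

text \<open>This is the growth of dimension along a strict inclusion of primes. In a relation modulo
  \<open>P\<close> between the old elements and \<open>g\<close>, factors \<open>g\<close> can be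
  cancelled because \<open>P\<close> is prime and does not contain \<open>g\<close>. Once some term
  is free of \<open>g\<close>, reduction modulo \<open>Q\<close> kills the terms with
  \<open>g\<close> and leaves a nontrivial relation between the old elements.\<close>

lemma alg_indep_mod_extend:
  fixes P Q :: "'a::field mpoly set"
  assumes P: "primeideal P (cube_ring k)" and Q: "ideal Q (cube_ring k)" "P \<subseteq> Q"
    and g: "g \<in> Q" "g \<notin> P" and F: "\<And>i. F i \<in> carrier (cube_ring k)"
    and indep: "alg_indep_mod n F Q"
  shows "alg_indep_mod (Suc n) (F(n := g)) P"
proof -
  let ?l = Poly_Mapping.lookup
  define ev where "ev = peval Const (F(n := g))"
  note ev_simps = peval_simps[OF semiring_hom_Const, of "F(n := g)", folded ev_def]
  note Q' = cube_ring_idealD[OF Q(1)]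
  have g_car: "g \<in> carrier (cube_ring k)" using g Q' by auto
  have ev_car: "ev H \<in> carrier (cube_ring k)" if "H \<in> carrier (cube_ring (Suc n))" for H
    unfolding ev_def using that F g_car by (intro peval_closed) auto
  \<comment> \<open>Induction on the exponent of the last variable in one monomial \<open>m\<close>
    of \<open>H\<close>: at 0 the part \<open>H0\<close> is nonzero, and otherwise either
    \<open>H0\<close> is nonzero or a factor \<open>g\<close> can be split off.\<close>
  have "ev H \<notin> P" if "H \<in> carrier (cube_ring (Suc n))" "m \<in> Poly_Mapping.keys H" "?l m n = e" for H m e
    using that
  proof (induction e arbitrary: H m)
    case (0 H m)
    obtain H0 H1 where H: "H0 \<in> carrier (cube_ring n)" "H1 \<in> carrier (cube_ring (Suc n))"
      "H = H0 + Var n * H1" "\<And>m. ?l H1 m = ?l H (Poly_Mapping.single n 1 + m)"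
      using split_off_variable[OF 0(1)] by blast
    have "H0 \<noteq> 0"
    proof
      assume "H0 = 0"
      then have "m \<in> Poly_Mapping.keys (Var n * H1)" using H(3) 0(2) by simp
      then obtain b where "m = Poly_Mapping.single n 1 + b"
        using Poly_Mapping.keys_mult[of "Var n" H1] by (auto simp: Var_def)
      then show False using 0(3) by (simp add: lookup_add)
    qed
    have "ev H0 = peval Const F H0"
      unfolding ev_def by (rule peval_cong[OF H(1)]) auto
    then have "ev H0 \<notin> Q" using indep H(1) \<open>H0 \<noteq> 0\<close> by (auto simp: alg_indep_mod_def)
    moreover have "ev H0 = ev H - ev H1 * g" by (simp add: H(3) ev_simps)
    moreover have "ev H1 * g \<in> Q" using Q'(4) g(1) ev_car H(2) by blast
    ultimately have "ev H \<notin> Q" using Q'(5) by metis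
    then show ?case using Q(2) by blast
  next
    case (Suc e H m)
    obtain H0 H1 where H: "H0 \<in> carrier (cube_ring n)" "H1 \<in> carrier (cube_ring (Suc n))"
      "H = H0 + Var n * H1" "\<And>m. ?l H1 m = ?l H (Poly_Mapping.single n 1 + m)"
      using split_off_variable[OF Suc.prems(1)] by blast
    have *: "ev H = ev H0 + g * ev H1" by (simp add: H(3) ev_simps)
    show ?case
    proof (cases "H0 = 0")
      case True
      have m: "Poly_Mapping.single n 1 + (m - Poly_Mapping.single n 1) = m"
        using Suc.prems(3) by (intro poly_mapping_eqI) (auto simp: lookup_add lookup_minus lookup_single when_def)
      have "ev H1 \<notin> P"
        using Suc.prems by (intro Suc.IH[of H1 "m - Poly_Mapping.single n 1"] H(2))
          (auto simp: in_keys_iff H(4) m[unfolded One_nat_def] lookup_minus)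
      then show ?thesis
        using True * g(2) primeidealD(3)[OF P, of g "ev H1"] g_car ev_car[OF H(2)] by (auto simp: ev_def)
    next
      case False
      have "ev H0 = peval Const F H0"
        unfolding ev_def by (rule peval_cong[OF H(1)]) auto
      then have "ev H0 \<notin> Q" using indep H(1) False by (auto simp: alg_indep_mod_def)
      moreover have "ev H0 = ev H - ev H1 * g" using * by (simp add: mult.commute)
      moreover have "ev H1 * g \<in> Q" using Q'(4) g(1) ev_car H(2) by blast
      ultimately have "ev H \<notin> Q" using Q'(5) by metis
      then show ?thesis using Q(2) by blast
    qed
  qed
  then show ?thesis
    unfolding alg_indep_mod_def ev_def[symmetric] by (metis keys_eq_empty ex_in_conv)
qed

text \<open>Going down the chain, every strict inclusion contributes one new independent
  element.\<close>

lemma alg_indep_mod_chain: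
  fixes c :: "nat \<Rightarrow> 'a::field mpoly set"
  assumes "\<And>i. i \<le> n \<Longrightarrow> primeideal (c i) (cube_ring k)" "\<And>i. i < n \<Longrightarrow> c i \<subset> c (Suc i)"
    and "\<And>i. F i \<in> carrier (cube_ring k)" "alg_indep_mod r F (c n)"
  shows "\<exists>F'. (\<forall>i. F' i \<in> carrier (cube_ring k)) \<and> alg_indep_mod (n + r) F' (c 0)"
  using assms
proof (induction n arbitrary: F r)
  case 0
  then show ?case by auto
next
  case (Suc n)
  obtain g where g: "g \<in> c (Suc n)" "g \<notin> c n" using Suc.prems(2)[of n] by auto
  have id: "ideal (c (Suc n)) (cube_ring k)" using Suc.prems(1) primeidealD(1) by blast
  have "alg_indep_mod (Suc r) (F(r := g)) (c n)"
    by (rule alg_indep_mod_extend[OF _ id _ g]) (use Suc.prems(1)[of n] Suc.prems(2)[of n] Suc.prems(3,4) in auto)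
  then have "\<exists>F'. (\<forall>i. F' i \<in> carrier (cube_ring k)) \<and> alg_indep_mod (n + Suc r) F' (c 0)"
    using Suc.prems cube_ring_idealD(1)[OF id] g by (intro Suc.IH) auto
  then show ?case by simp
qed

section \<open>Upper bounds for the number of independent elements, by counting monomials\<close>

definition degree_bound :: "nat set \<Rightarrow> nat \<Rightarrow> 'a::field mpoly \<Rightarrow> bool" where
  "degree_bound A d f \<longleftrightarrow> (\<forall>m\<in>Poly_Mapping.keys f. Poly_Mapping.keys m \<subseteq> A \<and> (\<forall>i. Poly_Mapping.lookup m i \<le> d))"

lemma degree_bound_mult:
  assumes "degree_bound A d f" "degree_bound A e g"
  shows "degree_bound A (d + e) (f * g)"
  unfolding degree_bound_def
proof (rule ballI)
  fix m assume "m \<in> Poly_Mapping.keys (f * g)"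
  then obtain a b where "m = a + b" "a \<in> Poly_Mapping.keys f" "b \<in> Poly_Mapping.keys g"
    using Poly_Mapping.keys_mult[of f g] by blast
  then show "Poly_Mapping.keys m \<subseteq> A \<and> (\<forall>i. Poly_Mapping.lookup m i \<le> d + e)"
    using assms Poly_Mapping.keys_add[of a b] unfolding degree_bound_def
    by (simp add: lookup_add add_mono) blast
qed

lemma degree_bound_1: "degree_bound A 0 1"
  by (simp add: degree_bound_def)

lemma degree_bound_power: "degree_bound A d f \<Longrightarrow> degree_bound A (n * d) (f ^ n)"
  by (induction n) (auto intro: degree_bound_1 degree_bound_mult)

lemma degree_bound_prod:
  "finite X \<Longrightarrow> (\<And>x. x \<in> X \<Longrightarrow> degree_bound A (d x) (f x)) \<Longrightarrow> degree_bound A (sum d X) (prod f X)"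
  by (induction X rule: finite_induct) (auto intro: degree_bound_1 degree_bound_mult)

lemma degree_bound_mono: "degree_bound A d f \<Longrightarrow> d \<le> e \<Longrightarrow> degree_bound A e f"
  unfolding degree_bound_def by (meson order_trans)

text \<open>A box of exponents instead of a bound on the total degree: its size is exactly a power,
  which keeps the comparison of dimensions elementary.\<close>

definition monoms_below :: "nat set \<Rightarrow> nat \<Rightarrow> (nat \<Rightarrow>\<^sub>0 nat) set" where
  "monoms_below A e = {m. Poly_Mapping.keys m \<subseteq> A \<and> (\<forall>i. Poly_Mapping.lookup m i < e)}"

lemma monoms_below_card:
  assumes "finite A" "0 < e"
  shows "finite (monoms_below A e)" "card (monoms_below A e) = e ^ card A"
proof -
  let ?r = "\<lambda>m. restrict (Poly_Mapping.lookup m) A"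
  have "bij_betw ?r (monoms_below A e) (A \<rightarrow>\<^sub>E {..<e})"
  proof (rule bij_betw_imageI)
    show "inj_on ?r (monoms_below A e)"
    proof (rule inj_onI, rule poly_mapping_eqI)
      fix m m' i assume m: "m \<in> monoms_below A e" "m' \<in> monoms_below A e" "?r m = ?r m'"
      show "Poly_Mapping.lookup m i = Poly_Mapping.lookup m' i"
      proof (cases "i \<in> A")
        case True then show ?thesis using m(3) by (metis restrict_apply')
      next
        case False
        then have "i \<notin> Poly_Mapping.keys m" "i \<notin> Poly_Mapping.keys m'"
          using m by (auto simp: monoms_below_def)
        then show ?thesis by (simp add: in_keys_iff)
      qed
    qed
    show "?r ` monoms_below A e = A \<rightarrow>\<^sub>E {..<e}"
    proof (intro equalityI subsetI)
      fix h assume h: "h \<in> A \<rightarrow>\<^sub>E {..<e}"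
      define m where "m = Abs_poly_mapping (\<lambda>i. if i \<in> A then h i else 0)"
      have "finite {i. (if i \<in> A then h i else 0) \<noteq> 0}"
        by (rule finite_subset[OF _ assms(1)]) auto
      then have l: "Poly_Mapping.lookup m = (\<lambda>i. if i \<in> A then h i else 0)"
        by (simp add: m_def)
      have "m \<in> monoms_below A e"
        using h assms(2) by (auto simp: monoms_below_def l in_keys_iff PiE_iff split: if_splits)
      moreover have "h = ?r m"
        using h by (auto simp: l fun_eq_iff PiE_iff extensional_def)
      ultimately show "h \<in> ?r ` monoms_below A e" by blast
    qed (auto simp: monoms_below_def)
  qed
  then show "finite (monoms_below A e)" "card (monoms_below A e) = e ^ card A"
    using assms by (auto simp: bij_betw_finite bij_betw_same_card card_PiE finite_PiE)
qed

lemma lookup_Const_mult: "Poly_Mapping.lookup (Const a * f) m = a * Poly_Mapping.lookup f m"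
  for f :: "'a::field mpoly"
  unfolding Const_def mult_map_scale_conv_mult[symmetric]
  by (simp add: Poly_Mapping.map.rep_eq when_def)

text \<open>Polynomials in the \<open>n\<close> given elements with all exponents below \<open>e\<close> span a space of dimension
  \<open>e ^ n\<close>, if these elements are independent, while their values have only about
  \<open>e ^ card A\<close> monomials.\<close>

lemma alg_dependent:
  fixes F :: "nat \<Rightarrow> 'a::field mpoly"
  assumes A: "finite A" "card A < n"
    and F: "\<And>i m. i < n \<Longrightarrow> m \<in> Poly_Mapping.keys (F i) \<Longrightarrow> Poly_Mapping.keys m \<subseteq> A"
  shows "\<exists>H\<in>carrier (cube_ring n). H \<noteq> 0 \<and> peval Const F H = 0"
proof -
  let ?l = Poly_Mapping.lookup
  define E where "E = (\<Union>i<n. \<Union>m\<in>Poly_Mapping.keys (F i). Poly_Mapping.range m)"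
  \<comment> \<open>A common bound for all exponents in the values \<open>F i\<close>; 0 is inserted
    because \<open>E\<close> may be empty.\<close>
  define d where "d = Max (insert 0 E)"
  have "finite E" unfolding E_def by auto
  then have d: "degree_bound A d (F i)" if "i < n" for i
    unfolding degree_bound_def
  proof (intro ballI conjI allI)
    fix m j assume m: "m \<in> Poly_Mapping.keys (F i)"
    show "Poly_Mapping.keys m \<subseteq> A" using F that m by blast
    show "?l m j \<le> d"
    proof (cases "j \<in> Poly_Mapping.keys m")
      case True
      then have "?l m j \<in> Poly_Mapping.range m" by (rule in_keys_lookup_in_range)
      then have "?l m j \<in> E" using m that by (auto simp: E_def)
      then show ?thesis using \<open>finite E\<close> by (simp add: d_def)
    qed (simp add: in_keys_iff)
  qed
  \<comment> \<open>With \<open>a = card A\<close>, a product with exponents below \<open>e\<close>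
    has a value with exponents below \<open>e'\<close>, and \<open>e'\<close> is at most
    \<open>e * (n * d + 1)\<close>. Taking \<open>e\<close> larger than
    \<open>(n * d + 1) ^ a\<close> makes \<open>e' ^ a\<close> smaller than
    \<open>e ^ (a + 1)\<close>, hence smaller than \<open>e ^ n\<close>: there are fewer equations
    than unknowns.\<close>
  define e where "e = (n * d + 1) ^ card A + 1"
  define e' where "e' = n * (e * d) + 1"
  have e: "(n * d + 1) ^ card A < e" "0 < e" by (simp_all add: e_def)
  then have "e' \<le> e * (n * d + 1)" by (simp add: e'_def algebra_simps)
  then have "e' ^ card A \<le> (e * (n * d + 1)) ^ card A"
    by (rule power_mono) simp
  also have "\<dots> = e ^ card A * (n * d + 1) ^ card A"
    by (rule power_mult_distrib)
  also have "\<dots> < e ^ card A * e"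
    using e by (intro mult_strict_left_mono) simp_all
  also have "\<dots> = e ^ Suc (card A)" by simp
  also have "\<dots> \<le> e ^ n" using A e by (intro power_increasing) simp_all
  finally have "card (monoms_below A e') < card (monoms_below {..<n} e)"
    using A e by (simp add: monoms_below_card e'_def)
  moreover have fin: "finite (monoms_below {..<n} e)" "finite (monoms_below A e')"
    using A e by (auto intro!: monoms_below_card(1) simp: e'_def)
  ultimately obtain x where x: "\<exists>b\<in>monoms_below {..<n} e. x b \<noteq> 0"
    "\<forall>m\<in>monoms_below A e'. (\<Sum>b\<in>monoms_below {..<n} e. ?l (monom_val F b) m * x b) = 0"
    using homogeneous_system_solution[of "monoms_below A e'" "monoms_below {..<n} e"
        "\<lambda>m b. ?l (monom_val F b) m"] by blast
  define H where "H = (\<Sum>b\<in>monoms_below {..<n} e. Poly_Mapping.single b (x b))"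
  have H_lookup: "?l H b = x b" if "b \<in> monoms_below {..<n} e" for b
    using that fin(1) by (simp add: H_def lookup_sum lookup_single when_def)
  have val: "monom_val F b \<in> {f. degree_bound A (n * (e * d)) f}" if b: "b \<in> monoms_below {..<n} e" for b
  proof -
    have "degree_bound A (\<Sum>i\<in>Poly_Mapping.keys b. ?l b i * d) (monom_val F b)"
      unfolding monom_val_def using b
      by (intro degree_bound_prod degree_bound_power d) (auto simp: monoms_below_def)
    moreover have "(\<Sum>i\<in>Poly_Mapping.keys b. ?l b i * d) \<le> (\<Sum>i<n. e * d)"
      using b by (intro order_trans[OF sum_mono sum_mono2])
        (auto simp: monoms_below_def less_imp_le intro!: mult_right_mono)
    ultimately show ?thesis by (auto intro: degree_bound_mono)
  qed
  have "peval Const F H = (\<Sum>b\<in>monoms_below {..<n} e. Const (x b) * monom_val F b)"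
    by (simp add: H_def peval_sum peval_single semiring_hom_Const)
  also have "\<dots> = 0"
  proof (rule poly_mapping_eqI)
    fix m
    have "(\<Sum>b\<in>monoms_below {..<n} e. ?l (monom_val F b) m * x b) = 0"
    proof (cases "m \<in> monoms_below A e'")
      case False
      have "?l (monom_val F b) m = 0" if "b \<in> monoms_below {..<n} e" for b
      proof (rule ccontr)
        assume "?l (monom_val F b) m \<noteq> 0"
        then have "Poly_Mapping.keys m \<subseteq> A \<and> (\<forall>i. ?l m i \<le> n * (e * d))"
          using val[OF that] by (simp add: degree_bound_def in_keys_iff)
        then show False using False by (auto simp: monoms_below_def e'_def less_Suc_eq_le)
      qed
      then show ?thesis by simp
    qed (use x in auto)
    then show "?l (\<Sum>b\<in>monoms_below {..<n} e. Const (x b) * monom_val F b) m = ?l 0 m"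
      by (simp add: lookup_sum lookup_Const_mult mult.commute)
  qed
  finally have "peval Const F H = 0" .
  moreover have "H \<noteq> 0" using x(1) H_lookup by force
  moreover have "H \<in> carrier (cube_ring n)"
    unfolding H_def by (intro cube_ring_sum) (auto simp: mem_cube_ring monoms_below_def split: if_splits)
  ultimately show ?thesis by blast
qed

section \<open>Coordinate faces and their ideals\<close>

definition zero_at :: "nat set \<Rightarrow> 'a::field mpoly \<Rightarrow> 'a mpoly" where
  "zero_at S = peval Const (\<lambda>i. if i \<in> S then 0 else Var i)"

definition zero_face :: "nat \<Rightarrow> nat set \<Rightarrow> 'a::field mpoly set" where
  "zero_face k S = genideal (cube_ring k) (Var ` S)"

lemma zero_face_facts:
  assumes "S \<subseteq> {..<k}"
  shows "ideal (zero_face k S) (cube_ring k :: 'a::field mpoly ring)"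
    "Var ` S \<subseteq> (zero_face k S :: 'a mpoly set)"
    "\<And>J. ideal J (cube_ring k) \<Longrightarrow> Var ` S \<subseteq> (J :: 'a mpoly set) \<Longrightarrow> zero_face k S \<subseteq> J"
proof -
  interpret R: cring "cube_ring k :: 'a mpoly ring" by (rule cube_ring_cring)
  have "Var ` S \<subseteq> carrier (cube_ring k :: 'a mpoly ring)" using assms by (auto intro: cube_ring_Var)
  note car = this
  show "ideal (zero_face k S) (cube_ring k :: 'a mpoly ring)"
    unfolding zero_face_def using car by (rule R.genideal_ideal)
  show "Var ` S \<subseteq> (zero_face k S :: 'a mpoly set)"
    unfolding zero_face_def using car by (rule R.genideal_self)
  show "zero_face k S \<subseteq> J" if "ideal J (cube_ring k)" "Var ` S \<subseteq> J" for J :: "'a mpoly set"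
    unfolding zero_face_def using that by (rule R.genideal_minimal)
qed

lemma zero_at_simps:
  "zero_at S (f + g) = zero_at S f + zero_at S g" "zero_at S (f * g) = zero_at S f * zero_at S g"
  "zero_at S (Const a) = Const a" "zero_at S (Var i) = (if i \<in> S then 0 else Var i)" "zero_at S 1 = 1"
  by (simp_all add: zero_at_def peval_simps semiring_hom_Const)

lemma zero_at_kernel:
  fixes f :: "'a::field mpoly"
  assumes S: "S \<subseteq> {..<k}" and f: "f \<in> carrier (cube_ring k)" "zero_at S f = 0"
  shows "f \<in> zero_face k S"
proof -
  interpret subring_ideal "carrier (cube_ring k)" "zero_face k S :: 'a mpoly set"
    by (rule ideal_subring_ideal[OF zero_face_facts(1)[OF S]])
  have car: "zero_at S g \<in> carrier (cube_ring k)" if "g \<in> carrier (cube_ring k)" for g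
    unfolding zero_at_def using that by (intro peval_closed) (auto intro: cube_ring_closed)
  have "eqv (zero_face k S) f (zero_at S f)"
    using f(1)
  proof (induction rule: cube_ring_induct)
    case (Var i)
    have "Var i \<in> (zero_face k S :: 'a mpoly set)" if "i \<in> S"
      using zero_face_facts(2)[OF S] that by blast
    then show ?case by (simp add: zero_at_simps eqv_def zero_N)
  qed (auto simp: zero_at_simps intro: eqv_add eqv_mult car)
  then show ?thesis using f(2) by (simp add: eqv_def)
qed

text \<open>On the face only \<open>k - card S\<close> variables are left, so more elements than
  that satisfy a relation after restriction. The value of this relation then lies in the face ideal,
  hence in \<open>P\<close>.\<close>

lemma alg_indep_mod_bound:
  fixes F :: "nat \<Rightarrow> 'a::field mpoly"
  assumes S: "S \<subseteq> {..<k}" and P: "zero_face k S \<subseteq> P"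
    and F: "\<And>i. F i \<in> carrier (cube_ring k)" and indep: "alg_indep_mod n F P"
  shows "n \<le> k - card S"
proof (rule ccontr)
  assume "\<not> n \<le> k - card S"
  then have "card ({..<k} - S) < n" using S by (simp add: card_Diff_subset finite_subset)
  moreover have "Poly_Mapping.keys m \<subseteq> {..<k} - S" if "m \<in> Poly_Mapping.keys (zero_at S f)"
    "f \<in> carrier (cube_ring k)" for m and f :: "'a mpoly"
  proof -
    let ?R = "{f :: 'a mpoly. \<forall>m\<in>Poly_Mapping.keys f. Poly_Mapping.keys m \<subseteq> {..<k} - S}"
    have add: "f + g \<in> ?R" if "f \<in> ?R" "g \<in> ?R" for f g
      using that Poly_Mapping.keys_add[of f g] by blast
    have mult: "f * g \<in> ?R" if "f \<in> ?R" "g \<in> ?R" for f g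
    proof -
      have "Poly_Mapping.keys m \<subseteq> {..<k} - S" if m: "m \<in> Poly_Mapping.keys (f * g)" for m
      proof -
        obtain a b where "m = a + b" "a \<in> Poly_Mapping.keys f" "b \<in> Poly_Mapping.keys g"
          using m Poly_Mapping.keys_mult[of f g] by blast
        then show ?thesis
          using \<open>f \<in> ?R\<close> \<open>g \<in> ?R\<close> Poly_Mapping.keys_add[of a b] by blast
      qed
      then show ?thesis by blast
    qed
      have "zero_at S f \<in> ?R"
      using that(2)
    proof (induction rule: cube_ring_induct)
      case (Const a)
      then show ?case by (simp add: zero_at_simps) (simp add: Const_def)
    next
      case (Var i)
      then show ?case by (simp add: zero_at_simps) (simp add: Var_def)
    next
      case (add f g)
      then show ?case unfolding zero_at_simps by (intro \<open>\<And>f g. f \<in> ?R \<Longrightarrow> g \<in> ?R \<Longrightarrow> f + g \<in> ?R\<close>)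
    next
      case (mult f g)
      then show ?case unfolding zero_at_simps by (intro \<open>\<And>f g. f \<in> ?R \<Longrightarrow> g \<in> ?R \<Longrightarrow> f * g \<in> ?R\<close>)
    qed
    then show ?thesis using that(1) by blast
  qed
  ultimately obtain H where H: "H \<in> carrier (cube_ring n)" "H \<noteq> 0" "peval Const (\<lambda>i. zero_at S (F i)) H = 0"
    using alg_dependent[of "{..<k} - S" n "\<lambda>i. zero_at S (F i)"] F by blast
  have "zero_at S (peval Const F H) = 0"
    using H(3) unfolding zero_at_def peval_peval[OF semiring_hom_Const] .
  moreover have "peval Const F H \<in> carrier (cube_ring k)"
    using H(1) F by (intro peval_closed) auto
  ultimately have "peval Const F H \<in> P" using zero_at_kernel[OF S] P by blast
  then show False using indep H by (auto simp: alg_indep_mod_def)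
qed

text \<open>The face ideal is itself prime, being the kernel of \<open>zero_at S\<close>. If
  \<open>P\<close> were larger, an element of the difference would extend \<open>F\<close> to more
  independent elements modulo the face ideal than the face has coordinates. So a variety of full
  dimension in a face is the whole face.\<close>

lemma prime_eq_zero_face:
  fixes F :: "nat \<Rightarrow> 'a::field mpoly"
  assumes S: "S \<subseteq> {..<k}" and P: "primeideal P (cube_ring k)" "zero_face k S \<subseteq> P"
    and F: "\<And>i. F i \<in> carrier (cube_ring k)" and indep: "alg_indep_mod (k - card S) F P"
  shows "P = zero_face k S"
proof -
  define K :: "'a mpoly set" where "K = {f \<in> carrier (cube_ring k). zero_at S f = 0}"
  have K: "primeideal K (cube_ring k)"
    unfolding K_def zero_at_def by (intro primeideal_kernel) (simp_all add: peval_simps semiring_hom_Const)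
  have 1: "K \<subseteq> zero_face k S" using zero_at_kernel[OF S] by (auto simp: K_def)
  have 2: "zero_face k S \<subseteq> K"
    using S by (intro zero_face_facts(3) primeidealD(1)[OF K])
      (auto simp: K_def zero_at_simps cube_ring_Var)
  have "g \<in> K" if "g \<in> P" for g
  proof (rule ccontr)
    assume "g \<notin> K"
    then have ind: "alg_indep_mod (Suc (k - card S)) (F(k - card S := g)) K"
      using that 1 P(2) by (intro alg_indep_mod_extend[OF K primeidealD(1)[OF P(1)]] F indep) auto
    have "g \<in> carrier (cube_ring k)"
      using cube_ring_idealD(1)[OF primeidealD(1)[OF P(1)]] that by blast
    then have "Suc (k - card S) \<le> k - card S"
      using F by (intro alg_indep_mod_bound[OF S 2 _ ind]) auto
    then show False by simp
  qed
  then show ?thesis using 1 P(2) by auto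
qed

section \<open>The ideal of a network\<close>

definition net_ideal :: "'a::field network \<Rightarrow> 'a mpoly set" where
  "net_ideal es = vanishing (length es) (points es)"

abbreviation gen_val :: "'a::field network \<Rightarrow> 'a mpoly \<Rightarrow> 'a mpoly fract" where
  "gen_val es \<equiv> peval fconst ((!) (coords generic es))"

lemma mem_net_ideal:
  assumes "Cst 0 \<notin> labels es"
  shows "f \<in> net_ideal es \<longleftrightarrow> f \<in> carrier (cube_ring (length es)) \<and> gen_val es f = 0"
  using assms by (simp add: net_ideal_def vanishing_points)

lemmas fconst_simps = peval_simps[OF semiring_hom_fconst]

lemma generic_nonzero: "Cst 0 \<notin> labels es \<Longrightarrow> l \<in> labels es \<Longrightarrow> generic l \<noteq> 0"
  using valuation_nonzero[OF valuation_generic] by metis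

lemma prime_net_ideal:
  assumes "Cst 0 \<notin> labels es"
  shows "primeideal (net_ideal es) (cube_ring (length es))"
proof -
  have "net_ideal es = {f \<in> carrier (cube_ring (length es)). gen_val es f = 0}"
    using mem_net_ideal[OF assms] by blast
  then show ?thesis by (simp only:) (intro primeideal_kernel fconst_simps)
qed

lemma net_ideal_subset_relabel:
  assumes "\<And>c. h (Cst c) = Cst c" "\<And>n. h (Par n) \<noteq> Cst 0"
  shows "net_ideal es \<subseteq> net_ideal (relabel h es)"
proof -
  have "valuation (\<alpha> \<circ> h)" if \<alpha>: "valuation \<alpha>" for \<alpha>
    using assms valuation_nonzero[OF \<alpha>] \<alpha> by (auto simp: valuation_def)
  then have "points (relabel h es) \<subseteq> points es"
    by (auto simp: points_def coords_relabel)
  then show ?thesis by (auto simp: net_ideal_def vanishing_def)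
qed

text \<open>The polynomial is the product of the factors \<open>1 - u\<close> along the path, where
  the intermediate labels cancel. It serves for all assignments that are nonzero on the labels, also
  for those that do not fix the constants; the chain for the codimension relies on this.\<close>

lemma path_polynomial:
  assumes "(u, v) \<in> (set es)\<^sup>*"
  shows "\<exists>g\<in>carrier (cube_ring (length es)). \<forall>\<alpha>. (\<forall>l\<in>labels es. \<alpha> l \<noteq> 0) \<longrightarrow>
    peval fconst ((!) (coords \<alpha> es)) g * \<alpha> u = \<alpha> v"
  using assms
proof (induction rule: rtrancl_induct)
  case base
  show ?case by (rule bexI[of _ 1]) (auto simp: fconst_simps cube_ring_1)
next
  case (step y z)
  then obtain g where g: "g \<in> carrier (cube_ring (length es))"
    "\<And>\<alpha>. (\<forall>l\<in>labels es. \<alpha> l \<noteq> 0) \<Longrightarrow> peval fconst ((!) (coords \<alpha> es)) g * \<alpha> u = \<alpha> y" by blast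
  obtain i where i: "i < length es" "es ! i = (y, z)" using step(2) by (metis in_set_conv_nth)
  have "peval fconst ((!) (coords \<alpha> es)) (g * (1 - Var i)) * \<alpha> u = \<alpha> z"
    if \<alpha>: "\<forall>l\<in>labels es. \<alpha> l \<noteq> 0" for \<alpha>
  proof -
    have "\<alpha> y \<noteq> 0" using \<alpha> labels_nth[OF i] by blast
    have "peval fconst ((!) (coords \<alpha> es)) (g * (1 - Var i)) * \<alpha> u
        = (peval fconst ((!) (coords \<alpha> es)) g * \<alpha> u) * (\<alpha> z / \<alpha> y)"
      using i by (simp add: fconst_simps nth_coords)
    also have "\<dots> = \<alpha> z" using g(2)[OF \<alpha>] \<open>\<alpha> y \<noteq> 0\<close> by simp
    finally show ?thesis .
  qed
  then show ?case using g(1) i(1)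
    by (intro bexI[of _ "g * (1 - Var i)"]) (auto intro: cube_ring_closed)
qed

lemma rtrancl_label: "(u, v) \<in> (set es)\<^sup>* \<Longrightarrow> v \<in> labels es \<Longrightarrow> u \<in> labels es"
  by (induction rule: converse_rtrancl_induct) (force simp: labels_def)+

lemma rtrancl_label': "(u, v) \<in> (set es)\<^sup>* \<Longrightarrow> u \<in> labels es \<Longrightarrow> v \<in> labels es"
  by (induction rule: rtrancl_induct) (force simp: labels_def)+

lemma rtrancl_relabel: "(u, v) \<in> (set es)\<^sup>* \<Longrightarrow> (h u, h v) \<in> (set (relabel h es))\<^sup>*"
proof (induction rule: rtrancl_induct)
  case (step y z)
  then have "(h y, h z) \<in> set (relabel h es)" by (force simp: set_relabel)
  then show ?case using step by auto
qed auto

text \<open>The condition under which every label and its inverse are polynomial functions on the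
  variety: a path from a constant gives the label, a path to a constant gives the inverse.\<close>

definition anchored :: "'a::field network \<Rightarrow> bool" where
  "anchored es \<longleftrightarrow> Cst 0 \<notin> labels es \<and>
    (\<forall>l\<in>labels es. (\<exists>c. (Cst c, l) \<in> (set es)\<^sup>*) \<and> (\<exists>c. (l, Cst c) \<in> (set es)\<^sup>*))"

lemma label_element:
  assumes "Cst 0 \<notin> labels es" "(Cst c, l) \<in> (set es)\<^sup>*" "l \<in> labels es"
  shows "\<exists>g\<in>carrier (cube_ring (length es)). gen_val es g = generic l"
proof -
  obtain g where g: "g \<in> carrier (cube_ring (length es))" "gen_val es g * generic (Cst c) = generic l"
    using path_polynomial[OF assms(2)] generic_nonzero[OF assms(1)] by blast
  then show ?thesis
    by (intro bexI[of _ "Const c * g"])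
      (auto simp: fconst_simps generic_Cst mult.commute intro: cube_ring_closed)
qed

text \<open>\<open>G l\<close> represents the label \<open>l\<close> and \<open>H l\<close> its
  inverse: a path from \<open>l\<close> to \<open>Cst d\<close> has the product
  \<open>d / l\<close>, which is then divided by \<open>d\<close>.\<close>

lemma anchored_elements:
  assumes "anchored es"
  obtains G H where "\<And>l. G l \<in> carrier (cube_ring (length es))" "\<And>l. H l \<in> carrier (cube_ring (length es))"
    "\<And>l. l \<in> labels es \<Longrightarrow> gen_val es (G l) = generic l"
    "\<And>l. l \<in> labels es \<Longrightarrow> gen_val es (G l * H l) = 1"
proof -
  have nz: "Cst 0 \<notin> labels es" using assms by (simp add: anchored_def)
  let ?C = "carrier (cube_ring (length es)) :: 'a mpoly set"
  have "\<exists>g\<in>?C. \<exists>h\<in>?C. l \<in> labels es \<longrightarrow> gen_val es g = generic l \<and> gen_val es (g * h) = 1" for l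
  proof (cases "l \<in> labels es")
    case True
    then obtain c d where c: "(Cst c, l) \<in> (set es)\<^sup>*" and d: "(l, Cst d) \<in> (set es)\<^sup>*"
      using assms unfolding anchored_def by blast
    obtain g where g: "g \<in> ?C" "gen_val es g = generic l"
      using label_element[OF nz c True] by blast
    obtain h where h: "h \<in> ?C" "gen_val es h * generic l = generic (Cst d)"
      using path_polynomial[OF d] generic_nonzero[OF nz] by blast
    have "Cst d \<in> labels es" using rtrancl_label'[OF d True] .
    then have "d \<noteq> 0" using nz by auto
    have "gen_val es (g * (Const (inverse d) * h)) = fconst (inverse d) * (gen_val es h * generic l)"
      by (simp add: fconst_simps g(2) mult_ac)
    also have "\<dots> = fconst (inverse d * d)"
      using h(2) by (simp add: generic_Cst semiring_homD(4)[OF semiring_hom_fconst])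
    finally show ?thesis using g h \<open>d \<noteq> 0\<close>
      by (intro bexI[of _ g] bexI[of _ "Const (inverse d) * h"] impI conjI) (auto intro: cube_ring_closed)
  qed (use cube_ring_0 in blast)
  then show ?thesis using that by metis
qed

text \<open>Equality of two labels as functions modulo \<open>N\<close>. Quantifying over all
  polynomials that represent them avoids a choice of representatives.\<close>

definition label_eq :: "'a::field network \<Rightarrow> 'a mpoly set \<Rightarrow> 'a label \<Rightarrow> 'a label \<Rightarrow> bool" where
  "label_eq es N l l' \<longleftrightarrow> (\<forall>p\<in>carrier (cube_ring (length es)). \<forall>q\<in>carrier (cube_ring (length es)).
     gen_val es p = generic l \<longrightarrow> gen_val es q = generic l' \<longrightarrow> p - q \<in> N)"

lemma edge_relation:
  assumes "Cst 0 \<notin> labels es" "i < length es" "es ! i = (v, w)"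
    and p: "p \<in> carrier (cube_ring (length es))" "gen_val es p = generic v"
    and q: "q \<in> carrier (cube_ring (length es))" "gen_val es q = generic w"
  shows "Var i * p - (p - q) \<in> net_ideal es"
proof -
  have "generic v \<noteq> 0" using generic_nonzero[OF assms(1)] labels_nth[OF assms(2,3)] by blast
  then have "gen_val es (Var i * p - (p - q)) = 0"
    using assms by (simp add: fconst_simps nth_coords field_simps)
  then show ?thesis using assms by (auto simp: mem_net_ideal intro!: cube_ring_closed)
qed

lemma label_eq_refl:
  assumes "Cst 0 \<notin> labels es" "net_ideal es \<subseteq> N" shows "label_eq es N l l"
  using assms by (auto simp: label_eq_def mem_net_ideal subset_iff fconst_simps intro: cube_ring_closed)

lemma label_eq_edge:
  assumes "Cst 0 \<notin> labels es" "net_ideal es \<subseteq> N" "ideal N (cube_ring (length es))"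
    and "i < length es" "es ! i = (v, w)" "Var i \<in> N"
  shows "label_eq es N v w"
  unfolding label_eq_def
proof (intro ballI impI)
  fix p q assume pq: "p \<in> carrier (cube_ring (length es))" "q \<in> carrier (cube_ring (length es))"
    "gen_val es p = generic v" "gen_val es q = generic w"
  have "Var i * p - (p - q) \<in> N" using edge_relation[OF assms(1,4,5)] pq assms(2) by blast
  moreover have "p * Var i \<in> N" using cube_ring_idealD(4)[OF assms(3,6) pq(1)] .
  ultimately have "p * Var i - (Var i * p - (p - q)) \<in> N" using cube_ring_idealD(5)[OF assms(3)] by blast
  then show "p - q \<in> N" by (simp add: mult.commute)
qed

lemma label_eq_sym:
  assumes "ideal N (cube_ring (length es))" "label_eq es N v w" shows "label_eq es N w v"
  using assms(2) cube_ring_idealD(4)[OF assms(1) _ cube_ring_uminus[OF cube_ring_1]]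
  unfolding label_eq_def by (metis minus_diff_eq mult_minus1)

lemma ideal_unit:
  assumes "ideal N (cube_ring k)" "Const a \<in> N" "a \<noteq> 0" shows "1 \<in> N"
  using cube_ring_idealD(4)[OF assms(1,2) cube_ring_Const[of "inverse a"]] assms(3)
  by (simp add: Const_mult[symmetric])

text \<open>The difference of two distinct constants is a unit. This is the case in which a
  contraction identifies two decorations.\<close>

lemma label_eq_Cst:
  assumes "ideal N (cube_ring (length es))" "label_eq es N (Cst a) (Cst b)" "a \<noteq> b"
  shows "1 \<in> N"
proof -
  have "Const a - Const b \<in> N"
    using assms(2) unfolding label_eq_def by (auto simp: fconst_simps generic_Cst cube_ring_closed)
  then show ?thesis using ideal_unit[OF assms(1), of "a - b"] assms(3) by (simp add: Const_diff)
qed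

text \<open>Where \<open>u\<close> is 1, the edge from \<open>v\<close> to \<open>w\<close> forces
  the parameter of \<open>w\<close> to be 0, although it is invertible on the variety.\<close>

lemma face_at_infinity:
  assumes "anchored es" "net_ideal es \<subseteq> N" "ideal N (cube_ring (length es))"
    and "i < length es" "Var i - 1 \<in> N"
  shows "1 \<in> N"
proof -
  obtain v w where vw: "es ! i = (v, w)" by fastforce
  have nz: "Cst 0 \<notin> labels es" using assms(1) by (simp add: anchored_def)
  obtain G H where GH: "\<And>l. G l \<in> carrier (cube_ring (length es))" "\<And>l. H l \<in> carrier (cube_ring (length es))"
    "\<And>l. l \<in> labels es \<Longrightarrow> gen_val es (G l) = generic l"
    "\<And>l. l \<in> labels es \<Longrightarrow> gen_val es (G l * H l) = 1"
    using anchored_elements[OF assms(1)] by blast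
  note l = labels_nth[OF assms(4) vw]
  have "Var i * G v - (G v - G w) \<in> N"
    using edge_relation[OF nz assms(4) vw] GH l assms(2) by blast
  moreover have "G v * (Var i - 1) \<in> N" using cube_ring_idealD(4)[OF assms(3,5) GH(1)] .
  ultimately have "(Var i * G v - (G v - G w)) - G v * (Var i - 1) \<in> N"
    using cube_ring_idealD(5)[OF assms(3)] by blast
  then have "G w \<in> N" by (simp add: algebra_simps)
  then have "H w * G w \<in> N" using cube_ring_idealD(4)[OF assms(3) _ GH(2)] by blast
  moreover have "G w * H w - 1 \<in> net_ideal es"
    unfolding mem_net_ideal[OF nz] using GH(4)[of w] l
    by (auto simp: fconst_simps intro!: cube_ring_closed GH(1,2))
  then have "G w * H w - 1 \<in> N" using assms(2) by blast
  ultimately have "H w * G w - (G w * H w - 1) \<in> N" using cube_ring_idealD(5)[OF assms(3)] by blast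
  then show ?thesis by (simp add: mult.commute)
qed

text \<open>Modulo \<open>N\<close> the functions \<open>G l\<close> also satisfy the edge relations
  of the relabelled network, because \<open>l\<close> and \<open>h l\<close> agree there;
  \<open>relation_transfer\<close> then puts its whole ideal into \<open>N\<close>. With
  \<open>N\<close> generated by the ideal of the network and a face equation, this is the reason why
  the intersection with the face is reduced.\<close>

lemma net_ideal_relabel_subset:
  assumes "anchored es" "net_ideal es \<subseteq> N" "ideal N (cube_ring (length es))"
    and h: "h ` labels es \<subseteq> labels es" "\<And>l. l \<in> labels es \<Longrightarrow> label_eq es N l (h l)"
  shows "net_ideal (relabel h es) \<subseteq> N"
proof
  fix f assume f: "f \<in> net_ideal (relabel h es)"
  let ?k = "length es"
  have nz: "Cst 0 \<notin> labels es" using assms(1) by (simp add: anchored_def)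
  then have nz': "Cst 0 \<notin> labels (relabel h es)" using h(1) by auto
  interpret subring_ideal "carrier (cube_ring ?k)" N using assms(3) by (rule ideal_subring_ideal)
  obtain G H where GH: "\<And>l. G l \<in> carrier (cube_ring (length es))" "\<And>l. H l \<in> carrier (cube_ring (length es))"
    "\<And>l. l \<in> labels es \<Longrightarrow> gen_val es (G l) = generic l"
    "\<And>l. l \<in> labels es \<Longrightarrow> gen_val es (G l * H l) = 1"
    using anchored_elements[OF assms(1)] by blast
  have eqv_I: "eqv N p q" if "p \<in> carrier (cube_ring ?k)" "q \<in> carrier (cube_ring ?k)"
    "gen_val es p = gen_val es q" for p q
    using that assms(2) nz by (auto simp: eqv_def mem_net_ideal subset_iff fconst_simps intro: cube_ring_closed)
  have f': "f \<in> carrier (cube_ring (length (relabel h es)))" "gen_val (relabel h es) f = 0"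
    using f nz' by (auto simp: mem_net_ideal)
  \<comment> \<open>\<open>relation_transfer\<close> wants a value in the ring for every index, so
    the indices from \<open>?k\<close> on get the value 0; \<open>f\<close> does not involve
    them.\<close>
  have "peval Const (\<lambda>i. if i < ?k then Var i else 0) f \<in> N"
  proof (rule relation_transfer[OF semiring_hom_Const cube_ring_Const f' nz', where G = G])
    show "(if i < ?k then Var i else 0) \<in> carrier (cube_ring ?k)" for i
      by (auto intro: cube_ring_closed)
    show "G l \<in> carrier (cube_ring ?k)" for l by (rule GH)
    show "eqv N (G (Cst a)) (Const a)" if "Cst a \<in> labels (relabel h es)" for a
    proof -
      have "Cst a \<in> labels es" using that h(1) by auto
      then show ?thesis by (intro eqv_I GH(1) cube_ring_Const) (simp add: GH(3) fconst_simps generic_Cst)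
    qed
    show "\<exists>x\<in>carrier (cube_ring ?k). eqv N (G l * x) 1" if "l \<in> labels (relabel h es)" for l
      using that h(1) by (intro bexI[of _ "H l"] eqv_I GH cube_ring_closed)
        (use GH in \<open>auto simp: fconst_simps\<close>)
    show "eqv N ((if i < ?k then Var i else 0) * G v) (G v - G w)"
      if i: "i < length (relabel h es)" "relabel h es ! i = (v, w)" for i v w
    proof -
      obtain v' w' where vw': "es ! i = (v', w')" by fastforce
      then have vw: "v = h v'" "w = h w'" and ik: "i < ?k" using i by auto
      note l = labels_nth[OF ik vw']
      have l': "v \<in> labels es" "w \<in> labels es" using l h(1) vw by auto
      have 1: "eqv N (G v') (G v)" "eqv N (G w') (G w)"
        using h(2)[of v'] h(2)[of w'] l l' GH unfolding vw label_eq_def eqv_def by blast+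
      have "eqv N (Var i * G v) (Var i * G v')"
        using ik by (intro eqv_mult eqv_sym[OF 1(1)] GH) (auto intro: cube_ring_closed)
      also have "eqv N (Var i * G v') (G v' - G w')"
        using edge_relation[OF nz ik vw'] GH l assms(2) unfolding eqv_def by blast
      also have "eqv N (G v' - G w') (G v - G w)"
        by (rule eqv_diff[OF 1])
      finally show ?thesis using ik by simp
    qed
  qed
  moreover have "peval Const (\<lambda>i. if i < ?k then Var i else 0) f = peval Const Var f"
    using f'(1) by (intro peval_cong) auto
  ultimately show "f \<in> N" by simp
qed

lemma peval_Fract: "peval fconst (\<lambda>i. Fract (\<phi> i) 1) f = Fract (peval Const \<phi> f) 1"
proof -
  have pow: "Fract (x :: 'a mpoly) 1 ^ n = Fract (x ^ n) 1" for x n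
    by (induction n) (simp_all add: One_fract_def)
  have prd: "(\<Prod>i\<in>A. Fract (x i :: 'a mpoly) 1) = Fract (\<Prod>i\<in>A. x i) 1" for x and A :: "nat set"
    by (induction A rule: infinite_finite_induct) (simp_all add: One_fract_def)
  have sm: "(\<Sum>i\<in>A. Fract (x i :: 'a mpoly) 1) = Fract (\<Sum>i\<in>A. x i) 1" for x and A :: "(nat \<Rightarrow>\<^sub>0 nat) set"
    by (induction A rule: infinite_finite_induct) (simp_all add: Zero_fract_def)
  show ?thesis by (simp add: peval_def pow prd sm fconst_def)
qed

text \<open>The parameters are polynomial functions on the variety, and at the generic point they
  are distinct variables, so a relation between them is a polynomial identity. Their number is thus
  a lower bound for the dimension.\<close>

lemma parameters_independent:
  assumes nz: "Cst 0 \<notin> labels es" and root: "\<And>l. l \<in> labels es \<Longrightarrow> (Cst r, l) \<in> (set es)\<^sup>*"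
  shows "\<exists>F. (\<forall>i. F i \<in> carrier (cube_ring (length es))) \<and>
    alg_indep_mod (card {n. Par n \<in> labels es}) F (net_ideal es)"
proof -
  let ?V = "{n. Par n \<in> labels es}"
  have "finite (labels es)" by (simp add: labels_def)
  then have "finite ?V" by (rule finite_surj[where f = "\<lambda>l. case l of Par n \<Rightarrow> n | _ \<Rightarrow> 0"]) (force simp: image_iff)
  then obtain ns where ns: "bij_betw ns {..<card ?V} ?V"
    using ex_bij_betw_nat_finite[of ?V] by (auto simp: atLeast0LessThan)
  have "\<exists>g\<in>carrier (cube_ring (length es)). i < card ?V \<longrightarrow> gen_val es g = generic (Par (ns i))" for i
  proof (cases "i < card ?V")
    case True
    then have "Par (ns i) \<in> labels es" using ns by (auto simp: bij_betw_def)
    then show ?thesis using label_element[OF nz root] by blast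
  qed (use cube_ring_0 in blast)
  then obtain F where F: "\<And>i. F i \<in> carrier (cube_ring (length es))"
    "\<And>i. i < card ?V \<Longrightarrow> gen_val es (F i) = generic (Par (ns i))" by metis
  have "H = 0" if H: "H \<in> carrier (cube_ring (card ?V))" "peval Const F H \<in> net_ideal es" for H
  proof -
    have "0 = peval fconst (\<lambda>i. gen_val es (F i)) H"
      using H(2) by (simp add: mem_net_ideal[OF nz] peval_peval[OF semiring_hom_fconst])
    also have "\<dots> = peval fconst (\<lambda>i. Fract (Var (ns i)) 1) H"
      using F(2) by (intro peval_cong[OF H(1)]) (simp add: generic_def)
    finally have "peval Const (\<lambda>i. Var (ns i)) H = 0" by (simp add: peval_Fract)
    then have "0 = peval Const (\<lambda>n. Var (the_inv_into {..<card ?V} ns n)) (peval Const (\<lambda>i. Var (ns i)) H)"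
      by simp
    also have "\<dots> = peval Const (\<lambda>i. Var (the_inv_into {..<card ?V} ns (ns i))) H"
      by (simp add: peval_peval semiring_hom_Const peval_Var)
    also have "\<dots> = peval Const Var H"
      using ns by (intro peval_cong[OF H(1)]) (simp add: the_inv_into_f_f bij_betw_def)
    finally show ?thesis by simp
  qed
  then show ?thesis using F(1) by (auto simp: alg_indep_mod_def)
qed

section \<open>Arborescences and contraction of edges\<close>

text \<open>The edges with index in \<open>S\<close> are loops, left over from contracted edges; the others form a
  tree directed away from the root.\<close>

definition arborescence :: "'a \<Rightarrow> nat set \<Rightarrow> 'a::field network \<Rightarrow> bool" where
  "arborescence r S es \<longleftrightarrow> S \<subseteq> {..<length es} \<and> (\<forall>i\<in>S. fst (es ! i) = snd (es ! i)) \<and>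
    inj_on (\<lambda>i. snd (es ! i)) ({..<length es} - S) \<and>
    (\<forall>i\<in>{..<length es} - S. snd (es ! i) \<noteq> Cst r) \<and>
    (\<forall>l\<in>labels es. (Cst r, l) \<in> (set es)\<^sup>*)"

definition constants :: "'a network \<Rightarrow> 'a set" where
  "constants es = {c. Cst c \<in> labels es}"

lemma finite_labels: "finite (labels es)"
  by (simp add: labels_def)

text \<open>A path from the root can be stripped of loops, so that its last edge outside
  \<open>S\<close> enters the label in question. The root is a label because such paths start
  there.\<close>

lemma arborescence_labels:
  assumes "arborescence r S es" "0 < length es"
  shows "labels es = insert (Cst r) ((\<lambda>i. snd (es ! i)) ` ({..<length es} - S))"
proof (intro equalityI subsetI)
  fix l assume "l \<in> labels es"
  then have "(Cst r, l) \<in> (set es)\<^sup>*" using assms by (auto simp: arborescence_def)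
  then show "l \<in> insert (Cst r) ((\<lambda>i. snd (es ! i)) ` ({..<length es} - S))"
  proof (induction rule: rtrancl_induct)
    case (step y z)
    obtain i where i: "i < length es" "es ! i = (y, z)" using step(2) by (metis in_set_conv_nth)
    show ?case
    proof (cases "i \<in> S")
      case True
      then have "y = z" using assms(1) i by (auto simp: arborescence_def)
      then show ?thesis using step by simp
    qed (use i in force)
  qed simp
next
  fix l assume l: "l \<in> insert (Cst r) ((\<lambda>i. snd (es ! i)) ` ({..<length es} - S))"
  have *: "fst (es ! i) \<in> labels es \<and> snd (es ! i) \<in> labels es" if "i < length es" for i
    using labels_nth[OF that, of "fst (es ! i)" "snd (es ! i)"] by simp
  then have "(Cst r, fst (es ! 0)) \<in> (set es)\<^sup>*" "fst (es ! 0) \<in> labels es"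
    using assms by (auto simp: arborescence_def)
  then have "Cst r \<in> labels es" by (rule rtrancl_label)
  then show "l \<in> labels es" using l * by auto
qed

text \<open>Every vertex except the root is the target of exactly one edge outside \<open>S\<close>.
  The left side is the dimension of the face and the number of parameters that of the variety, so
  the constants other than the root count the codimension.\<close>

lemma arborescence_count:
  assumes "arborescence r S es" "0 < length es"
  shows "length es - card S = card {n. Par n \<in> labels es} + card (constants es - {r})"
proof -
  let ?T = "(\<lambda>i. snd (es ! i)) ` ({..<length es} - S)"
  have lab: "labels es = insert (Cst r) ?T" by (rule arborescence_labels[OF assms])
  have r: "Cst r \<notin> ?T" using assms by (auto simp: arborescence_def)
  have S: "S \<subseteq> {..<length es}" using assms by (simp add: arborescence_def)
  have "card ?T = length es - card S"
    using assms S by (subst card_image) (auto simp: arborescence_def card_Diff_subset finite_subset)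
  moreover have T: "?T = Par ` {n. Par n \<in> labels es} \<union> Cst ` (constants es - {r})"
  proof -
    have "?T = labels es - {Cst r}" using lab r by blast
    also have "\<dots> = Par ` {n. Par n \<in> labels es} \<union> Cst ` (constants es - {r})"
    proof (rule Set.set_eqI)
      show "l \<in> labels es - {Cst r} \<longleftrightarrow> l \<in> Par ` {n. Par n \<in> labels es} \<union> Cst ` (constants es - {r})" for l
        by (cases l) (auto simp: constants_def)
    qed
    finally show ?thesis .
  qed
  have fin: "finite (Par ` {n. Par n \<in> labels es} :: 'a label set)" "finite (Cst ` (constants es - {r}))"
    using finite_subset[OF _ finite_imageI[of "{..<length es} - S" "\<lambda>i. snd (es ! i)"]] T by auto
  have "card ?T = card (Par ` {n. Par n \<in> labels es} :: 'a label set) + card (Cst ` (constants es - {r}))"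
    unfolding T by (rule card_Un_disjoint[OF fin]) auto
  also have "\<dots> = card {n. Par n \<in> labels es} + card (constants es - {r})"
    by (simp add: card_image inj_on_def)
  ultimately show ?thesis by simp
qed

text \<open>Apart from loops in \<open>S\<close>, such a loop would be the only edge entering its
  vertex, which could then not be reached from the root.\<close>

lemma arborescence_no_loop:
  assumes "arborescence r S es" "i < length es" "i \<notin> S"
  shows "fst (es ! i) \<noteq> snd (es ! i)"
proof
  assume loop: "fst (es ! i) = snd (es ! i)"
  define v where "v = snd (es ! i)"
  have "v \<in> labels es" unfolding v_def labels_def using assms(2) by auto
  then have "(Cst r, v) \<in> (set es)\<^sup>*" using assms by (auto simp: arborescence_def)
  moreover have "u \<noteq> v" if "(Cst r, u) \<in> (set es)\<^sup>*" for u
    using that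
  proof (induction rule: rtrancl_induct)
    case base
    then show ?case using assms by (auto simp: arborescence_def v_def)
  next
    case (step y z)
    obtain j where j: "j < length es" "es ! j = (y, z)" using step(2) by (metis in_set_conv_nth)
    show ?case
    proof
      assume "z = v"
      show False
      proof (cases "j \<in> S")
        case True
        then have "y = z" using assms(1) j by (auto simp: arborescence_def)
        then show False using step \<open>z = v\<close> by simp
      next
        case False
        then have "j = i"
          using assms j \<open>z = v\<close> by (auto simp: arborescence_def v_def dest!: inj_onD[where x = i and y = j])
        then show False using j(2) step(3) loop v_def by (metis fst_conv)
      qed
    qed
  qed
  ultimately show False by blast
qed

text \<open>The surviving name \<open>y\<close> is that of the source, unless the target is a
  constant, which has to be kept. In that case the edge that entered \<open>v\<close> now enters the
  constant, and targets stay distinct because the other edge with this target has become a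
  loop.\<close>

lemma arborescence_contract:
  assumes arb: "arborescence r S es" and anch: "anchored es"
    and i: "i < length es" "i \<notin> S" "es ! i = (v, w)"
    and xy: "x = Par n" "(x = v \<and> y = w \<and> (\<exists>c. w = Cst c)) \<or> (x = w \<and> y = v)"
  defines "h \<equiv> id(x := y)"
  shows "arborescence r (insert i S) (relabel h es)" "anchored (relabel h es)"
    "constants (relabel h es) = constants es"
proof -
  let ?k = "length es"
  note l = labels_nth[OF i(1,3)]
  have h_Cst: "h (Cst c) = Cst c" for c by (simp add: h_def xy)
  have y_lab: "y \<in> labels es" using xy l by auto
  then have h_lab: "h ` labels es \<subseteq> labels es" by (auto simp: h_def)
  have nz: "Cst 0 \<notin> labels es" using anch by (simp add: anchored_def)
  have w_only: "snd (es ! j) \<noteq> w" if "j < ?k" "j \<notin> insert i S" for j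
  proof
    assume "snd (es ! j) = w"
    then have "j = i" using that i arb unfolding arborescence_def
      by (intro inj_onD[of "\<lambda>i. snd (es ! i)" "{..<?k} - S" j i]) auto
    then show False using that by simp
  qed
  have "w \<noteq> Cst r"
    using arb i(1,2) unfolding arborescence_def by (metis DiffI lessThan_iff i(3) snd_conv)
  show anch': "anchored (relabel h es)"
    unfolding anchored_def
  proof (intro conjI ballI)
    show "Cst 0 \<notin> labels (relabel h es)" using nz h_lab by auto
    fix l' assume "l' \<in> labels (relabel h es)"
    then obtain l where l: "l \<in> labels es" "l' = h l" by auto
    then obtain c d where "(Cst c, l) \<in> (set es)\<^sup>*" "(l, Cst d) \<in> (set es)\<^sup>*"
      using anch unfolding anchored_def by blast
    from this[THEN rtrancl_relabel, of h] l(2) h_Cst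
    show "\<exists>c. (Cst c, l') \<in> (set (relabel h es))\<^sup>*" "\<exists>c. (l', Cst c) \<in> (set (relabel h es))\<^sup>*" by auto
  qed
  show "constants (relabel h es) = constants es"
  proof (intro equalityI subsetI)
    fix c assume "c \<in> constants (relabel h es)"
    then show "c \<in> constants es" using h_lab by (auto simp: constants_def)
  next
    fix c assume "c \<in> constants es"
    then have "h (Cst c) \<in> h ` labels es" by (auto simp: constants_def)
    then show "c \<in> constants (relabel h es)" by (simp add: constants_def h_Cst)
  qed
  have "h v = h w" using xy by (auto simp: h_def)
  show "arborescence r (insert i S) (relabel h es)"
    unfolding arborescence_def
  proof (intro conjI ballI)
    show "insert i S \<subseteq> {..<length (relabel h es)}" using arb i by (auto simp: arborescence_def)
    show "fst (relabel h es ! j) = snd (relabel h es ! j)" if "j \<in> insert i S" for j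
    proof -
      have "j < ?k" using that arb i by (auto simp: arborescence_def)
      then show ?thesis using that arb i \<open>h v = h w\<close> by (auto simp: arborescence_def)
    qed
    have inj_h: "h (snd (es ! j)) = h (snd (es ! j')) \<longrightarrow> snd (es ! j) = snd (es ! j')"
      if "j < ?k" "j \<notin> insert i S" "j' < ?k" "j' \<notin> insert i S" for j j'
      using w_only[OF that(1,2)] w_only[OF that(3,4)] xy by (auto simp: h_def)
    show "inj_on (\<lambda>j. snd (relabel h es ! j)) ({..<length (relabel h es)} - insert i S)"
    proof (rule inj_onI)
      fix j j' assume j: "j \<in> {..<length (relabel h es)} - insert i S" "j' \<in> {..<length (relabel h es)} - insert i S"
        "snd (relabel h es ! j) = snd (relabel h es ! j')"
      then have "snd (es ! j) = snd (es ! j')" using inj_h[of j j'] by simp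
      then show "j = j'" using j arb unfolding arborescence_def
        by (intro inj_onD[of "\<lambda>i. snd (es ! i)" "{..<?k} - S" j j']) auto
    qed
    show "snd (relabel h es ! j) \<noteq> Cst r" if "j \<in> {..<length (relabel h es)} - insert i S" for j
    proof -
      have "snd (es ! j) \<noteq> w" "snd (es ! j) \<noteq> Cst r" "j < ?k"
        using that w_only arb by (auto simp: arborescence_def)
      then show ?thesis using xy \<open>w \<noteq> Cst r\<close> by (auto simp: h_def)
    qed
    show "(Cst r, l') \<in> (set (relabel h es))\<^sup>*" if l': "l' \<in> labels (relabel h es)" for l'
    proof -
      obtain l where "l \<in> labels es" "l' = h l" using l' by auto
      then show ?thesis using arb rtrancl_relabel[of "Cst r" l es h] by (auto simp: arborescence_def h_Cst)
    qed
  qed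
qed

section \<open>Admissibility\<close>

lemma relabel_relabel: "relabel h (relabel h' es) = relabel (h \<circ> h') es"
  by (simp add: relabel_def map_prod_def case_prod_beta)

lemma relabel_cong: "(\<And>l. l \<in> labels es \<Longrightarrow> h l = h' l) \<Longrightarrow> relabel h es = relabel h' es"
  by (force simp: relabel_def labels_def)

lemma relabel_ident: "(\<And>l. l \<in> labels es \<Longrightarrow> h l = l) \<Longrightarrow> relabel h es = es"
  using relabel_cong[of es h id] by (simp add: relabel_def map_prod.id)

lemma arborescence_relabel_inj:
  assumes "arborescence r S es" "inj_on h (labels es)" "h (Cst r) = Cst r" "0 < length es"
  shows "arborescence r S (relabel h es)"
proof -
  have snd_lab: "snd (es ! i) \<in> labels es" if "i < length es" for i
    using labels_nth[OF that, of "fst (es ! i)" "snd (es ! i)"] by simp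
  have r: "Cst r \<in> labels es" using arborescence_labels[OF assms(1,4)] by simp
  show ?thesis
    unfolding arborescence_def
  proof (intro conjI ballI)
    show S: "S \<subseteq> {..<length (relabel h es)}" using assms(1) by (auto simp: arborescence_def)
    show "fst (relabel h es ! i) = snd (relabel h es ! i)" if "i \<in> S" for i
      using that assms(1) S by (auto simp: arborescence_def subset_iff)
    show "inj_on (\<lambda>i. snd (relabel h es ! i)) ({..<length (relabel h es)} - S)"
    proof (rule inj_onI)
      fix i j assume ij: "i \<in> {..<length (relabel h es)} - S" "j \<in> {..<length (relabel h es)} - S"
        "snd (relabel h es ! i) = snd (relabel h es ! j)"
      then have "snd (es ! i) = snd (es ! j)"
        using inj_onD[OF assms(2)] snd_lab by simp
      then show "i = j" using ij assms(1) unfolding arborescence_def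
        by (intro inj_onD[of "\<lambda>i. snd (es ! i)" "{..<length es} - S" i j]) auto
    qed
    show "snd (relabel h es ! i) \<noteq> Cst r" if i: "i \<in> {..<length (relabel h es)} - S" for i
    proof
      assume "snd (relabel h es ! i) = Cst r"
      then have "h (snd (es ! i)) = h (Cst r)" using i assms(3) by simp
      then have "snd (es ! i) = Cst r" using inj_onD[OF assms(2)] snd_lab r i by simp
      then show False using i assms(1) by (auto simp: arborescence_def)
    qed
    show "(Cst r, l') \<in> (set (relabel h es))\<^sup>*" if l': "l' \<in> labels (relabel h es)" for l'
    proof -
      obtain l where "l \<in> labels es" "l' = h l" using l' by auto
      then show ?thesis using assms(1,3) rtrancl_relabel[of "Cst r" l es h] by (auto simp: arborescence_def)
    qed
  qed
qed

lemma loop_in_net_ideal: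
  assumes "Cst 0 \<notin> labels es" "arborescence r S es" "i \<in> S"
  shows "Var i \<in> net_ideal es"
proof -
  have i: "i < length es" "fst (es ! i) = snd (es ! i)" using assms by (auto simp: arborescence_def)
  have "fst (es ! i) \<in> labels es" using i(1) by (simp add: labels_def)
  then have "generic (fst (es ! i)) \<noteq> 0" using generic_nonzero[OF assms(1)] by blast
  then show ?thesis using i
    by (simp add: mem_net_ideal[OF assms(1)] cube_ring_Var fconst_simps nth_coords)
qed

lemma zero_face_subset_net_ideal:
  assumes "Cst 0 \<notin> labels es" "arborescence r S es"
  shows "zero_face (length es) S \<subseteq> net_ideal es"
  using assms loop_in_net_ideal[OF assms]
  by (intro zero_face_facts(3) primeidealD(1)[OF prime_net_ideal]) (auto simp: arborescence_def)

text \<open>The dimension count in the upper bound uses the parameters as independent elements. A chain of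
  maximal length is obtained by replacing the constants at the leaves, one by one, by further
  parameters: when all of them are replaced, the network parametrizes the whole face.\<close>

lemma codim_net_ideal:
  fixes es :: "'a::field network"
  assumes anch: "anchored es" and arb: "arborescence r S es" and k: "0 < length es"
  shows "codim (cube_ring (length es)) (zero_face (length es) S) (net_ideal es)
    = enat (card (constants es - {r}))"
proof -
  let ?k = "length es" and ?R = "cube_ring (length es) :: 'a mpoly ring"
  define L where "L = (zero_face (length es) S :: 'a mpoly set)"
  define p where "p = card (constants es - {r})"
  have nz: "Cst 0 \<notin> labels es" using anch by (simp add: anchored_def)
  have S: "S \<subseteq> {..<?k}" using arb by (simp add: arborescence_def)
  have count: "?k - card S = card {n. Par n \<in> labels es} + p"
    unfolding p_def by (rule arborescence_count[OF arb k])
  have fin_const: "finite (constants es - {r})"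
    using finite_surj[OF finite_labels[of es], of "constants es" "\<lambda>l. case l of Cst c \<Rightarrow> c | _ \<Rightarrow> r"]
    by (force simp: constants_def image_iff)
  obtain idx where idx: "bij_betw idx (constants es - {r}) {..<p}"
    using ex_bij_betw_finite_nat[OF fin_const] by (auto simp: p_def atLeast0LessThan)
  have "finite {n. Par n \<in> labels es}"
    using finite_surj[OF finite_labels[of es], of "{n. Par n \<in> labels es}" "\<lambda>l. case l of Par n \<Rightarrow> n | _ \<Rightarrow> 0"]
    by (force simp: image_iff)
  then obtain N0 where N0: "\<And>n. Par n \<in> labels es \<Longrightarrow> n < N0"
    by (meson finite_nat_set_iff_bounded mem_Collect_eq)
  \<comment> \<open>\<open>rel j\<close> replaces the constants of index at least \<open>j\<close>
    by new parameters, numbered from \<open>N0\<close> on to avoid those in use. At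
    \<open>j = p\<close> nothing is replaced, at \<open>j = 0\<close> every constant except the
    root.\<close>
  define rel :: "nat \<Rightarrow> 'a label \<Rightarrow> 'a label" where "rel = (\<lambda>j l. case l of Par n \<Rightarrow> Par n | Cst c \<Rightarrow>
    if c \<in> constants es - {r} \<and> j \<le> idx c then Par (N0 + idx c) else Cst c)"
  define ch where "ch = (\<lambda>j. net_ideal (relabel (rel j) es))"
  have rel_simps: "rel j (Par n) = Par n" "rel j (Cst r) = Cst r"
    "rel j (Cst c) = (if c \<in> constants es - {r} \<and> j \<le> idx c then Par (N0 + idx c) else Cst c)" for j n c
    by (simp_all add: rel_def)
  have nz_rel: "Cst 0 \<notin> labels (relabel (rel j) es)" for j
  proof
    assume "Cst 0 \<in> labels (relabel (rel j) es)"
    then obtain l where "l \<in> labels es" "Cst 0 = rel j l" by auto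
    then show False using nz by (cases l) (auto simp: rel_simps split: if_splits)
  qed
  have idx_lt: "idx c < p" if "c \<in> constants es - {r}" for c
    using idx that by (auto simp: bij_betw_def)
  have ch_p: "ch p = net_ideal es"
    unfolding ch_def
  proof (rule arg_cong[where f = net_ideal], rule relabel_ident)
    show "rel p l = l" if "l \<in> labels es" for l
      using idx_lt by (cases l) (force simp: rel_simps)+
  qed
  have prime: "primeideal (ch j) ?R" for j
    using prime_net_ideal[OF nz_rel] by (simp add: ch_def)
  have ch_step: "ch j \<subset> ch (Suc j)" if j: "j < p" for j
  proof -
    have "j \<in> idx ` (constants es - {r})" using idx j by (simp add: bij_betw_def)
    then obtain c where c: "c \<in> constants es - {r}" "idx c = j" by blast
    have uniq: "c' = c" if "c' \<in> constants es - {r}" "idx c' = j" for c'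
      using inj_onD[OF bij_betw_imp_inj_on[OF idx], of c' c] that c by auto
    have "relabel (rel (Suc j)) es = relabel (id(Par (N0 + j) := Cst c) \<circ> rel j) es"
    proof (rule relabel_cong)
      fix l assume l: "l \<in> labels es"
      show "rel (Suc j) l = (id(Par (N0 + j) := Cst c) \<circ> rel j) l"
      proof (cases l)
        case (Cst a)
        show ?thesis
        proof (cases "a \<in> constants es - {r} \<and> idx a = j")
          case True
          then have "a = c" using uniq by blast
          then show ?thesis using Cst c by (simp add: rel_simps)
        next
          case False
          then show ?thesis using Cst by (auto simp: rel_simps)
        qed
      next
        case (Par n)
        then show ?thesis using N0[of n] l by (simp add: rel_simps)
      qed
    qed
    then have step: "relabel (rel (Suc j)) es = relabel (id(Par (N0 + j) := Cst c)) (relabel (rel j) es)"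
      by (simp add: relabel_relabel)
    have "c \<noteq> 0" using c nz by (auto simp: constants_def)
    then have sub: "ch j \<subseteq> ch (Suc j)"
      unfolding ch_def step by (intro net_ideal_subset_relabel) auto
    have c_lab: "Cst c \<in> labels es" using c by (simp add: constants_def)
    then have "(Cst r, Cst c) \<in> (set es)\<^sup>*" using arb by (auto simp: arborescence_def)
    then obtain g where g: "g \<in> carrier ?R" "\<And>\<alpha>. (\<forall>l\<in>labels es. \<alpha> l \<noteq> 0) \<Longrightarrow>
        peval fconst ((!) (coords \<alpha> es)) g * \<alpha> (Cst r) = \<alpha> (Cst c)"
      using path_polynomial by blast
    \<comment> \<open>At the generic point, \<open>q\<close> is the label that \<open>rel\<close>
      puts in place of \<open>c\<close>, minus \<open>c\<close>; it vanishes as soon as this label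
      is set back to \<open>c\<close>, and not before.\<close>
    define q where "q = Const r * g - Const c"
    have q_val: "gen_val (relabel (rel i) es) q = generic (rel i (Cst c)) - fconst c" for i
    proof -
      have "\<forall>l\<in>labels es. (generic \<circ> rel i) l \<noteq> 0"
        using generic_nonzero[OF nz_rel[of i]] by auto
      from g(2)[OF this] show ?thesis
        by (simp add: q_def fconst_simps coords_relabel rel_simps(2) generic_Cst mult.commute comp_def)
    qed
    have q_car: "q \<in> carrier ?R" using g(1) unfolding q_def by (intro cube_ring_closed)
    have "q \<in> ch (Suc j)"
      using q_car q_val[of "Suc j"] c
      by (simp add: ch_def mem_net_ideal[OF nz_rel] rel_simps generic_Cst)
    moreover have "q \<notin> ch j"
    proof
      assume "q \<in> ch j"
      then have "generic (Par (N0 + j)) = fconst c"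
        using q_val[of j] c by (simp add: ch_def mem_net_ideal[OF nz_rel] rel_simps)
      then have "Var (N0 + j) = Const c" by (simp add: generic_def fconst_def eq_fract)
      then have "Poly_Mapping.keys (Var (N0 + j) :: 'a mpoly) \<subseteq> {0}" by (simp add: Const_def)
      then have "Poly_Mapping.single (N0 + j) (1::nat) = 0" by (simp add: Var_def)
      then show False by (metis lookup_single_eq lookup_zero zero_neq_one)
    qed
    ultimately show ?thesis using sub by blast
  qed
  have inj_rel: "inj_on (rel 0) (labels es)"
  proof (rule inj_onI)
    fix l l' assume l: "l \<in> labels es" "l' \<in> labels es" "rel 0 l = rel 0 l'"
    have *: "c = c'" if "c \<in> constants es - {r}" "c' \<in> constants es - {r}" "idx c = idx c'" for c c'
      using inj_onD[OF bij_betw_imp_inj_on[OF idx]] that by blast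
    show "l = l'"
      using l * N0 by (cases l; cases l') (fastforce simp: rel_simps split: if_splits)+
  qed
  have arb0: "arborescence r S (relabel (rel 0) es)"
    by (rule arborescence_relabel_inj[OF arb inj_rel]) (use k in \<open>simp_all add: rel_simps\<close>)
  have "constants (relabel (rel 0) es) - {r} = {}"
  proof -
    have "c = r" if c: "Cst c \<in> rel 0 ` labels es" for c
    proof -
      obtain l where "l \<in> labels es" "Cst c = rel 0 l" using c by auto
      then show ?thesis by (cases l) (auto simp: rel_simps constants_def split: if_splits)
    qed
    then show ?thesis by (auto simp: constants_def)
  qed
  \<comment> \<open>With the root as the only constant there are as many parameters as coordinates
    on the face, so the smallest ideal of the chain is the ideal of the face.\<close>
  then have "?k - card S = card {n. Par n \<in> labels (relabel (rel 0) es)}"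
    using arborescence_count[OF arb0] k card.empty by (metis add_0_right length_relabel)
  moreover have "\<exists>F. (\<forall>i. F i \<in> carrier ?R) \<and>
      alg_indep_mod (card {n. Par n \<in> labels (relabel (rel 0) es)}) F (ch 0)"
  proof -
    have "(Cst r, l) \<in> (set (relabel (rel 0) es))\<^sup>*" if "l \<in> labels (relabel (rel 0) es)" for l
      using arb0 that unfolding arborescence_def by blast
    from parameters_independent[OF nz_rel this] show ?thesis
      unfolding ch_def by (simp only: length_relabel)
  qed
  ultimately obtain F where "\<And>i. F i \<in> carrier ?R" "alg_indep_mod (?k - card S) F (ch 0)"
    by metis
  moreover have "zero_face ?k S \<subseteq> ch 0"
    using zero_face_subset_net_ideal[OF nz_rel arb0] by (simp add: ch_def)
  ultimately have ch_0: "ch 0 = L"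
    unfolding L_def by (intro prime_eq_zero_face[OF S prime]) auto
  let ?A = "{n. \<exists>c. c 0 = L \<and> c n = net_ideal es \<and>
     (\<forall>i\<le>n. primeideal (c i) ?R) \<and> (\<forall>i<n. c i \<subset> c (Suc i))}"
  have "p \<in> ?A" using ch_0 ch_p prime ch_step by blast
  then have "enat p \<le> (SUP n\<in>?A. enat n)" by (rule SUP_upper)
  \<comment> \<open>A chain of length \<open>n\<close> adds \<open>n\<close> independent elements to
    the parameters, and the face has room for \<open>?k - card S\<close> in all.\<close>
  moreover have "n \<le> p" if "n \<in> ?A" for n
  proof -
    obtain c where c: "c 0 = L" "c n = net_ideal es" "\<And>i. i \<le> n \<Longrightarrow> primeideal (c i) ?R"
      "\<And>i. i < n \<Longrightarrow> c i \<subset> c (Suc i)" using \<open>n \<in> ?A\<close> by blast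
    obtain F where F: "\<And>i. F i \<in> carrier ?R" "alg_indep_mod (card {n. Par n \<in> labels es}) F (c n)"
      using parameters_independent[OF nz, of r] arb c(2) by (auto simp: arborescence_def)
    obtain F' where "\<And>i. F' i \<in> carrier ?R" "alg_indep_mod (n + card {n. Par n \<in> labels es}) F' (c 0)"
      using alg_indep_mod_chain[of n c ?k F, OF c(3,4) F] by metis
    then have "n + card {n. Par n \<in> labels es} \<le> ?k - card S"
      using c(1) by (intro alg_indep_mod_bound[OF S, of L]) (simp_all add: L_def)
    then show ?thesis using count by simp
  qed
  then have "(SUP n\<in>?A. enat n) \<le> enat p" by (intro SUP_least) simp
  ultimately show ?thesis
    unfolding codim_def L_def[symmetric] p_def[symmetric] by (rule order.antisym[rotated])
qed

text \<open>Edges are contracted one at a time, and the contractions are composed into one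
  relabelling of the original network. The first alternative is an empty face, which arises when an
  edge between two distinct constants has to be contracted. Quantifying over the ideals
  \<open>N\<close> above both ideals avoids a sum of ideals and fits the primes over it.\<close>

lemma contract_edges:
  fixes es :: "'a::field network"
  assumes anch: "anchored es" and arb: "arborescence r {} es"
    and T: "T \<subseteq> {..<length es}"
  shows "(\<forall>N. ideal N (cube_ring (length es)) \<longrightarrow> net_ideal es \<union> Var ` T \<subseteq> N \<longrightarrow> 1 \<in> N) \<or>
    (\<exists>h. anchored (relabel h es) \<and> arborescence r T (relabel h es) \<and>
       constants (relabel h es) = constants es \<and> net_ideal es \<subseteq> net_ideal (relabel h es) \<and>
       (\<forall>N. ideal N (cube_ring (length es)) \<longrightarrow> net_ideal es \<union> Var ` T \<subseteq> N \<longrightarrow>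
          net_ideal (relabel h es) \<subseteq> N))"
proof -
  have "finite T" using T finite_subset by blast
  then show ?thesis using T
  proof (induction T rule: finite_induct)
    case empty
    have "relabel id es = es" by (rule relabel_ident) simp
    then show ?case using anch arb by (intro disjI2 exI[of _ id]) (simp del: id_apply)
  next
    case (insert i T)
    show ?case
    proof (cases "\<forall>N. ideal N (cube_ring (length es)) \<longrightarrow> net_ideal es \<union> Var ` T \<subseteq> N \<longrightarrow> 1 \<in> N")
      case True
      then show ?thesis by (intro disjI1) auto
    next
      case False
      then obtain h where h: "anchored (relabel h es)" "arborescence r T (relabel h es)"
        "constants (relabel h es) = constants es" "net_ideal es \<subseteq> net_ideal (relabel h es)"
        "\<And>N. ideal N (cube_ring (length es)) \<Longrightarrow> net_ideal es \<union> Var ` T \<subseteq> N \<Longrightarrow> net_ideal (relabel h es) \<subseteq> N"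
        using insert.IH insert.prems by (metis insert_subset)
      define es' where "es' = relabel h es"
      have len: "length es' = length es" by (simp add: es'_def)
      have i: "i < length es'" "i \<notin> T" using insert len by auto
      have nz: "Cst 0 \<notin> labels es'" using h(1) by (simp add: anchored_def es'_def)
      obtain v w where vw: "es' ! i = (v, w)" by fastforce
      note l = labels_nth[OF i(1) vw]
      have "v \<noteq> w"
        using arborescence_no_loop[OF h(2)[folded es'_def] i] vw by simp
      have eq: "label_eq es' N v w" if "ideal N (cube_ring (length es))" "net_ideal es \<union> Var ` insert i T \<subseteq> N" for N
        using h(5)[of N] that len nz i vw by (intro label_eq_edge) (auto simp: es'_def)
      show ?thesis
      proof (cases "(\<exists>c. v = Cst c) \<and> (\<exists>c. w = Cst c)")
        case True
        then obtain a b where "v = Cst a" "w = Cst b" "a \<noteq> b" using \<open>v \<noteq> w\<close> by auto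
        then show ?thesis using eq label_eq_Cst[of _ es'] len by (intro disjI1) metis
      next
        case False
        then obtain x y n where xy: "x = Par n" "(x = v \<and> y = w \<and> (\<exists>c. w = Cst c)) \<or> (x = w \<and> y = v)"
          by (metis label.exhaust)
        define h' where "h' = id(x := y)"
        note con = arborescence_contract[OF h(2,1)[folded es'_def] i vw xy, folded h'_def]
        have "y \<noteq> Cst 0" using xy(2) l nz by auto
        then have sub: "net_ideal es' \<subseteq> net_ideal (relabel h' es')"
          by (intro net_ideal_subset_relabel) (auto simp: h'_def xy(1))
        have "net_ideal (relabel h' es') \<subseteq> N"
          if N: "ideal N (cube_ring (length es))" "net_ideal es \<union> Var ` insert i T \<subseteq> N" for N
        proof (rule net_ideal_relabel_subset)
          show "anchored es'" using h(1) by (simp add: es'_def)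
          show "net_ideal es' \<subseteq> N" using h(5)[OF N(1)] N(2) by (auto simp: es'_def)
          show "ideal N (cube_ring (length es'))" using N(1) len by simp
          show "h' ` labels es' \<subseteq> labels es'" using xy l by (auto simp: h'_def)
          show "label_eq es' N l (h' l)" if "l \<in> labels es'" for l
          proof (cases "l = x")
            case True
            then show ?thesis using eq[OF N] label_eq_sym[of N es' v w] N(1) len xy(2) by (auto simp: h'_def)
          next
            case False
            then show ?thesis
              using label_eq_refl[OF nz \<open>net_ideal es' \<subseteq> N\<close>] by (simp add: h'_def)
          qed
        qed
        then have "anchored (relabel (h' \<circ> h) es) \<and> arborescence r (insert i T) (relabel (h' \<circ> h) es) \<and>
          constants (relabel (h' \<circ> h) es) = constants es \<and> net_ideal es \<subseteq> net_ideal (relabel (h' \<circ> h) es) \<and>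
          (\<forall>N. ideal N (cube_ring (length es)) \<longrightarrow> net_ideal es \<union> Var ` insert i T \<subseteq> N \<longrightarrow>
             net_ideal (relabel (h' \<circ> h) es) \<subseteq> N)"
          using con h(3,4) sub unfolding relabel_relabel[symmetric] es'_def by auto
        then show ?thesis by blast
      qed
    qed
  qed
qed

text \<open>Contraction keeps the constants, so the number that gives the codimension in the cube
  also gives it in every face that is met.\<close>

theorem admissible_net_ideal:
  fixes es :: "'a::field network"
  assumes anch: "anchored es" and arb: "arborescence r {} es" and k: "0 < length es"
  shows "admissible_subvariety (length es) (card (constants es - {r})) (net_ideal es)"
  unfolding admissible_subvariety_def
proof (intro conjI allI impI ballI)
  let ?R = "cube_ring (length es) :: 'a mpoly ring"
  have nz: "Cst 0 \<notin> labels es" using anch by (simp add: anchored_def)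
  show "primeideal (net_ideal es) ?R" by (rule prime_net_ideal[OF nz])
  have "ideal {0} ?R" by (intro cube_ring_idealI) (auto intro: cube_ring_0)
  then have "zero_face (length es) {} \<subseteq> {0 :: 'a mpoly}" by (intro zero_face_facts(3)) auto
  moreover have "0 \<in> (zero_face (length es) {} :: 'a mpoly set)"
    using cube_ring_idealD(2)[OF zero_face_facts(1)] by blast
  ultimately have "zero_face (length es) {} = {0 :: 'a mpoly}" by blast
  then show "codim ?R {0} (net_ideal es) = enat (card (constants es - {r}))"
    using codim_net_ideal[OF anch arb k] by simp
  fix \<sigma> :: "nat \<rightharpoonup> endpoint" and M :: "'a mpoly set"
  assume \<sigma>: "dom \<sigma> \<subseteq> {..<length es}" and M: "M \<in> minimal_primes ?R (net_ideal es \<union> face_ideal (length es) \<sigma>)"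
  let ?G = "{Var i - Const (u_value e) | i e. \<sigma> i = Some e} :: 'a mpoly set"
  have M': "primeideal M ?R" "net_ideal es \<subseteq> M" "face_ideal (length es) \<sigma> \<subseteq> M"
    and min: "\<And>N. primeideal N ?R \<Longrightarrow> net_ideal es \<subseteq> N \<Longrightarrow> face_ideal (length es) \<sigma> \<subseteq> N \<Longrightarrow> N \<subseteq> M \<Longrightarrow> N = M"
    using M by (auto simp: minimal_primes_def)
  interpret R: cring ?R by (rule cube_ring_cring)
  have G_car: "?G \<subseteq> carrier ?R"
    using \<sigma> by (auto intro!: cube_ring_closed)
  then have G_face: "?G \<subseteq> face_ideal (length es) \<sigma>"
    unfolding face_ideal_def by (rule R.genideal_self)
  have no_inf: "\<sigma> i \<noteq> Some Infty" for i
  proof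
    assume i: "\<sigma> i = Some Infty"
    then have "i < length es" using \<sigma> by blast
    have "Var i - Const (u_value Infty) \<in> ?G" using i by blast
    then have "Var i - 1 \<in> M" using G_face M'(3) by (simp add: subset_iff)
    with \<open>i < length es\<close> show False
      using face_at_infinity[OF anch M'(2) primeidealD(1)[OF M'(1)]] primeidealD(2)[OF M'(1)] by blast
  qed
  have "?G = Var ` dom \<sigma>"
  proof (intro equalityI subsetI)
    fix f assume "f \<in> ?G"
    then obtain i e where "f = Var i - Const (u_value e)" "\<sigma> i = Some e" by blast
    then show "f \<in> Var ` dom \<sigma>" using no_inf[of i] by (cases e) auto
  next
    fix f :: "'a mpoly" assume "f \<in> Var ` dom \<sigma>"
    then obtain i e where f: "f = Var i" "\<sigma> i = Some e" by blast
    then have "e = Zero" using no_inf[of i] by (cases e) auto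
    then show "f \<in> ?G" using f by (intro CollectI exI[of _ i] exI[of _ Zero]) simp
  qed
  then have face: "face_ideal (length es) \<sigma> = (zero_face (length es) (dom \<sigma>) :: 'a mpoly set)"
    by (simp add: face_ideal_def zero_face_def)
  have "net_ideal es \<union> Var ` dom \<sigma> \<subseteq> M"
    using M'(2,3) zero_face_facts(2)[OF \<sigma>] face by blast
  note M_sup = this
  obtain h where h: "anchored (relabel h es)" "arborescence r (dom \<sigma>) (relabel h es)"
    "constants (relabel h es) = constants es" "net_ideal es \<subseteq> net_ideal (relabel h es)"
    "net_ideal (relabel h es) \<subseteq> M"
    using contract_edges[OF anch arb \<sigma>]
  proof (elim disjE exE conjE)
    assume "\<forall>N. ideal N ?R \<longrightarrow> net_ideal es \<union> Var ` dom \<sigma> \<subseteq> N \<longrightarrow> 1 \<in> N"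
    then have "1 \<in> M" using M_sup primeidealD(1)[OF M'(1)] by metis
    then show ?thesis using primeidealD(2)[OF M'(1)] by contradiction
  next
    fix h
    assume h: "anchored (relabel h es)" "arborescence r (dom \<sigma>) (relabel h es)"
      "constants (relabel h es) = constants es" "net_ideal es \<subseteq> net_ideal (relabel h es)"
      "\<forall>N. ideal N ?R \<longrightarrow> net_ideal es \<union> Var ` dom \<sigma> \<subseteq> N \<longrightarrow> net_ideal (relabel h es) \<subseteq> N"
    then have "net_ideal (relabel h es) \<subseteq> M" using M_sup primeidealD(1)[OF M'(1)] by metis
    then show ?thesis using that h by metis
  qed
  have nz': "Cst 0 \<notin> labels (relabel h es)" using h(1) by (simp add: anchored_def)
  \<comment> \<open>The ideal of the contracted network is a prime that contains both ideals and
    lies inside \<open>M\<close>; minimality makes it equal to \<open>M\<close>.\<close>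
  have "net_ideal (relabel h es) = M"
    using prime_net_ideal[OF nz'] zero_face_subset_net_ideal[OF nz' h(2)] face
    by (intro min h(4,5)) simp_all
  then show "codim ?R (face_ideal (length es) \<sigma>) M = enat (card (constants es - {r}))"
    using codim_net_ideal[OF h(1,2)] k h(3) face by simp
qed

section \<open>Faces, permutations and products\<close>

definition remove_nth :: "nat \<Rightarrow> 'x list \<Rightarrow> 'x list" where
  "remove_nth i xs = take i xs @ drop (Suc i) xs"

lemma length_remove_nth: "i < length xs \<Longrightarrow> length (remove_nth i xs) = length xs - 1"
  by (simp add: remove_nth_def)

lemma nth_remove_nth: "i < length xs \<Longrightarrow> j < length xs - 1 \<Longrightarrow>
    remove_nth i xs ! j = xs ! (if j < i then j else Suc j)"
  by (auto simp: remove_nth_def nth_append min_def)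

lemma map_remove_nth: "remove_nth i (map f xs) = map f (remove_nth i xs)"
  by (simp add: remove_nth_def take_map drop_map)

lemma coords_remove_nth: "coords \<alpha> (remove_nth i es) = remove_nth i (coords \<alpha> es)"
  by (simp add: coords_def map_remove_nth)

lemma set_remove_nth: "set (remove_nth i xs) \<subseteq> set xs"
  by (auto simp: remove_nth_def dest: in_set_takeD in_set_dropD)

lemma set_remove_nth': "i < length xs \<Longrightarrow> set xs = insert (xs ! i) (set (remove_nth i xs))"
  by (subst (1) id_take_nth_drop[of i xs]) (auto simp: remove_nth_def)

lemma distinct_remove_nth_map:
  assumes "i < length xs" "inj_on (\<lambda>j. f (xs ! j)) ({..<length xs} - {i})"
  shows "distinct (map f (remove_nth i xs))"
proof -
  have "f (remove_nth i xs ! a) \<noteq> f (remove_nth i xs ! b)" if "a < length xs - 1" "b < length xs - 1" "a \<noteq> b" for a b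
  proof
    assume eq: "f (remove_nth i xs ! a) = f (remove_nth i xs ! b)"
    have "(if a < i then a else Suc a) = (if b < i then b else Suc b)"
      using that assms(1) eq
      by (intro inj_onD[OF assms(2)]) (auto simp: nth_remove_nth split: if_splits)
    then show False using that by (auto split: if_splits)
  qed
  then show ?thesis using assms(1) by (auto simp: distinct_conv_nth length_remove_nth)
qed

lemma arborescence_iff:
  "arborescence r {} es \<longleftrightarrow> distinct (map snd es) \<and> Cst r \<notin> snd ` set es \<and>
    (\<forall>l\<in>labels es. (Cst r, l) \<in> (set es)\<^sup>*)"
proof -
  have "distinct (map snd es) \<longleftrightarrow> inj_on (\<lambda>i. snd (es ! i)) {..<length es}"
    by (auto simp: distinct_conv_nth inj_on_def)
  moreover have "Cst r \<notin> snd ` set es \<longleftrightarrow> (\<forall>i\<in>{..<length es}. snd (es ! i) \<noteq> Cst r)"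
    by (force simp: in_set_conv_nth image_iff)
  ultimately show ?thesis by (auto simp: arborescence_def)
qed

definition section_at :: "nat \<Rightarrow> 'a::field mpoly fract list set \<Rightarrow> 'a mpoly fract list set" where
  "section_at i X = {remove_nth i x | x. x \<in> X \<and> x ! i = 0}"

lemma face_map_simps:
  "face_map i e (f + g) = face_map i e f + face_map i e g" "face_map i e (f * g) = face_map i e f * face_map i e g"
  "face_map i e (Const a) = Const a" "face_map i e 1 = 1"
  "face_map i e (Var j) = (if j < i then Var j else if j = i then Const (u_value e) else Var (j - 1))"
  "face_map i e (f - g) = face_map i e f - face_map i e g" "face_map i e 0 = 0"
  by (simp_all add: face_map_def peval_simps semiring_hom_Const)

lemma face_map_closed:
  assumes "i < k" "f \<in> carrier (cube_ring k)" shows "face_map i e f \<in> carrier (cube_ring (k - 1))"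
  unfolding face_map_def using assms by (intro peval_closed[OF assms(2)]) (auto intro: cube_ring_closed)

text \<open>Pullback along the projection that forgets coordinate \<open>i\<close>, a right inverse
  of the face maps.\<close>

definition degeneracy :: "nat \<Rightarrow> 'a::field mpoly \<Rightarrow> 'a mpoly" where
  "degeneracy i = peval Const (\<lambda>j. Var (if j < i then j else Suc j))"

lemma degeneracy_closed:
  assumes "i < k" "f \<in> carrier (cube_ring (k - 1))" shows "degeneracy i f \<in> carrier (cube_ring k)"
  unfolding degeneracy_def using assms by (intro peval_closed[OF assms(2)]) (auto intro: cube_ring_closed)

lemma face_map_degeneracy [simp]: "face_map i e (degeneracy i f) = f"
proof -
  have "face_map i e (degeneracy i f) = peval Const Var f"
    unfolding degeneracy_def face_map_def peval_peval[OF semiring_hom_Const]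
    by (rule arg_cong[where f = "\<lambda>\<phi>. peval Const \<phi> f"]) (auto simp: peval_simps semiring_hom_Const)
  then show ?thesis by simp
qed

lemma peval_degeneracy:
  assumes "i < length x" "f \<in> carrier (cube_ring (length x - 1))"
  shows "peval fconst ((!) x) (degeneracy i f) = peval fconst ((!) (remove_nth i x)) f"
  unfolding degeneracy_def peval_peval[OF semiring_hom_fconst] using assms
  by (intro peval_cong[OF assms(2)]) (auto simp: fconst_simps nth_remove_nth)

lemma peval_face_map:
  assumes "i < length x" "f \<in> carrier (cube_ring (length x))" "x ! i = fconst (u_value e)"
  shows "peval fconst ((!) (remove_nth i x)) (face_map i e f) = peval fconst ((!) x) f"
  unfolding face_map_def peval_peval[OF semiring_hom_fconst] using assms
  by (intro peval_cong[OF assms(2)]) (auto simp: fconst_simps nth_remove_nth)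

lemma length_points: "x \<in> points es \<Longrightarrow> length x = length es"
  by (auto simp: points_def)

text \<open>This preimage is the sum of \<open>P\<close> and the ideal of the face, in a form that
  translates membership directly into the image of \<open>P\<close>.\<close>

lemma ideal_face_preimage:
  assumes "ideal P (cube_ring k)" "i < k"
  shows "ideal {f \<in> carrier (cube_ring k). face_map i e f \<in> face_map i e ` P} (cube_ring k)"
proof (rule cube_ring_idealI)
  note P = cube_ring_idealD[OF assms(1)]
  let ?N = "{f \<in> carrier (cube_ring k). face_map i e f \<in> face_map i e ` P}"
  show "?N \<subseteq> carrier (cube_ring k)" by blast
  show "0 \<in> ?N" using P(2) cube_ring_0 by blast
  show "f + g \<in> ?N" if fg: "f \<in> ?N" "g \<in> ?N" for f g
  proof -
    obtain f' g' where "f' \<in> P" "face_map i e f = face_map i e f'" "g' \<in> P" "face_map i e g = face_map i e g'"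
      using fg by auto
    then show ?thesis using fg P(3)[of f' g']
      by (auto simp: cube_ring_add face_map_simps intro!: image_eqI[of _ _ "f' + g'"])
  qed
  show "g * f \<in> ?N" if fg: "f \<in> ?N" "g \<in> carrier (cube_ring k)" for f g
  proof -
    obtain f' where "f' \<in> P" "face_map i e f = face_map i e f'" using fg by auto
    then show ?thesis using fg P(4)[of f' g]
      by (auto simp: cube_ring_mult face_map_simps intro!: image_eqI[of _ _ "g * f'"])
  qed
qed

text \<open>The edge is contracted and the loop deleted. One inclusion of the ideals is checked on
  points. For the other, a polynomial pulled back by \<open>degeneracy\<close> lies in the ideal of
  the contracted network, which is contained in the sum of the old ideal and that of the
  face.\<close>

lemma face_zero:
  fixes es :: "'a::field network"
  assumes anch: "anchored es" and arb: "arborescence r {} es"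
    and k: "2 \<le> length es" and i: "i < length es" and ne: "section_at i (points es) \<noteq> {}"
  shows "\<exists>es'. length es' = length es - 1 \<and> anchored es' \<and> arborescence r {} es' \<and> constants es' = constants es \<and>
    points es' = section_at i (points es) \<and> face_map i Zero ` net_ideal es = net_ideal es'"
proof -
  let ?k = "length es"
  have nz: "Cst 0 \<notin> labels es" using anch by (simp add: anchored_def)
  obtain v w where vw: "es ! i = (v, w)" by fastforce
  note l = labels_nth[OF i vw]
  have "v \<noteq> w" using arborescence_no_loop[OF arb i] vw by simp
  have val_nz: "\<alpha> l \<noteq> 0" if "valuation \<alpha>" "l \<in> labels es" for \<alpha> l
    using valuation_nonzero[OF that(1)] that(2) nz by metis
  have zero_iff: "coords \<alpha> es ! i = 0 \<longleftrightarrow> \<alpha> v = \<alpha> w" if "valuation \<alpha>" for \<alpha>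
    using val_nz[OF that] l i vw by (auto simp: nth_coords)
  have "\<not> ((\<exists>c. v = Cst c) \<and> (\<exists>c. w = Cst c))"
  proof
    assume "(\<exists>c. v = Cst c) \<and> (\<exists>c. w = Cst c)"
    moreover obtain \<alpha> where "valuation \<alpha>" "coords \<alpha> es ! i = 0"
      using ne by (auto simp: section_at_def points_def)
    ultimately show False using zero_iff \<open>v \<noteq> w\<close> by (auto simp: valuation_def)
  qed
  then obtain x y n where xy: "x = Par n" "(x = v \<and> y = w \<and> (\<exists>c. w = Cst c)) \<or> (x = w \<and> y = v)"
    by (metis label.exhaust)
  define h where "h = id(x := y)"
  define es1 where "es1 = relabel h es"
  define es' where "es' = remove_nth i es1"
  have "i \<notin> {}" by simp
  note con = arborescence_contract[OF arb anch i this vw xy, folded h_def es1_def]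
  have len: "length es1 = ?k" "length es' = ?k - 1"
    using i by (simp_all add: es1_def es'_def length_remove_nth)
  have "h v = h w" using xy by (auto simp: h_def)
  then have loop: "es1 ! i = (h v, h v)" using i vw by (simp add: es1_def)
  have set_es1: "set es1 = insert (h v, h v) (set es')"
    using set_remove_nth'[of i es1] i len loop by (simp add: es'_def)
  have rt: "(set es1)\<^sup>* = (set es')\<^sup>*"
  proof (rule antisym[OF rtrancl_subset_rtrancl rtrancl_mono])
    show "set es1 \<subseteq> (set es')\<^sup>*" "set es' \<subseteq> set es1" unfolding set_es1 by auto
  qed
  have "labels es' = labels es1"
  proof (intro equalityI subsetI)
    show "l \<in> labels es1" if "l \<in> labels es'" for l
      using that set_es1 by (auto simp: labels_def)
    \<comment> \<open>A second edge guarantees that deleting the loop loses no label, the root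
      included.\<close>
    obtain j where j: "j < ?k" "j \<noteq> i"
      using k by (cases "i = 0") (auto intro: that[of 1] that[of 0])
    have in_es': "es1 ! j \<in> set es'" if "j < ?k" "j \<noteq> i" for j
    proof -
      define j' where "j' = (if j < i then j else j - 1)"
      have "j' < length es'" using that i len by (auto simp: j'_def)
      moreover have "es' ! j' = es1 ! j"
        using that i len by (auto simp: es'_def j'_def nth_remove_nth)
      ultimately show ?thesis using nth_mem by metis
    qed
    have "snd (es1 ! j) \<in> labels es'" using in_es'[OF j] by (auto simp: labels_def)
    moreover have "snd (es1 ! j) \<in> labels es1" using j len by (auto simp: labels_def)
    then have "(Cst r, snd (es1 ! j)) \<in> (set es')\<^sup>*" using con(1) rt by (auto simp: arborescence_def)
    ultimately have r: "Cst r \<in> labels es'" using rtrancl_label by blast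
    have pos: "0 < length es1" using i len by linarith
    fix l assume "l \<in> labels es1"
    then consider "l = Cst r" | j where "j < ?k" "j \<noteq> i" "l = snd (es1 ! j)"
      using arborescence_labels[OF con(1) pos] len by auto
    then show "l \<in> labels es'"
      using r in_es' by cases (auto simp: labels_def)
  qed
  note lab = this
  have arb': "arborescence r {} es'"
    unfolding arborescence_iff
  proof (intro conjI ballI)
    show "distinct (map snd es')"
      unfolding es'_def using con(1) i len by (intro distinct_remove_nth_map) (auto simp: arborescence_def)
    show "Cst r \<notin> snd ` set es'"
    proof
      assume "Cst r \<in> snd ` set es'"
      then obtain j where "j < ?k - 1" "snd (es' ! j) = Cst r"
        using len by (auto simp: in_set_conv_nth)
      then have "snd (es1 ! (if j < i then j else Suc j)) = Cst r"
        using i len by (simp add: es'_def nth_remove_nth)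
      then show False using con(1) \<open>j < ?k - 1\<close> len unfolding arborescence_def
        by (auto split: if_splits)
    qed
    show "(Cst r, l) \<in> (set es')\<^sup>*" if "l \<in> labels es'" for l
      using that con(1) rt lab by (auto simp: arborescence_def)
  qed
  have anch': "anchored es'" using con(2) lab rt by (simp add: anchored_def)
  have "y \<noteq> Cst 0" using xy(2) l nz by auto
  have pts: "points es' = section_at i (points es)"
  proof (intro equalityI subsetI)
    fix p assume "p \<in> points es'"
    then obtain \<alpha> where \<alpha>: "valuation \<alpha>" "p = coords \<alpha> es'" by (auto simp: points_def)
    have val: "valuation (\<alpha> \<circ> h)"
      using \<alpha>(1) \<open>y \<noteq> Cst 0\<close> valuation_nonzero[OF \<alpha>(1)] xy(1) by (auto simp: valuation_def h_def)
    then have "coords (\<alpha> \<circ> h) es ! i = 0" using zero_iff \<open>h v = h w\<close> by simp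
    then show "p \<in> section_at i (points es)"
      unfolding section_at_def points_def using val \<alpha>(2)
      by (auto simp: es'_def es1_def coords_remove_nth coords_relabel)
  next
    fix p assume "p \<in> section_at i (points es)"
    then obtain \<alpha> where \<alpha>: "valuation \<alpha>" "p = remove_nth i (coords \<alpha> es)" "coords \<alpha> es ! i = 0"
      by (auto simp: section_at_def points_def)
    then have "\<alpha> v = \<alpha> w" using zero_iff by simp
    then have "\<alpha> \<circ> h = \<alpha>" using xy(2) by (auto simp: h_def fun_eq_iff)
    then have "p = coords \<alpha> es'"
      using \<alpha>(2) by (simp add: es'_def es1_def coords_remove_nth coords_relabel)
    then show "p \<in> points es'" using \<alpha>(1) by (auto simp: points_def)
  qed
  have img: "face_map i Zero ` net_ideal es = net_ideal es'"
  proof (intro equalityI subsetI)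
    fix g assume "g \<in> face_map i Zero ` net_ideal es"
    then obtain f where f: "f \<in> net_ideal es" "g = face_map i Zero f" by blast
    then have car: "f \<in> carrier (cube_ring ?k)" by (simp add: net_ideal_def vanishing_def)
    have "peval fconst ((!) p) g = 0" if p: "p \<in> points es'" for p
    proof -
      obtain q where q: "q \<in> points es" "q ! i = 0" "p = remove_nth i q"
        using p unfolding pts section_at_def by blast
      then show ?thesis
        using peval_face_map[of i q f Zero] f car i length_points[OF q(1)]
        by (simp add: net_ideal_def vanishing_def)
    qed
    then show "g \<in> net_ideal es'"
      using f(2) face_map_closed[OF i car] by (simp add: net_ideal_def vanishing_def len)
  next
    fix g assume g: "g \<in> net_ideal es'"
    define N where "N = {f \<in> carrier (cube_ring ?k). face_map i Zero f \<in> face_map i Zero ` net_ideal es}"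
    have id: "ideal (net_ideal es) (cube_ring ?k)" by (rule primeidealD(1)[OF prime_net_ideal[OF nz]])
    have N: "ideal N (cube_ring ?k)" unfolding N_def by (rule ideal_face_preimage[OF id i])
    have sub: "net_ideal es \<subseteq> N" using cube_ring_idealD(1)[OF id] by (auto simp: N_def)
    have "Var i \<in> N"
      using cube_ring_idealD(2)[OF id] i
      by (auto simp: N_def cube_ring_Var face_map_simps image_iff intro!: bexI[of _ 0])
    then have eq: "label_eq es N v w" by (rule label_eq_edge[OF nz sub N i vw])
    have "net_ideal es1 \<subseteq> N"
      unfolding es1_def
    proof (rule net_ideal_relabel_subset[OF anch sub N])
      show "h ` labels es \<subseteq> labels es" using xy l by (auto simp: h_def)
      show "label_eq es N l (h l)" if "l \<in> labels es" for l
        using eq label_eq_sym[OF N eq] label_eq_refl[OF nz sub] xy(2) by (auto simp: h_def)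
    qed
    moreover have "degeneracy i g \<in> net_ideal es1"
    proof -
      have car: "g \<in> carrier (cube_ring (?k - 1))" using g by (simp add: net_ideal_def vanishing_def len)
      have "peval fconst ((!) p) (degeneracy i g) = 0" if "p \<in> points es1" for p
      proof -
        have "remove_nth i p \<in> points es'"
          using that by (auto simp: points_def es'_def coords_remove_nth)
        then show ?thesis
          using g peval_degeneracy[of i p g] length_points[OF that] i car len
          by (simp add: net_ideal_def vanishing_def)
      qed
      then show ?thesis using degeneracy_closed[OF i car] by (simp add: net_ideal_def vanishing_def len)
    qed
    ultimately have "degeneracy i g \<in> N" by blast
    then show "g \<in> face_map i Zero ` net_ideal es" by (simp add: N_def)
  qed
  show ?thesis
    using len(2) anch' arb' con(3) lab pts img by (intro exI[of _ es']) (simp add: constants_def)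
qed

text \<open>At infinity this is \<open>face_at_infinity\<close>. At 0, an edge with a parameter at
  one end would have a point with coordinate 0, obtained by identifying its ends; so both ends are
  constants, and distinct ones.\<close>

lemma face_empty:
  fixes es :: "'a::field network"
  assumes anch: "anchored es" and arb: "arborescence r {} es" and i: "i < length es"
    and e: "e = Infty \<or> section_at i (points es) = {}"
  shows "1 \<in> face_map i e ` net_ideal es"
proof -
  let ?k = "length es"
  have nz: "Cst 0 \<notin> labels es" using anch by (simp add: anchored_def)
  define N where "N = {f \<in> carrier (cube_ring ?k). face_map i e f \<in> face_map i e ` net_ideal es}"
  have id: "ideal (net_ideal es) (cube_ring ?k)" by (rule primeidealD(1)[OF prime_net_ideal[OF nz]])
  have N: "ideal N (cube_ring ?k)" unfolding N_def by (rule ideal_face_preimage[OF id i])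
  have sub: "net_ideal es \<subseteq> N" using cube_ring_idealD(1)[OF id] by (auto simp: N_def)
  have "Var i - Const (u_value e) \<in> N"
    using cube_ring_idealD(2)[OF id] i
    by (auto simp: N_def cube_ring_closed face_map_simps image_iff intro!: bexI[of _ 0])
  then have "1 \<in> N"
  proof (cases e)
    case Infty
    then show ?thesis
      using face_at_infinity[OF anch sub N i] \<open>Var i - Const (u_value e) \<in> N\<close> by simp
  next
    case Zero
    obtain v w where vw: "es ! i = (v, w)" by fastforce
    note l = labels_nth[OF i vw]
    have "v \<noteq> w" using arborescence_no_loop[OF arb i] vw by simp
    have eq: "label_eq es N v w"
      using \<open>Var i - Const (u_value e) \<in> N\<close> Zero by (intro label_eq_edge[OF nz sub N i vw]) simp
    have "(\<exists>c. v = Cst c) \<and> (\<exists>c. w = Cst c)"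
    proof (rule ccontr)
      assume "\<not> ?thesis"
      then obtain x y n where xy: "x = Par n" "(x = v \<and> y = w) \<or> (x = w \<and> y = v)"
        by (metis label.exhaust)
      define \<alpha> where "\<alpha> = generic \<circ> id(x := y)"
      have "y \<noteq> Cst 0" using xy(2) l nz by auto
      then have \<alpha>: "valuation \<alpha>"
        using valuation_generic valuation_nonzero[OF valuation_generic] xy(1)
        by (auto simp: valuation_def \<alpha>_def)
      have "\<alpha> v = \<alpha> w" using xy(2) by (auto simp: \<alpha>_def)
      moreover have "\<alpha> v \<noteq> 0" using valuation_nonzero[OF \<alpha>] l nz by metis
      ultimately have "coords \<alpha> es ! i = 0" using i vw by (simp add: nth_coords)
      then show False using e Zero \<alpha> by (auto simp: section_at_def points_def)
    qed
    then show ?thesis using label_eq_Cst[OF N] eq \<open>v \<noteq> w\<close> by blast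
  qed
  then show ?thesis by (simp add: N_def face_map_simps)
qed

section \<open>Permutations of the coordinates\<close>

lemma nth_permute_list: "i < length xs \<Longrightarrow> permute_list \<pi> xs ! i = xs ! \<pi> i"
  by (simp add: permute_list_def)

text \<open>Substituting permuted variables into \<open>f\<close> amounts to evaluating
  \<open>f\<close> at the permuted point, which is why the permuted set stands on the left.\<close>

lemma cube_aut_vanishing:
  fixes X :: "'a::field mpoly fract list set"
  assumes \<pi>: "\<pi> permutes {..<k}" and X: "\<And>x. x \<in> X \<Longrightarrow> length x = k"
  shows "cube_aut \<pi> {} ` vanishing k (permute_list \<pi> ` X) = vanishing k X"
proof -
  have eval: "peval fconst ((!) x) (cube_aut \<pi> {} f) = peval fconst ((!) (permute_list \<pi> x)) f"
    if "f \<in> carrier (cube_ring k)" "length x = k" for x and f :: "'a mpoly"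
    unfolding cube_aut_def peval_peval[OF semiring_hom_fconst] using that
    by (intro peval_cong[OF that(1)]) (simp add: fconst_simps nth_permute_list)
  have inv: "cube_aut \<pi> {} (cube_aut (inv_into UNIV \<pi>) {} f) = f" for f :: "'a mpoly"
    unfolding cube_aut_def peval_peval[OF semiring_hom_Const]
    by (simp add: peval_Var semiring_hom_Const permutes_inverses(1)[OF \<pi>])
  have closed: "cube_aut \<rho> {} f \<in> carrier (cube_ring k)"
    if "f \<in> carrier (cube_ring k)" "\<rho> permutes {..<k}" for f :: "'a mpoly" and \<rho>
    unfolding cube_aut_def using permutes_in_image[OF that(2)]
    by (intro peval_closed[OF that(1)]) (simp add: cube_ring_Var)
  show ?thesis
  proof (intro equalityI subsetI)
    fix g assume "g \<in> cube_aut \<pi> {} ` vanishing k (permute_list \<pi> ` X)"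
    then show "g \<in> vanishing k X" using eval closed[OF _ \<pi>] X by (auto simp: vanishing_def)
  next
    fix g assume g: "g \<in> vanishing k X"
    then have car: "g \<in> carrier (cube_ring k)" by (simp add: vanishing_def)
    have car': "cube_aut (inv_into UNIV \<pi>) {} g \<in> carrier (cube_ring k)"
      by (rule closed[OF car permutes_inv[OF \<pi>]])
    have "peval fconst ((!) (permute_list \<pi> x)) (cube_aut (inv_into UNIV \<pi>) {} g) = 0" if "x \<in> X" for x
      using g that eval[OF car' X[OF that]] by (simp add: inv vanishing_def)
    then have "cube_aut (inv_into UNIV \<pi>) {} g \<in> vanishing k (permute_list \<pi> ` X)"
      using car' by (auto simp: vanishing_def)
    then show "g \<in> cube_aut \<pi> {} ` vanishing k (permute_list \<pi> ` X)"
      using inv by (intro image_eqI[of _ _ "cube_aut (inv_into UNIV \<pi>) {} g"]) simp_all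
  qed
qed

lemma points_permute:
  assumes "\<pi> permutes {..<length es}"
  shows "points (permute_list \<pi> es) = permute_list \<pi> ` points es"
proof -
  have "coords \<alpha> (permute_list \<pi> es) = permute_list \<pi> (coords \<alpha> es)" for \<alpha>
    unfolding coords_def by (rule permute_list_map[OF assms, symmetric])
  then show ?thesis by (auto simp: points_def)
qed

lemma arborescence_permute:
  assumes "\<pi> permutes {..<length es}" "anchored es" "arborescence r {} es"
  shows "anchored (permute_list \<pi> es)" "arborescence r {} (permute_list \<pi> es)"
    "constants (permute_list \<pi> es) = constants es"
proof -
  have s: "set (permute_list \<pi> es) = set es" by (rule set_permute_list[OF assms(1)])
  then have l: "labels (permute_list \<pi> es) = labels es" by (simp add: labels_def)
  have "distinct (map snd (permute_list \<pi> es)) \<longleftrightarrow> distinct (map snd es)"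
    using mset_permute_list[OF assms(1)] by (metis mset_map mset_eq_imp_distinct_iff)
  then show "anchored (permute_list \<pi> es)" "arborescence r {} (permute_list \<pi> es)"
    "constants (permute_list \<pi> es) = constants es"
    using assms(2,3) s l by (simp_all add: anchored_def arborescence_iff constants_def)
qed

section \<open>Exterior products, after renaming the parameters of the factors\<close>

lemma points_rename:
  assumes "inj g"
  shows "points (relabel (case_label Cst (\<lambda>n. Par (g n))) es) = points es"
proof (intro equalityI subsetI)
  let ?h = "case_label Cst (\<lambda>n. Par (g n))"
  fix p assume "p \<in> points (relabel ?h es)"
  then obtain \<alpha> where \<alpha>: "valuation \<alpha>" "p = coords \<alpha> (relabel ?h es)" by (auto simp: points_def)
  moreover have "valuation (\<alpha> \<circ> ?h)" using \<alpha>(1) by (simp add: valuation_def)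
  ultimately show "p \<in> points es" by (auto simp: points_def coords_relabel)
next
  let ?h = "case_label Cst (\<lambda>n. Par (g n))"
  fix p assume "p \<in> points es"
  then obtain \<alpha> where \<alpha>: "valuation \<alpha>" "p = coords \<alpha> es" by (auto simp: points_def)
  define \<beta> where "\<beta> = case_label fconst (\<lambda>n. \<alpha> (Par (inv_into UNIV g n)))"
  have "valuation \<beta>" using \<alpha>(1) by (simp add: valuation_def \<beta>_def)
  moreover have "\<beta> \<circ> ?h = \<alpha>"
  proof
    show "(\<beta> \<circ> ?h) l = \<alpha> l" for l
      using \<alpha>(1) assms by (cases l) (simp_all add: \<beta>_def valuation_def)
  qed
  then have "p = coords \<beta> (relabel ?h es)" using \<alpha>(2) by (simp add: coords_relabel)
  ultimately show "p \<in> points (relabel ?h es)" by (auto simp: points_def)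
qed

lemma anchored_relabel:
  assumes "anchored es" "\<And>c. h (Cst c) = Cst c" "\<And>n. h (Par n) \<noteq> Cst 0"
  shows "anchored (relabel h es)"
  unfolding anchored_def
proof (intro conjI ballI)
  show "Cst 0 \<notin> labels (relabel h es)"
  proof
    assume "Cst 0 \<in> labels (relabel h es)"
    then obtain l where "l \<in> labels es" "Cst 0 = h l" by auto
    then show False using assms by (cases l) (auto simp: anchored_def)
  qed
  fix l' assume "l' \<in> labels (relabel h es)"
  then obtain l where l: "l \<in> labels es" "l' = h l" by auto
  then obtain c d where "(Cst c, l) \<in> (set es)\<^sup>*" "(l, Cst d) \<in> (set es)\<^sup>*"
    using assms(1) unfolding anchored_def by blast
  from this[THEN rtrancl_relabel, of h] l(2) assms(2)
  show "\<exists>c. (Cst c, l') \<in> (set (relabel h es))\<^sup>*" "\<exists>c. (l', Cst c) \<in> (set (relabel h es))\<^sup>*" by auto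
qed

definition concat_points :: "'x list set \<Rightarrow> 'x list set \<Rightarrow> 'x list set" where
  "concat_points X Y = {x @ y | x y. x \<in> X \<and> y \<in> Y}"

definition shift_vars :: "nat \<Rightarrow> 'a::field mpoly \<Rightarrow> 'a mpoly" where
  "shift_vars k = peval Const (\<lambda>i. Var (k + i))"

lemma shift_vars_simps:
  "shift_vars k (f + g) = shift_vars k f + shift_vars k g" "shift_vars k (f - g) = shift_vars k f - shift_vars k g"
  "shift_vars k (f * g) = shift_vars k f * shift_vars k g" "shift_vars k (Const a) = Const a"
  "shift_vars k (Var i) = Var (k + i)" "shift_vars k 1 = 1"
  by (simp_all add: shift_vars_def peval_simps semiring_hom_Const)

lemma shift_vars_closed: "f \<in> carrier (cube_ring l) \<Longrightarrow> shift_vars k f \<in> carrier (cube_ring (k + l))"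
  unfolding shift_vars_def by (rule peval_closed) (auto intro: cube_ring_Var)

lemma coords_cong:
  assumes "\<And>l. l \<in> labels es \<Longrightarrow> \<alpha> l = \<beta> l" shows "coords \<alpha> es = coords \<beta> es"
  unfolding coords_def
proof (rule map_cong[OF refl])
  fix e assume "e \<in> set es"
  then have "fst e \<in> labels es" "snd e \<in> labels es" by (auto simp: labels_def)
  then show "(case e of (v, w) \<Rightarrow> 1 - \<alpha> w / \<alpha> v) = (case e of (v, w) \<Rightarrow> 1 - \<beta> w / \<beta> v)"
    using assms by (simp add: case_prod_beta)
qed

lemma coords_append: "coords \<alpha> (es @ es') = coords \<alpha> es @ coords \<alpha> es'"
  by (simp add: coords_def)

text \<open>With disjoint parameters the two networks together form one network, whose points are
  the concatenations and whose ideal is prime. The generated ideal contains that ideal because the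
  elements representing the labels of either factor satisfy all edge relations modulo it.\<close>

lemma prod_ideal_disjoint:
  fixes es es' :: "'a::field network"
  assumes anch: "anchored es" "anchored es'"
    and disj: "\<And>n. Par n \<in> labels es \<Longrightarrow> Par n \<notin> labels es'"
  shows "prod_ideal (length es) (length es') (net_ideal es) (net_ideal es')
    = vanishing (length es + length es') (concat_points (points es) (points es'))"
proof -
  let ?k = "length es" and ?l = "length es'" and ?E = "es @ es'"
  let ?R = "cube_ring (?k + ?l) :: 'a mpoly ring"
  have nz: "Cst 0 \<notin> labels es" "Cst 0 \<notin> labels es'" using anch by (simp_all add: anchored_def)
  have lab: "labels ?E = labels es \<union> labels es'" by (auto simp: labels_def)
  have nzE: "Cst 0 \<notin> labels ?E" using nz by (simp add: lab)
  have pts: "concat_points (points es) (points es') = points ?E"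
  proof (intro equalityI subsetI)
    fix p assume "p \<in> concat_points (points es) (points es')"
    then obtain \<alpha> \<beta> where \<alpha>: "valuation \<alpha>" "valuation \<beta>" "p = coords \<alpha> es @ coords \<beta> es'"
      by (auto simp: concat_points_def points_def)
    define \<gamma> where "\<gamma> = (\<lambda>l. if l \<in> labels es then \<alpha> l else \<beta> l)"
    have g: "valuation \<gamma>" using \<alpha>(1,2) by (simp add: valuation_def \<gamma>_def)
    have "\<gamma> l = \<beta> l" if "l \<in> labels es'" for l
      using that disj \<alpha>(1,2) by (cases l) (auto simp: \<gamma>_def valuation_def)
    then have "coords \<gamma> es' = coords \<beta> es'" by (rule coords_cong)
    moreover have "coords \<gamma> es = coords \<alpha> es" by (rule coords_cong) (simp add: \<gamma>_def)
    ultimately have "p = coords \<gamma> ?E" using \<alpha>(3) by (simp add: coords_append)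
    then show "p \<in> points ?E" using g by (auto simp: points_def)
  qed (auto simp: concat_points_def points_def coords_append)
  have van: "vanishing (?k + ?l) (concat_points (points es) (points es')) = net_ideal ?E"
    by (simp add: net_ideal_def pts)
  have mem: "f \<in> net_ideal es \<longleftrightarrow> f \<in> carrier (cube_ring ?k) \<and> gen_val es f = 0" for f
    by (rule mem_net_ideal[OF nz(1)])
  have mem': "f \<in> net_ideal es' \<longleftrightarrow> f \<in> carrier (cube_ring ?l) \<and> gen_val es' f = 0" for f
    by (rule mem_net_ideal[OF nz(2)])
  let ?gen = "net_ideal es \<union> shift_vars ?k ` net_ideal es'"
  define N where "N = prod_ideal ?k ?l (net_ideal es) (net_ideal es')"
  have N_gen: "N = genideal ?R ?gen" by (simp add: N_def prod_ideal_def shift_vars_def)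
  interpret R: cring ?R by (rule cube_ring_cring)
  have gen_car: "?gen \<subseteq> carrier ?R"
    using mem mem' shift_vars_closed cube_ring_mono[of _ ?k "?k + ?l"] by auto
  have N: "ideal N ?R" "?gen \<subseteq> N" and N_min: "\<And>J. ideal J ?R \<Longrightarrow> ?gen \<subseteq> J \<Longrightarrow> N \<subseteq> J"
    unfolding N_gen using R.genideal_ideal[OF gen_car] R.genideal_self[OF gen_car] R.genideal_minimal by blast+
  have "N \<subseteq> net_ideal ?E"
  proof (rule N_min)
    show "ideal (net_ideal ?E) ?R" using primeidealD(1)[OF prime_net_ideal[OF nzE]] by simp
    have "gen_val ?E f = gen_val es f" if "f \<in> carrier (cube_ring ?k)" for f
      using that by (intro peval_cong[OF that]) (simp add: coords_append nth_append)
    moreover have "gen_val ?E (shift_vars ?k f) = gen_val es' f" if "f \<in> carrier (cube_ring ?l)" for f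
      unfolding shift_vars_def peval_peval[OF semiring_hom_fconst]
      by (intro peval_cong[OF that]) (simp add: coords_append nth_append fconst_simps)
    ultimately show "?gen \<subseteq> net_ideal ?E"
      using gen_car mem mem' by (auto simp: mem_net_ideal[OF nzE])
  qed
  moreover have "net_ideal ?E \<subseteq> N"
  proof
    fix f assume "f \<in> net_ideal ?E"
    then have f: "f \<in> carrier (cube_ring (length ?E))" "gen_val ?E f = 0" by (simp_all add: mem_net_ideal[OF nzE])
    interpret subring_ideal "carrier ?R" N using N(1) by (rule ideal_subring_ideal)
    obtain G H where G: "\<And>l. G l \<in> carrier (cube_ring ?k)" "\<And>l. H l \<in> carrier (cube_ring ?k)"
      "\<And>l. l \<in> labels es \<Longrightarrow> gen_val es (G l) = generic l"
      "\<And>l. l \<in> labels es \<Longrightarrow> gen_val es (G l * H l) = 1"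
      using anchored_elements[OF anch(1)] by blast
    obtain G' H' where G': "\<And>l. G' l \<in> carrier (cube_ring ?l)" "\<And>l. H' l \<in> carrier (cube_ring ?l)"
      "\<And>l. l \<in> labels es' \<Longrightarrow> gen_val es' (G' l) = generic l"
      "\<And>l. l \<in> labels es' \<Longrightarrow> gen_val es' (G' l * H' l) = 1"
      using anchored_elements[OF anch(2)] by blast
    have eqv_1: "eqv N p q" if "p \<in> carrier (cube_ring ?k)" "q \<in> carrier (cube_ring ?k)"
      "gen_val es p = gen_val es q" for p q
    proof -
      have "p - q \<in> net_ideal es" using that by (simp add: mem fconst_simps cube_ring_closed)
      then show ?thesis using N(2) by (auto simp: eqv_def)
    qed
    have eqv_2: "eqv N (shift_vars ?k p) (shift_vars ?k q)" if "p \<in> carrier (cube_ring ?l)" "q \<in> carrier (cube_ring ?l)"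
      "gen_val es' p = gen_val es' q" for p q
    proof -
      have "p - q \<in> net_ideal es'" using that by (simp add: mem' fconst_simps cube_ring_closed)
      then have "shift_vars ?k (p - q) \<in> N" using N(2) by blast
      then show ?thesis by (simp add: eqv_def shift_vars_simps)
    qed
    have c1: "eqv N (G (Cst a)) (Const a)" if "Cst a \<in> labels es" for a
      using that G by (intro eqv_1 cube_ring_Const) (auto simp: fconst_simps generic_Cst)
    have c2: "eqv N (shift_vars ?k (G' (Cst a))) (Const a)" if "Cst a \<in> labels es'" for a
    proof -
      have "eqv N (shift_vars ?k (G' (Cst a))) (shift_vars ?k (Const a))"
        using that G' by (intro eqv_2 cube_ring_Const) (auto simp: fconst_simps generic_Cst)
      then show ?thesis by (simp add: shift_vars_simps)
    qed
    \<comment> \<open>A label occurring in both factors is a constant, and both of its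
      representatives are congruent to this constant; so the preference for the first factor does
      not matter modulo \<open>N\<close>.\<close>
    define K where "K = (\<lambda>l. if l \<in> labels es then G l else shift_vars ?k (G' l))"
    have up: "p \<in> carrier (cube_ring ?k) \<Longrightarrow> p \<in> carrier ?R" for p :: "'a mpoly"
      by (rule cube_ring_mono[OF _ le_add1])
    have K2: "eqv N (K l) (shift_vars ?k (G' l))" if l: "l \<in> labels es'" for l
    proof (cases "l \<in> labels es")
      case True
      then obtain a where "l = Cst a" using disj l by (cases l) auto
      then show ?thesis using True l eqv_trans[OF c1 eqv_sym[OF c2]] by (simp add: K_def)
    qed (simp add: K_def)
    have K_car: "K l \<in> carrier ?R" for l
      by (simp add: K_def G(1) G'(1) up shift_vars_closed)
    have "peval Const (\<lambda>i. if i < ?k + ?l then Var i else 0) f \<in> N"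
    proof (rule relation_transfer[OF semiring_hom_Const cube_ring_Const f nzE, where G = K])
      show "(if i < ?k + ?l then Var i else 0) \<in> carrier ?R" for i
        by (auto intro: cube_ring_closed)
      show "eqv N (K (Cst a)) (Const a)" if "Cst a \<in> labels ?E" for a
        using that c1[of a] c2[of a] by (auto simp: K_def lab)
      show "\<exists>x\<in>carrier ?R. eqv N (K l * x) 1" if "l \<in> labels ?E" for l
      proof (cases "l \<in> labels es")
        case True
        then have "eqv N (K l * H l) 1"
          unfolding K_def using G by (auto intro!: eqv_1 cube_ring_closed simp: fconst_simps)
        then show ?thesis using G(2) up by blast
      next
        case False
        then have "l \<in> labels es'" using that lab by blast
        then have "eqv N (shift_vars ?k (G' l * H' l)) (shift_vars ?k 1)"
          using G' by (intro eqv_2 cube_ring_closed) (auto simp: fconst_simps)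
        then show ?thesis using False G'(2) shift_vars_closed
          by (intro bexI[of _ "shift_vars ?k (H' l)"]) (auto simp: K_def shift_vars_simps)
      qed
      show "eqv N ((if i < ?k + ?l then Var i else 0) * K v) (K v - K w)"
        if i: "i < length ?E" "?E ! i = (v, w)" for i v w
      proof (cases "i < ?k")
        case True
        then have vw: "es ! i = (v, w)" using i by (simp add: nth_append)
        note l = labels_nth[OF True vw]
        have "Var i * G v - (G v - G w) \<in> net_ideal es"
          using G l by (intro edge_relation[OF nz(1) True vw]) auto
        then show ?thesis using True l N(2) by (auto simp: eqv_def K_def)
      next
        case False
        define j where "j = i - ?k"
        have j: "j < ?l" "es' ! j = (v, w)" "i = ?k + j" using False i by (auto simp: j_def nth_append)
        note l = labels_nth[OF j(1,2)]
        have "Var j * G' v - (G' v - G' w) \<in> net_ideal es'"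
          using G' l by (intro edge_relation[OF nz(2) j(1,2)]) auto
        then have "shift_vars ?k (Var j * G' v - (G' v - G' w)) \<in> N" using N(2) by blast
        then have 1: "eqv N (Var i * shift_vars ?k (G' v)) (shift_vars ?k (G' v) - shift_vars ?k (G' w))"
          by (simp add: eqv_def shift_vars_simps j(3))
        have "eqv N (Var i * K v) (Var i * shift_vars ?k (G' v))"
          using i(1) K_car by (intro eqv_mult K2) (auto simp: l intro: cube_ring_closed)
        also note 1
        also have "eqv N (shift_vars ?k (G' v) - shift_vars ?k (G' w)) (K v - K w)"
          using l by (intro eqv_diff eqv_sym[OF K2]) auto
        finally show ?thesis using i(1) by simp
      qed
    qed (rule K_car)
    moreover have "peval Const (\<lambda>i. if i < ?k + ?l then Var i else 0) f = peval Const Var f"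
      using f(1) by (intro peval_cong) auto
    ultimately show "f \<in> N" by simp
  qed
  ultimately show ?thesis unfolding van N_def[symmetric] by blast
qed

text \<open>Even and odd numbers separate the parameters of the two factors without changing their
  points.\<close>

lemma prod_ideal_net_ideal:
  fixes es es' :: "'a::field network"
  assumes anch: "anchored es" "anchored es'"
  shows "prod_ideal (length es) (length es') (net_ideal es) (net_ideal es')
    = vanishing (length es + length es') (concat_points (points es) (points es'))"
proof -
  define h :: "'a label \<Rightarrow> 'a label" where "h = case_label Cst (\<lambda>n. Par (2 * n))"
  define h' :: "'a label \<Rightarrow> 'a label" where "h' = case_label Cst (\<lambda>n. Par (2 * n + 1))"
  have pts: "points (relabel h es) = points es" "points (relabel h' es') = points es'"
    unfolding h_def h'_def by (rule points_rename; simp add: inj_def)+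
  have anch': "anchored (relabel h es)" "anchored (relabel h' es')"
    using anch by (auto intro!: anchored_relabel simp: h_def h'_def)
  have "Par n \<notin> labels (relabel h' es')" if n: "Par n \<in> labels (relabel h es)" for n
  proof
    assume "Par n \<in> labels (relabel h' es')"
    then obtain l' where "Par n = h' l'" by auto
    then have "odd n" by (cases l') (auto simp: h'_def)
    obtain l where "Par n = h l" using n by auto
    then have "even n" by (cases l) (auto simp: h_def)
    then show False using \<open>odd n\<close> by contradiction
  qed
  from prod_ideal_disjoint[OF anch' this] show ?thesis
    by (simp add: net_ideal_def pts)
qed

section \<open>Fundamental cycles of prime ideals\<close>

lemma subring_cring:
  fixes C :: "'r::comm_ring_1 set"
  assumes "0 \<in> C" "1 \<in> C" "\<And>x. x \<in> C \<Longrightarrow> - x \<in> C"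
    "\<And>x y. x \<in> C \<Longrightarrow> y \<in> C \<Longrightarrow> x + y \<in> C" "\<And>x y. x \<in> C \<Longrightarrow> y \<in> C \<Longrightarrow> x * y \<in> C"
  shows "cring \<lparr>carrier = C, monoid.mult = (*), one = 1, zero = 0, add = (+)\<rparr>"
proof -
  let ?R = "\<lparr>carrier = C, monoid.mult = (*), one = 1, zero = 0, add = (+)\<rparr>"
  have "abelian_group ?R"
  proof (rule abelian_groupI)
    show "\<exists>y\<in>carrier ?R. y \<oplus>\<^bsub>?R\<^esub> x = \<zero>\<^bsub>?R\<^esub>" if "x \<in> carrier ?R" for x
      using assms(3)[of x] that by (intro bexI[of _ "- x"]) auto
  qed (use assms in \<open>auto simp: ac_simps\<close>)
  moreover have "comm_monoid ?R"
    by (rule comm_monoidI) (use assms in \<open>auto simp: ac_simps\<close>)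
  ultimately show ?thesis
    by (rule cringI) (simp add: distrib_right)
qed

lemma ideal_of_subring:
  fixes C I :: "'r::comm_ring_1 set"
  defines "R \<equiv> \<lparr>carrier = C, monoid.mult = (*), one = 1, zero = 0, add = (+)\<rparr>"
  assumes R: "cring R" and "I \<subseteq> C" "0 \<in> I" "\<And>x. x \<in> I \<Longrightarrow> - x \<in> I" "\<And>x y. x \<in> I \<Longrightarrow> y \<in> I \<Longrightarrow> x + y \<in> I"
    "\<And>x y. x \<in> I \<Longrightarrow> y \<in> C \<Longrightarrow> y * x \<in> I"
  shows "ideal I R"
proof -
  interpret cring R by fact
  have sel: "carrier R = C" "x \<otimes>\<^bsub>R\<^esub> y = x * y" "x \<oplus>\<^bsub>R\<^esub> y = x + y" "\<zero>\<^bsub>R\<^esub> = 0" for x y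
    by (simp_all add: R_def)
  have "\<ominus>\<^bsub>R\<^esub> x = - x" if "x \<in> I" for x
    using that assms by (intro minus_equality) (auto simp: sel)
  then have inv: "inv\<^bsub>add_monoid R\<^esub> x \<in> I" if "x \<in> I" for x
    using that assms(5)[OF that] by (simp add: a_inv_def)
  have "subgroup I (add_monoid R)"
    by (rule subgroup.intro) (use assms(3-) inv in \<open>simp_all add: sel\<close>)
  then show ?thesis
    using assms(3-) by (intro idealI ring_axioms) (auto simp: sel mult.commute)
qed

lemma ring_length_field:
  assumes "field Q" shows "ring_length Q = 1"
proof -
  interpret field Q by fact
  let ?A = "{n. \<exists>c :: nat \<Rightarrow> 'a set. (\<forall>i\<le>n. ideal (c i) Q) \<and> (\<forall>i<n. c i \<subset> c (Suc i))}"
  have ideals: "ideal I Q \<longleftrightarrow> I = {\<zero>\<^bsub>Q\<^esub>} \<or> I = carrier Q" for I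
    using all_ideals by blast
  have "\<one>\<^bsub>Q\<^esub> \<in> carrier Q" "\<zero>\<^bsub>Q\<^esub> \<in> carrier Q" "\<one>\<^bsub>Q\<^esub> \<noteq> \<zero>\<^bsub>Q\<^esub>" by simp_all
  then have "{\<zero>\<^bsub>Q\<^esub>} \<subset> carrier Q" by blast
  then have "1 \<in> ?A"
    by (intro CollectI exI[of _ "\<lambda>i. if i = 0 then {\<zero>\<^bsub>Q\<^esub>} else carrier Q"]) (auto simp: ideals)
  then have "enat 1 \<le> (SUP n\<in>?A. enat n)" by (rule SUP_upper)
  moreover have "n \<le> 1" if "n \<in> ?A" for n
  proof (rule ccontr)
    assume "\<not> n \<le> 1"
    then have n: "0 \<le> n" "1 \<le> n" "2 \<le> n" "0 < n" "1 < n" by auto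
    obtain c where c: "\<forall>i\<le>n. ideal (c i) Q" "\<forall>i<n. c i \<subset> c (Suc i)" using \<open>n \<in> ?A\<close> by blast
    have "c 0 \<subset> c 1" "c 1 \<subset> c 2" using c(2) n by (auto simp: numeral_2_eq_2)
    moreover have "ideal (c 0) Q" "ideal (c 1) Q" "ideal (c 2) Q" using c(1) n by blast+
    ultimately show False using \<open>{\<zero>\<^bsub>Q\<^esub>} \<subset> carrier Q\<close> unfolding ideals by auto
  qed
  then have "(SUP n\<in>?A. enat n) \<le> enat 1" by (intro SUP_least) simp
  ultimately show ?thesis
    unfolding ring_length_def by (simp add: one_enat_def order.antisym)
qed

text \<open>The quotient is the residue field of the local ring: an element outside the extended
  ideal has a numerator outside \<open>P\<close> and is therefore invertible.\<close>

lemma multiplicity_at_prime: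
  fixes P :: "'a::field mpoly set"
  assumes P: "primeideal P (cube_ring k)"
  shows "multiplicity_at k P P = 1"
proof -
  let ?C = "carrier (cube_ring k) :: 'a mpoly set"
  note id = cube_ring_idealD[OF primeidealD(1)[OF P]]
  have nP: "g * g' \<in> ?C - P" if "g \<in> ?C - P" "g' \<in> ?C - P" for g g'
    using that primeidealD(3)[OF P] cube_ring_mult by blast
  have nz: "g \<noteq> 0" if "g \<in> ?C - P" for g using that id(2) by auto
  define L where "L = loc_ideal k P ?C"
  define m where "m = loc_ideal k P P"
  have L_iff: "x \<in> L \<longleftrightarrow> (\<exists>f g. x = Fract f g \<and> f \<in> ?C \<and> g \<in> ?C - P)" for x
    by (auto simp: L_def loc_ideal_def)
  have m_iff: "x \<in> m \<longleftrightarrow> (\<exists>f g. x = Fract f g \<and> f \<in> P \<and> g \<in> ?C - P)" for x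
    by (auto simp: m_def loc_ideal_def)
  have one: "1 \<in> ?C - P" using primeidealD(2)[OF P] cube_ring_1 by blast
  have L: "0 \<in> L" "1 \<in> L"
    unfolding L_iff using one cube_ring_0[of k] by (auto simp: Zero_fract_def One_fract_def)
  have L_um: "- x \<in> L" if x: "x \<in> L" for x
  proof -
    obtain f g where "x = Fract f g" "f \<in> ?C" "g \<in> ?C - P" using x unfolding L_iff by blast
    then show ?thesis unfolding L_iff by (intro exI[of _ "- f"] exI[of _ g]) (auto intro: cube_ring_uminus)
  qed
  have L_add: "x + y \<in> L" and L_mult: "x * y \<in> L" if xy: "x \<in> L" "y \<in> L" for x y
  proof -
    obtain f g f' g' where xy: "x = Fract f g" "f \<in> ?C" "g \<in> ?C - P" "y = Fract f' g'" "f' \<in> ?C" "g' \<in> ?C - P"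
      using xy unfolding L_iff by blast
    then have "g \<noteq> 0" "g' \<noteq> 0" using nz by auto
    then have "x + y = Fract (f * g' + f' * g) (g * g')" "x * y = Fract (f * f') (g * g')"
      using xy by simp_all
    moreover have "f * g' + f' * g \<in> ?C" "f * f' \<in> ?C" using xy by (auto intro: cube_ring_add cube_ring_mult)
    ultimately show "x + y \<in> L" "x * y \<in> L" using nP[OF xy(3,6)] unfolding L_iff by blast+
  qed
  define R where "R = (loc_ring k P :: 'a mpoly fract ring)"
  have R: "R = \<lparr>carrier = L, monoid.mult = (*), one = 1, zero = 0, add = (+)\<rparr>"
    by (simp add: R_def loc_ring_def L_def)
  have cr: "cring R" unfolding R by (rule subring_cring) (use L L_um L_add L_mult in auto)
  have id_m: "ideal m R"
    unfolding R
  proof (rule ideal_of_subring[OF cr[unfolded R]])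
    show "m \<subseteq> L" using m_iff L_iff id(1) by blast
    show "0 \<in> m" unfolding m_iff using one id(2) by (intro exI[of _ 0] exI[of _ 1]) (auto simp: Zero_fract_def)
    show "- x \<in> m" if x: "x \<in> m" for x
    proof -
      obtain f g where "x = Fract f g" "f \<in> P" "g \<in> ?C - P" using x unfolding m_iff by blast
      then show ?thesis using id(5)[of 0 f] id(2) unfolding m_iff by (intro exI[of _ "- f"] exI[of _ g]) auto
    qed
    show "x + y \<in> m" if xy: "x \<in> m" "y \<in> m" for x y
    proof -
      obtain f g f' g' where xy: "x = Fract f g" "f \<in> P" "g \<in> ?C - P" "y = Fract f' g'" "f' \<in> P" "g' \<in> ?C - P"
        using xy unfolding m_iff by blast
      then have "g \<noteq> 0" "g' \<noteq> 0" using nz by auto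
      then have "x + y = Fract (g' * f + g * f') (g * g')"
        using xy by (simp add: mult.commute)
      moreover have "g' * f + g * f' \<in> P" using xy id(3,4) by auto
      ultimately show ?thesis using nP[OF xy(3,6)] unfolding m_iff by blast
    qed
    show "y * x \<in> m" if xy: "x \<in> m" "y \<in> L" for x y
    proof -
      obtain f g f' g' where xy: "x = Fract f g" "f \<in> P" "g \<in> ?C - P" "y = Fract f' g'" "f' \<in> ?C" "g' \<in> ?C - P"
        using xy unfolding m_iff L_iff by blast
      then have "y * x = Fract (f' * f) (g' * g)" by simp
      moreover have "f' * f \<in> P" using xy id(4) by auto
      ultimately show ?thesis using nP[OF xy(6,3)] unfolding m_iff by blast
    qed
  qed
  have "maximalideal m R"
  proof (rule maximalidealI[OF id_m])
    have "1 \<notin> m"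
    proof
      assume "1 \<in> m"
      then obtain f g where fg: "1 = Fract f g" "f \<in> P" "g \<in> ?C - P" unfolding m_iff by blast
      then have "f = g" using nz[OF fg(3)] by (simp add: One_fract_def eq_fract)
      then show False using fg by blast
    qed
    then show "carrier R \<noteq> m" using L(2) by (auto simp: R)
    fix J assume J: "ideal J R" "m \<subseteq> J" "J \<subseteq> carrier R"
    show "J = m \<or> J = carrier R"
    proof (cases "J \<subseteq> m")
      case False
      then obtain x where x: "x \<in> J" "x \<notin> m" by blast
      then have "x \<in> L" using J(3) by (auto simp: R)
      then obtain f g where fg: "x = Fract f g" "f \<in> ?C" "g \<in> ?C - P" using L_iff[of x] by blast
      then have f: "f \<in> ?C - P" using x(2) m_iff by blast
      then have "Fract g f \<in> L" using fg unfolding L_iff by blast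
      then have "Fract g f * x \<in> J"
        using ideal.I_l_closed[OF J(1) x(1), of "Fract g f"] by (simp add: R)
      moreover have "Fract g f * x = 1"
        using fg nz[OF f] nz[OF fg(3)] by (simp add: One_fract_def eq_fract mult.commute)
      ultimately have "\<one>\<^bsub>R\<^esub> \<in> J" by (simp add: R)
      then show ?thesis using ideal.one_imp_carrier[OF J(1)] by blast
    qed (use J(2) in blast)
  qed
  then have "field (R Quot m)"
    by (rule maximalideal.quotient_is_field[OF _ cr])
  from ring_length_field[OF this] show ?thesis
    by (simp add: multiplicity_at_def R_def m_def one_enat_def)
qed

lemma fund_cycle_prime:
  assumes P: "primeideal P (cube_ring k)"
  shows "fund_cycle k P = Poly_Mapping.single (k, P) 1"
proof -
  have "minimal_primes (cube_ring k) P = {P}"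
    unfolding minimal_primes_def using P by auto
  then show ?thesis by (simp add: fund_cycle_def multiplicity_at_prime[OF P])
qed

lemma fund_cycle_unit:
  assumes "1 \<in> I" shows "fund_cycle k I = 0"
proof -
  have "minimal_primes (cube_ring k) I = {}"
    using assms primeidealD(2) by (auto simp: minimal_primes_def subset_iff)
  then show ?thesis by (simp add: fund_cycle_def)
qed

section \<open>Linear algebra of cycles\<close>

interpretation qs: vector_space scale
  by (rule vector_space_scale)

lemma lin_ext_superset:
  assumes "finite A" "Poly_Mapping.keys Z \<subseteq> A"
  shows "lin_ext h Z = (\<Sum>x\<in>A. scale (Poly_Mapping.lookup Z x) (h x))"
  unfolding lin_ext_def using assms
  by (intro sum.mono_neutral_left) (auto simp: in_keys_iff)

lemma lin_ext_add: "lin_ext h (Z + W) = lin_ext h Z + lin_ext h W"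
proof -
  let ?A = "Poly_Mapping.keys Z \<union> Poly_Mapping.keys W"
  have "Poly_Mapping.keys (Z + W) \<subseteq> ?A" by (rule Poly_Mapping.keys_add)
  then show ?thesis
    by (simp add: lin_ext_superset[where A = ?A] lookup_add qs.scale_left_distrib sum.distrib)
qed

lemma lin_ext_single: "lin_ext h (Poly_Mapping.single x c) = scale c (h x)"
  by (cases "c = 0") (simp_all add: lin_ext_def)

lemma lin_ext_0 [simp]: "lin_ext h 0 = 0"
  by (simp add: lin_ext_def)

lemma lin_ext_sum: "lin_ext h (sum F A) = (\<Sum>a\<in>A. lin_ext h (F a))"
  by (induction A rule: infinite_finite_induct) (simp_all add: lin_ext_add)

lemma adm_cycles_0: "0 \<in> adm_cycles A"
  by (simp add: adm_cycles_def)

lemma adm_cycles_add: "Z \<in> adm_cycles A \<Longrightarrow> W \<in> adm_cycles A \<Longrightarrow> Z + W \<in> adm_cycles A"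
  using Poly_Mapping.keys_add[of Z W] unfolding adm_cycles_def by blast

lemma adm_cycles_scale: "Z \<in> adm_cycles A \<Longrightarrow> scale c Z \<in> adm_cycles A"
  unfolding adm_cycles_def by (auto simp: in_keys_iff)

lemma adm_cycles_single:
  "admissible_subvariety k p P \<Longrightarrow> p \<in> A \<Longrightarrow> Poly_Mapping.single (k, P) c \<in> adm_cycles A"
  by (auto simp: adm_cycles_def split: if_splits)

definition product_span :: "'a::field cyc set" where
  "product_span = qspan {cyc_mult Z W | Z W. Z \<in> adm_cycles {0<..} \<and> W \<in> adm_cycles {0<..}}"

text \<open>A condition on representatives, so that boundary terms can be treated one by one and
  added. \<open>D\<close> is required to be admissible because \<open>nc_rel\<close> relates
  admissible cycles only.\<close>

definition dec_cycle :: "'a::field cyc \<Rightarrow> bool" where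
  "dec_cycle Z \<longleftrightarrow> Z \<in> adm_cycles UNIV \<and>
    (\<exists>D\<in>product_span \<inter> adm_cycles UNIV. Z - D \<in> alt_relations)"

lemma alt_relations_subspace: "qs.subspace alt_relations"
  unfolding alt_relations_def by (rule qs.subspace_span)

lemma dec_cycle_0: "dec_cycle 0"
  unfolding dec_cycle_def product_span_def
  using qs.span_zero qs.subspace_0[OF alt_relations_subspace] adm_cycles_0
  by (intro conjI bexI[of _ 0]) auto

lemma dec_cycle_add:
  assumes "dec_cycle Z" "dec_cycle W" shows "dec_cycle (Z + W)"
proof -
  obtain D E where "D \<in> product_span \<inter> adm_cycles UNIV" "Z - D \<in> alt_relations"
    "E \<in> product_span \<inter> adm_cycles UNIV" "W - E \<in> alt_relations"
    using assms unfolding dec_cycle_def by blast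
  moreover from this have "(Z - D) + (W - E) \<in> alt_relations"
    using qs.subspace_add[OF alt_relations_subspace] by blast
  moreover have "(Z - D) + (W - E) = (Z + W) - (D + E)" by simp
  ultimately show ?thesis
    using assms qs.span_add unfolding dec_cycle_def product_span_def
    by (intro conjI bexI[of _ "D + E"]) (auto intro: adm_cycles_add)
qed

lemma dec_cycle_scale:
  assumes "dec_cycle Z" shows "dec_cycle (scale c Z)"
proof -
  obtain D where "D \<in> product_span \<inter> adm_cycles UNIV" "Z - D \<in> alt_relations"
    using assms unfolding dec_cycle_def by blast
  moreover from this have "scale c (Z - D) \<in> alt_relations"
    using qs.subspace_scale[OF alt_relations_subspace] by blast
  moreover have "scale c (Z - D) = scale c Z - scale c D" by (rule qs.scale_right_diff_distrib)
  ultimately show ?thesis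
    using assms qs.span_scale unfolding dec_cycle_def product_span_def
    by (intro conjI bexI[of _ "scale c D"]) (auto intro: adm_cycles_scale)
qed

lemma dec_cycle_sum: "(\<And>a. a \<in> A \<Longrightarrow> dec_cycle (F a)) \<Longrightarrow> dec_cycle (sum F A)"
  by (induction A rule: infinite_finite_induct) (auto intro: dec_cycle_0 dec_cycle_add)

lemma dec_cycle_decomposable:
  assumes "dec_cycle Z" shows "decomposable (nc_class Z)"
proof -
  obtain D where D: "D \<in> product_span" "D \<in> adm_cycles UNIV" "Z - D \<in> alt_relations" and Z: "Z \<in> adm_cycles UNIV"
    using assms unfolding dec_cycle_def by blast
  have "Z - W \<in> alt_relations \<longleftrightarrow> D - W \<in> alt_relations" for W
  proof
    assume "Z - W \<in> alt_relations"
    then have "(Z - W) - (Z - D) \<in> alt_relations" using D(3) qs.subspace_diff[OF alt_relations_subspace] by blast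
    then show "D - W \<in> alt_relations" by simp
  next
    assume "D - W \<in> alt_relations"
    then have "(D - W) + (Z - D) \<in> alt_relations" using D(3) qs.subspace_add[OF alt_relations_subspace] by blast
    then show "Z - W \<in> alt_relations" by simp
  qed
  then have "nc_class Z = nc_class D"
    using Z D(2) by (auto simp: nc_class_def nc_rel_def)
  moreover have "nc_class Z \<in> adm_cycles UNIV // nc_rel"
    unfolding nc_class_def using Z by (rule quotientI)
  ultimately show ?thesis
    using D(1) unfolding decomposable_def product_span_def by blast
qed

section \<open>Boundary terms\<close>

text \<open>The empty case is separate because the ideal of the empty set is the whole ring, which
  is not prime.\<close>

definition point_cycle :: "nat \<Rightarrow> 'a::field mpoly fract list set \<Rightarrow> 'a cyc" where
  "point_cycle k X = (if X = {} then 0 else Poly_Mapping.single (k, vanishing k X) 1)"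

text \<open>All multiplicities are 1 and the terms at infinity vanish. The last assumption takes
  care of a single edge, whose removal would leave no network to describe the face.\<close>

lemma boundary_net_ideal:
  fixes es :: "'a::field network"
  assumes anch: "anchored es" and arb: "arborescence r {} es"
    and k: "2 \<le> length es \<or> (\<forall>i<length es. section_at i (points es) = {})"
  shows "boundary (Poly_Mapping.single (length es, net_ideal es) 1) =
    (\<Sum>i<length es. scale ((- 1) ^ i) (point_cycle (length es - 1) (section_at i (points es))))"
proof -
  have inf: "fund_cycle (length es - 1) (face_map i Infty ` net_ideal es) = 0" if "i < length es" for i
    using face_empty[OF anch arb that] by (intro fund_cycle_unit) simp
  have zero: "fund_cycle (length es - 1) (face_map i Zero ` net_ideal es)
      = point_cycle (length es - 1) (section_at i (points es))" if i: "i < length es" for i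
  proof (cases "section_at i (points es) = {}")
    case True
    then show ?thesis
      using face_empty[OF anch arb i] by (simp add: point_cycle_def fund_cycle_unit)
  next
    case False
    then obtain es' where es': "length es' = length es - 1" "anchored es'"
      "points es' = section_at i (points es)" "face_map i Zero ` net_ideal es = net_ideal es'"
      using face_zero[OF anch arb _ i False] k i by blast
    have "primeideal (net_ideal es') (cube_ring (length es - 1))"
      using prime_net_ideal[of es'] es'(1,2) by (simp add: anchored_def)
    then show ?thesis
      using False es' by (simp add: fund_cycle_prime point_cycle_def net_ideal_def)
  qed
  show ?thesis
    by (simp add: boundary_def lin_ext_single inf zero del: One_nat_def)
qed

lemma cyc_mult_net_ideal:
  fixes es es' :: "'a::field network"
  assumes "anchored es" "anchored es'"
    and "primeideal (vanishing (length es + length es') (concat_points (points es) (points es'))) (cube_ring (length es + length es'))"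
  shows "cyc_mult (Poly_Mapping.single (length es, net_ideal es) 1) (Poly_Mapping.single (length es', net_ideal es') 1)
    = Poly_Mapping.single (length es + length es', vanishing (length es + length es') (concat_points (points es) (points es'))) 1"
  using assms by (simp add: cyc_mult_def lin_ext_single prod_ideal_net_ideal fund_cycle_prime)

text \<open>\<open>permute_list\<close> reads entry \<open>\<rho> i\<close> at place
  \<open>i\<close>: after the common block of length \<open>l\<close>, the places for
  \<open>C\<close> look \<open>n\<close> further and those for \<open>B\<close> look
  \<open>m\<close> back.\<close>

lemma block_swap_permutes:
  assumes "\<rho> = (\<lambda>i. if i < l then i else if i < l + m then i + n else if i < l + m + n then i - m else i)"
  shows "\<rho> permutes {..<l + m + n}"
    and "\<And>A B C. length A = l \<Longrightarrow> length B = n \<Longrightarrow> length C = m \<Longrightarrow> permute_list \<rho> (A @ B @ C) = A @ C @ B"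
proof -
  have "inj_on \<rho> {..<l + m + n}" by (auto simp: inj_on_def assms split: if_splits)
  moreover have "\<rho> ` {..<l + m + n} \<subseteq> {..<l + m + n}" by (auto simp: assms)
  ultimately have "bij_betw \<rho> {..<l + m + n} {..<l + m + n}"
    by (simp add: bij_betw_def endo_inj_surj)
  then show "\<rho> permutes {..<l + m + n}"
    by (rule bij_imp_permutes) (simp add: assms)
  show "permute_list \<rho> (A @ B @ C) = A @ C @ B"
    if "length A = l" "length B = n" "length C = m" for A B C :: "'x list"
    using that by (intro nth_equalityI) (auto simp: permute_list_def nth_append assms add_ac)
qed

text \<open>A face of an admissible cycle whose points are those of a product with the coordinates of the
  second factor inserted after the first \<open>l\<close> coordinates is a product up to sign.\<close>

lemma dec_cycle_product:
  fixes es es1 es2 :: "'a::field network"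
  assumes es: "anchored es" "arborescence r {} es"
    and es1: "anchored es1" "arborescence r1 {} es1" "constants es1 - {r1} \<noteq> {}"
    and es2: "anchored es2" "arborescence r2 {} es2" "constants es2 - {r2} \<noteq> {}"
    and len: "length es = length es1 + length es2" "l \<le> length es1" "0 < length es1" "0 < length es2"
    and pts: "points es = {A @ B @ C | A B C. length A = l \<and> A @ C \<in> points es1 \<and> B \<in> points es2}"
  shows "dec_cycle (Poly_Mapping.single (length es, net_ideal es) 1)"
proof -
  define m where "m = length es1 - l"
  define n where "n = length es2"
  define \<rho> where "\<rho> = (\<lambda>i. if i < l then i else if i < l + m then i + n else if i < l + m + n then i - m else i)"
  have k: "l + m + n = length es" using len by (simp add: m_def n_def)
  note \<rho> = block_swap_permutes[OF \<rho>_def]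
  have perm: "\<rho> permutes {..<length es}" using \<rho>(1) k by simp
  define es' where "es' = permute_list \<rho> es"
  note es' = arborescence_permute[OF perm es, folded es'_def]
  have len': "length es' = length es" by (simp add: es'_def)
  have pts': "points es' = concat_points (points es1) (points es2)"
  proof -
    have "permute_list \<rho> (A @ B @ C) = A @ C @ B"
      if "length A = l" "A @ C \<in> points es1" "B \<in> points es2" for A B C
      using \<rho>(2)[OF that(1)] length_points[OF that(2)] length_points[OF that(3)] that(1) by (simp add: m_def n_def)
    then have 1: "points es' = {A @ C @ B | A B C. length A = l \<and> A @ C \<in> points es1 \<and> B \<in> points es2}"
      unfolding es'_def points_permute[OF perm] pts by force
    show ?thesis
    proof (intro equalityI subsetI)
      fix p assume "p \<in> concat_points (points es1) (points es2)"
      then obtain x B where x: "p = x @ B" "x \<in> points es1" "B \<in> points es2" by (auto simp: concat_points_def)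
      have "p = take l x @ drop l x @ B" "length (take l x) = l" "take l x @ drop l x \<in> points es1"
        using x length_points[OF x(2)] len(2) by (simp_all flip: append_assoc)
      then show "p \<in> points es'" using x(3) unfolding 1 by blast
    next
      fix p assume "p \<in> points es'"
      then obtain A B C where "p = A @ C @ B" "A @ C \<in> points es1" "B \<in> points es2" unfolding 1 by blast
      then show "p \<in> concat_points (points es1) (points es2)"
        unfolding concat_points_def by (intro CollectI exI[of _ "A @ C"] exI[of _ B]) simp
    qed
  qed
  have pos: "0 < length es" using len by simp
  have adm: "admissible_subvariety (length es) (card (constants es - {r})) (net_ideal es)"
    by (rule admissible_net_ideal[OF es pos])
  have adm': "admissible_subvariety (length es) (card (constants es - {r})) (net_ideal es')"
    using admissible_net_ideal[OF es'(1,2)] pos es'(3) len' by simp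
  have fin: "finite (constants es')" for es' :: "'a network"
    using finite_surj[OF finite_labels[of es'], of "constants es'" "\<lambda>l. case l of Cst c \<Rightarrow> c | _ \<Rightarrow> r"]
    by (force simp: constants_def image_iff)
  have adm12: "Poly_Mapping.single (length es1, net_ideal es1) 1 \<in> adm_cycles {0<..}"
    "Poly_Mapping.single (length es2, net_ideal es2) 1 \<in> adm_cycles {0<..}"
    using es1(3) es2(3) fin
    by (auto intro!: adm_cycles_single[OF admissible_net_ideal[OF es1(1,2) len(3)]]
        adm_cycles_single[OF admissible_net_ideal[OF es2(1,2) len(4)]] simp: card_gt_0_iff)
  have prime: "primeideal (net_ideal es') (cube_ring (length es))"
    using prime_net_ideal[of es'] es'(1) len' by (simp add: anchored_def)
  define Q where "Q = Poly_Mapping.single (length es, net_ideal es') (1 :: rat)"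
  have van: "net_ideal es' = vanishing (length es1 + length es2) (concat_points (points es1) (points es2))"
    using len(1) len' by (simp add: net_ideal_def pts')
  have "Q = cyc_mult (Poly_Mapping.single (length es1, net_ideal es1) 1) (Poly_Mapping.single (length es2, net_ideal es2) 1)"
    using cyc_mult_net_ideal[OF es1(1) es2(1)] prime unfolding Q_def van len(1) by simp
  then have Q: "Q \<in> product_span"
    unfolding product_span_def using adm12 by (intro qs.span_base) blast
  have "cube_aut \<rho> {} ` net_ideal es' = net_ideal es"
    unfolding net_ideal_def len' using cube_aut_vanishing[OF perm, of "points es"]
    by (simp add: es'_def points_permute[OF perm] length_points)
  then have "Poly_Mapping.single (length es, net_ideal es) (hyp_sign \<rho> {}) - Q \<in> alt_relations"
    unfolding alt_relations_def Q_def using adm' perm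
    by (intro qs.span_base CollectI exI[of _ "length es"] exI[of _ "card (constants es - {r})"]
        exI[of _ "net_ideal es'"] exI[of _ \<rho>] exI[of _ "{}"]) auto
  \<comment> \<open>The relation carries the sign on the cycle of \<open>es\<close>; the sign is its
    own inverse, so multiplication by it moves it to the product.\<close>
  then have "scale (hyp_sign \<rho> {}) (Poly_Mapping.single (length es, net_ideal es) (hyp_sign \<rho> {}) - Q) \<in> alt_relations"
    by (rule qs.subspace_scale[OF alt_relations_subspace])
  moreover have sgn: "hyp_sign \<rho> {} * hyp_sign \<rho> {} = 1"
    by (simp add: hyp_sign_def sign_def)
  have "scale (hyp_sign \<rho> {}) (Poly_Mapping.single (length es, net_ideal es) (hyp_sign \<rho> {}) - Q)
      = Poly_Mapping.single (length es, net_ideal es) 1 - scale (hyp_sign \<rho> {}) Q"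
    by (rule poly_mapping_eqI) (simp add: lookup_minus lookup_single when_def right_diff_distrib sgn)
  ultimately show ?thesis
    unfolding dec_cycle_def using adm adm' Q
    by (intro conjI bexI[of _ "scale (hyp_sign \<rho> {}) Q"])
      (auto intro!: adm_cycles_scale adm_cycles_single simp: Q_def product_span_def qs.span_scale)
qed

section \<open>Parametrizations of trivalent trees\<close>

lemma trivalent_induct [consumes 1, case_names Leaf Node]:
  assumes "trivalent t" "\<And>x. P (Leaf x)"
    "\<And>s t. trivalent s \<Longrightarrow> trivalent t \<Longrightarrow> P s \<Longrightarrow> P t \<Longrightarrow> P (Node [s, t])"
  shows "P t"
  using assms(1)
proof (induction t)
  case (Node ts)
  then obtain a b where "ts = [a, b]" by (auto simp: length_Suc_conv numeral_2_eq_2)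
  with Node show ?case by (auto intro: assms(3))
qed (rule assms(2))

lemma trivalent_cases:
  "trivalent t \<Longrightarrow> (\<exists>x. t = Leaf x) \<or> (\<exists>a b. t = Node [a, b] \<and> trivalent a \<and> trivalent b)"
  by (induction rule: trivalent_induct) auto

definition is_node :: "'r plane_tree \<Rightarrow> bool" where
  "is_node t \<longleftrightarrow> (\<exists>ts. t = Node ts)"

lemma is_node_simps [simp]: "\<not> is_node (Leaf x)" "is_node (Node ts)"
  by (simp_all add: is_node_def)

text \<open>The edge above the top vertex is counted, so a leaf has one edge. The default 1 keeps
  the number positive for every tree.\<close>

fun nedges :: "'r plane_tree \<Rightarrow> nat" where
  "nedges (Node [s, t]) = Suc (nedges s + nedges t)"
| "nedges _ = 1"

lemma nedges_leaves: "trivalent t \<Longrightarrow> nedges t + 1 = 2 * length (leaves t)"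
  by (induction rule: trivalent_induct) auto

text \<open>The root edge runs from the parameter \<open>y\<close> to a new one, \<open>z\<close>,
  on which two subtrees hang. Keeping the sets as functions of the parameter above lets a subtree be
  replaced by a modified one, such as a face of it.\<close>

definition graft :: "('a::field mpoly fract \<Rightarrow> 'a mpoly fract list set) \<Rightarrow>
    ('a mpoly fract \<Rightarrow> 'a mpoly fract list set) \<Rightarrow> 'a mpoly fract \<Rightarrow> 'a mpoly fract list set" where
  "graft X Y y = {(1 - z / y) # p @ q | z p q. z \<noteq> 0 \<and> p \<in> X z \<and> q \<in> Y z}"

text \<open>The points of the variety of a tree whose root edge starts at a vertex with parameter \<open>y\<close>,
  when the parameters of the internal vertices run through the nonzero rational functions.\<close>

fun tree_points :: "'a::field plane_tree \<Rightarrow> 'a mpoly fract \<Rightarrow> 'a mpoly fract list set" where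
  "tree_points (Leaf x) = (\<lambda>y. {[1 - fconst x / y]})"
| "tree_points (Node [s, t]) = graft (tree_points s) (tree_points t)"
| "tree_points (Node _) = (\<lambda>y. {})"

lemma length_tree_points: "trivalent t \<Longrightarrow> p \<in> tree_points t y \<Longrightarrow> length p = nedges t"
  by (induction arbitrary: p y rule: trivalent_induct) (auto simp: graft_def)

text \<open>\<open>a\<close> is the address of the top vertex and \<open>u\<close> the label at the
  upper end of the edge to it. Parameters are numbered by addresses exactly as in
  \<open>vertex_value\<close>, so the generic point gives the parametrization in
  \<open>Phi\<close>.\<close>

fun subnet :: "nat list \<Rightarrow> 'a label \<Rightarrow> 'a plane_tree \<Rightarrow> 'a network" where
  "subnet a u (Leaf x) = [(u, Cst x)]"
| "subnet a u (Node [s, t]) = (u, Par (to_nat a)) #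
     subnet (0 # a) (Par (to_nat a)) s @ subnet (1 # a) (Par (to_nat a)) t"
| "subnet a u (Node _) = []"

lemma length_subnet: "trivalent t \<Longrightarrow> length (subnet a u t) = nedges t"
  by (induction arbitrary: a u rule: trivalent_induct) auto

lemma coords_Cons: "coords \<alpha> ((v, w) # es) = (1 - \<alpha> w / \<alpha> v) # coords \<alpha> es"
  by (simp add: coords_def)

lemma coords_subnet_mem:
  assumes "trivalent t" "valuation \<alpha>"
  shows "coords \<alpha> (subnet a u t) \<in> tree_points t (\<alpha> u)"
  using assms(1)
proof (induction arbitrary: a u rule: trivalent_induct)
  case (Leaf x)
  then show ?case using assms(2) by (simp add: coords_def valuation_def)
next
  case (Node s t)
  let ?v = "Par (to_nat a)"
  have "\<alpha> ?v \<noteq> 0" using assms(2) by (simp add: valuation_def)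
  then show ?case using Node.IH(1)[of "0 # a" ?v] Node.IH(2)[of "1 # a" ?v]
    by (auto simp: coords_Cons coords_append graft_def)
qed

text \<open>Membership in \<open>tree_points\<close> makes an independent choice of a parameter at
  every internal vertex; the choices are collected in a function \<open>\<beta>\<close> of the
  relative address. Quantifying over \<open>a\<close> makes \<open>\<beta>\<close> usable wherever
  the subtree sits.\<close>

lemma subnet_valuation_exists:
  assumes "trivalent t" "p \<in> tree_points t y"
  shows "\<exists>\<beta>. (\<forall>q. \<beta> q \<noteq> 0) \<and> (\<forall>a u \<alpha>. valuation \<alpha> \<longrightarrow> \<alpha> u = y \<longrightarrow>
    (\<forall>q. \<alpha> (Par (to_nat (q @ a))) = \<beta> q) \<longrightarrow> coords \<alpha> (subnet a u t) = p)"
  using assms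
proof (induction arbitrary: p y rule: trivalent_induct)
  case (Leaf x)
  then show ?case by (intro exI[of _ "\<lambda>_. 1"]) (auto simp: coords_def valuation_def)
next
  case (Node s t)
  then obtain z p1 p2 where z: "z \<noteq> 0" "p1 \<in> tree_points s z" "p2 \<in> tree_points t z" "p = (1 - z / y) # p1 @ p2"
    by (auto simp: graft_def)
  obtain b1 where b1: "\<And>q. b1 q \<noteq> 0" "\<And>a u \<alpha>. valuation \<alpha> \<Longrightarrow> \<alpha> u = z \<Longrightarrow>
      (\<forall>q. \<alpha> (Par (to_nat (q @ a))) = b1 q) \<Longrightarrow> coords \<alpha> (subnet a u s) = p1"
    using Node.IH(1)[OF z(2)] by blast
  obtain b2 where b2: "\<And>q. b2 q \<noteq> 0" "\<And>a u \<alpha>. valuation \<alpha> \<Longrightarrow> \<alpha> u = z \<Longrightarrow>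
      (\<forall>q. \<alpha> (Par (to_nat (q @ a))) = b2 q) \<Longrightarrow> coords \<alpha> (subnet a u t) = p2"
    using Node.IH(2)[OF z(3)] by blast
  \<comment> \<open>Addresses store the last step first, so \<open>last q\<close> is the first step
    and names the subtree, and \<open>butlast q\<close> is the address inside it.\<close>
  define \<beta> where "\<beta> = (\<lambda>q :: nat list. if q = [] then z else if last q = 0 then b1 (butlast q) else b2 (butlast q))"
  have "coords \<alpha> (subnet a u (Node [s, t])) = p"
    if \<alpha>: "valuation \<alpha>" "\<alpha> u = y" "\<forall>q. \<alpha> (Par (to_nat (q @ a))) = \<beta> q" for a u \<alpha>
  proof -
    have v: "\<alpha> (Par (to_nat a)) = z" using \<alpha>(3)[rule_format, of "[]"] by (simp add: \<beta>_def)
    have "\<alpha> (Par (to_nat (q @ 0 # a))) = b1 q" for q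
      using \<alpha>(3)[rule_format, of "q @ [0]"] by (simp add: \<beta>_def)
    then have 1: "coords \<alpha> (subnet (0 # a) (Par (to_nat a)) s) = p1"
      using b1(2)[OF \<alpha>(1) v] by blast
    have "\<alpha> (Par (to_nat (q @ 1 # a))) = b2 q" for q
      using \<alpha>(3)[rule_format, of "q @ [1]"] by (simp add: \<beta>_def)
    then have 2: "coords \<alpha> (subnet (1 # a) (Par (to_nat a)) t) = p2"
      using b2(2)[OF \<alpha>(1) v] by blast
    show ?thesis using 1 2 v \<alpha>(2) z(4) by (simp add: coords_Cons coords_append)
  qed
  moreover have "\<beta> q \<noteq> 0" for q using z(1) b1(1) b2(1) by (simp add: \<beta>_def)
  ultimately show ?case by blast
qed

lemma points_subnet:
  assumes "trivalent t"
  shows "points (subnet [] (Cst r) t) = tree_points t (fconst r)"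
proof (intro equalityI subsetI)
  fix p assume "p \<in> points (subnet [] (Cst r) t)"
  then obtain \<alpha> where "valuation \<alpha>" "p = coords \<alpha> (subnet [] (Cst r) t)" by (auto simp: points_def)
  then show "p \<in> tree_points t (fconst r)"
    using coords_subnet_mem[OF assms, of \<alpha> "[]" "Cst r"] by (simp add: valuation_def)
next
  fix p assume "p \<in> tree_points t (fconst r)"
  then obtain \<beta> where \<beta>: "\<And>q. \<beta> q \<noteq> 0" "\<And>a u \<alpha>. valuation \<alpha> \<Longrightarrow> \<alpha> u = fconst r \<Longrightarrow>
      (\<forall>q. \<alpha> (Par (to_nat (q @ a))) = \<beta> q) \<Longrightarrow> coords \<alpha> (subnet a u t) = p"
    using subnet_valuation_exists[OF assms] by metis
  define \<alpha> where "\<alpha> = case_label fconst (\<lambda>n. \<beta> (from_nat n))"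
  have "valuation \<alpha>" using \<beta>(1) by (simp add: valuation_def \<alpha>_def)
  moreover from this have "coords \<alpha> (subnet [] (Cst r) t) = p"
    by (intro \<beta>(2)) (auto simp: \<alpha>_def)
  ultimately show "p \<in> points (subnet [] (Cst r) t)" by (auto simp: points_def)
qed

lemma subnet_targets:
  assumes "trivalent t"
  shows "snd ` set (subnet a u t) \<subseteq> Cst ` set (leaves t) \<union> range (\<lambda>q. Par (to_nat (q @ a)))"
  using assms
proof (induction arbitrary: a u rule: trivalent_induct)
  case (Node s t)
  define R :: "'a label set" where "R = range (\<lambda>q. Par (to_nat (q @ a)))"
  let ?v = "Par (to_nat a) :: 'a label"
  have R: "range (\<lambda>q. Par (to_nat (q @ i # a))) \<subseteq> R" for i
  proof
    fix l :: "'a label" assume "l \<in> range (\<lambda>q. Par (to_nat (q @ i # a)))"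
    then obtain q where "l = Par (to_nat ((q @ [i]) @ a))" by auto
    then show "l \<in> R" unfolding R_def by blast
  qed
  have "?v \<in> R" unfolding R_def by (rule range_eqI[of _ _ "[]"]) simp
  moreover have "insert v (A \<union> B) \<subseteq> (C \<union> D) \<union> R" if "A \<subseteq> C \<union> R" "B \<subseteq> D \<union> R" "v \<in> R"
    for v :: "'a label" and A B C D using that by blast
  moreover note subset_trans[OF Node.IH(1)[of "0 # a" ?v] Un_mono[OF subset_refl R]]
    subset_trans[OF Node.IH(2)[of "1 # a" ?v] Un_mono[OF subset_refl R]]
  ultimately have "insert ?v (snd ` set (subnet (0 # a) ?v s) \<union> snd ` set (subnet (1 # a) ?v t))
      \<subseteq> (Cst ` set (leaves s) \<union> Cst ` set (leaves t)) \<union> R" by simp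
  then show ?case by (simp add: image_Un R_def)
qed auto

lemma subnet_leaves:
  assumes "trivalent t" shows "Cst ` set (leaves t) \<subseteq> snd ` set (subnet a u t)"
  using assms
proof (induction arbitrary: a u rule: trivalent_induct)
  case (Node s t)
  from Node.IH(1)[of "0 # a" "Par (to_nat a)"] Node.IH(2)[of "1 # a" "Par (to_nat a)"]
  show ?case by (simp add: image_Un) blast
qed simp

lemma distinct_subnet_targets:
  assumes "trivalent t" "distinct (leaves t)"
  shows "distinct (map snd (subnet a u t))"
  using assms
proof (induction arbitrary: a u rule: trivalent_induct)
  case (Node s t)
  let ?v = "Par (to_nat a) :: 'a label"
  let ?S = "snd ` set (subnet (0 # a) ?v s)" and ?T = "snd ` set (subnet (1 # a) ?v t)"
  have S: "?S \<subseteq> Cst ` set (leaves s) \<union> range (\<lambda>q. Par (to_nat (q @ 0 # a)))"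
    and T: "?T \<subseteq> Cst ` set (leaves t) \<union> range (\<lambda>q. Par (to_nat (q @ 1 # a)))"
    using Node.hyps by (auto simp del: One_nat_def dest: subsetD[OF subnet_targets])
  have "q @ 0 # a \<noteq> q' @ 1 # a" for q q' :: "nat list"
  proof
    assume "q @ 0 # a = q' @ 1 # a"
    then have "(q @ [0]) @ a = (q' @ [1]) @ a" by simp
    then have "q @ [0] = q' @ [1]" by (simp only: append_same_eq)
    then show False by simp
  qed
  moreover have "a \<noteq> q @ i # a" for q i using arg_cong[of a "q @ i # a" length] by auto
  moreover have "set (leaves s) \<inter> set (leaves t) = {}" using Node.prems by simp
  ultimately have "?S \<inter> ?T = {}" "?v \<notin> ?S" "?v \<notin> ?T"
    using S T by (fastforce dest: subsetD)+
  then show ?case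
    using Node.IH[of _ ?v] Node.prems by simp
qed simp

lemma subnet_sources:
  assumes "trivalent t"
  shows "fst ` set (subnet a u t) \<subseteq> insert u (snd ` set (subnet a u t) \<inter> range Par)"
  using assms
proof (induction arbitrary: a u rule: trivalent_induct)
  case (Node s t)
  from Node.IH(1)[of "0 # a" "Par (to_nat a)"] Node.IH(2)[of "1 # a" "Par (to_nat a)"]
  show ?case by (auto simp: image_Un)
qed auto

lemma subnet_reachable:
  assumes "trivalent t" "l \<in> labels (subnet a u t)"
  shows "(u, l) \<in> (set (subnet a u t))\<^sup>*"
  using assms
proof (induction arbitrary: a u rule: trivalent_induct)
  case (Leaf x)
  then show ?case by (auto simp: labels_def)
next
  case (Node s t)
  let ?v = "Par (to_nat a) :: 'a label"
  let ?E = "set (subnet a u (Node [s, t]))"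
  have sub: "set (subnet (0 # a) ?v s) \<subseteq> ?E" "set (subnet (1 # a) ?v t) \<subseteq> ?E" by auto
  have uv: "(u, ?v) \<in> ?E" by simp
  have "l = u \<or> l = ?v \<or> l \<in> labels (subnet (0 # a) ?v s) \<or> l \<in> labels (subnet (1 # a) ?v t)"
    using Node.prems by (auto simp: labels_def)
  then consider "l = u" | "(?v, l) \<in> ?E\<^sup>*"
    using Node.IH(1)[of "0 # a" ?v] Node.IH(2)[of "1 # a" ?v]
      rtrancl_mono[OF sub(1)] rtrancl_mono[OF sub(2)] by blast
  then show ?case
  proof cases
    case 2
    then show ?thesis using uv by (rule converse_rtrancl_into_rtrancl[rotated])
  qed simp
qed

lemma subnet_reaches_leaf:
  assumes "trivalent t" "l \<in> labels (subnet a u t)"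
  shows "\<exists>c. (l, Cst c) \<in> (set (subnet a u t))\<^sup>*"
  using assms
proof (induction arbitrary: a u l rule: trivalent_induct)
  case (Leaf x)
  then show ?case by (auto simp: labels_def)
next
  case (Node s t)
  let ?v = "Par (to_nat a) :: 'a label"
  let ?E = "set (subnet a u (Node [s, t]))"
  have sub: "set (subnet (0 # a) ?v s) \<subseteq> ?E" "set (subnet (1 # a) ?v t) \<subseteq> ?E" by auto
  have uv: "(u, ?v) \<in> ?E" by simp
  have "?v \<in> labels (subnet (0 # a) ?v s)"
    using \<open>trivalent s\<close> by (cases rule: trivalent_induct) (auto simp: labels_def)
  moreover have "\<exists>c. (m, Cst c) \<in> ?E\<^sup>*"
    if "m \<in> labels (subnet (0 # a) ?v s) \<or> m \<in> labels (subnet (1 # a) ?v t)" for m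
    using that Node.IH(1)[of m "0 # a" ?v] Node.IH(2)[of m "1 # a" ?v]
      rtrancl_mono[OF sub(1)] rtrancl_mono[OF sub(2)] by blast
  moreover have "l = u \<or> l = ?v \<or> l \<in> labels (subnet (0 # a) ?v s) \<or> l \<in> labels (subnet (1 # a) ?v t)"
    using Node.prems by (auto simp: labels_def)
  ultimately show ?case using uv by (metis converse_rtrancl_into_rtrancl)
qed

lemma vertex_value_generic:
  assumes "trivalent t" "generic u = y"
  shows "(y, vertex_value a t) # edges_below a t = map (map_prod generic generic) (subnet a u t)"
  using assms
proof (induction arbitrary: a u y rule: trivalent_induct)
  case (Leaf x)
  then show ?case by (simp add: generic_def)
next
  case (Node s t)
  have g: "generic (Par (to_nat a)) = Fract (Var (to_nat a)) (1 :: 'a mpoly)" by (simp add: generic_def)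
  show ?case
    using Node.IH(1)[OF g, of "0 # a"] Node.IH(2)[OF g, of "1 # a"] Node.prems
    by (simp add: upt_rec g)
qed

lemma edge_coord_u_eq:
  assumes "y \<noteq> 0" "y' \<noteq> 0" shows "edge_coord_u (y, y') = 1 - y' / y"
proof -
  have "(1 - y / y') / (1 - y / y' - 1) = 1 - y' / y"
    using assms by (simp add: field_simps)
  then show ?thesis by (simp add: edge_coord_u_def)
qed

text \<open>The passage from trees to networks. Distinct decorations give every vertex a label of
  its own, and the points as well as the generic coordinates are read off from the same list of
  edges.\<close>

lemma tree_network:
  fixes t :: "'a::field plane_tree"
  assumes t: "trivalent t" and r: "distinct (r # leaves t)" "0 \<notin> set (r # leaves t)"
  shows "\<exists>es. length es = nedges t \<and> points es = tree_points t (fconst r) \<and> anchored es \<and>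
    arborescence r {} es \<and> constants es - {r} = set (leaves t) \<and>
    map edge_coord_u (edge_list (Planted r t)) = coords generic es"
proof -
  define es where "es = subnet [] (Cst r) t"
  have tgt: "snd ` set es \<subseteq> Cst ` set (leaves t) \<union> range Par"
    using subnet_targets[OF t, of "[]" "Cst r"] unfolding es_def by blast
  have lvs: "Cst ` set (leaves t) \<subseteq> snd ` set es" unfolding es_def by (rule subnet_leaves[OF t])
  have src: "fst ` set es \<subseteq> insert (Cst r) (range Par)"
    using subnet_sources[OF t, of "[]" "Cst r"] unfolding es_def by blast
  have reach: "(Cst r, l) \<in> (set es)\<^sup>*" "\<exists>c. (l, Cst c) \<in> (set es)\<^sup>*" if "l \<in> labels es" for l
    using subnet_reachable[OF t] subnet_reaches_leaf[OF t] that unfolding es_def by blast+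
  have lab: "labels es \<subseteq> insert (Cst r) (Cst ` set (leaves t) \<union> range Par)"
    using tgt src by (auto simp: labels_def)
  have nz: "Cst 0 \<notin> labels es" using lab r(2) by auto
  have anch: "anchored es" using nz reach by (auto simp: anchored_def)
  have "Cst r \<notin> snd ` set es" using tgt r(1) by auto
  then have arb: "arborescence r {} es"
    using distinct_subnet_targets[OF t, of "[]" "Cst r"] r(1) reach
    by (auto simp: arborescence_iff es_def)
  have const: "constants es - {r} = set (leaves t)"
    using lab lvs r(1) by (auto simp: constants_def labels_def)
  have "generic (Cst r) = Fract (Const r) 1" by (simp add: generic_def)
  from vertex_value_generic[OF t this, of "[]"]
  have "edge_list (Planted r t) = map (map_prod generic generic) es" by (simp add: es_def)
  moreover have "edge_coord_u (map_prod generic generic e) = (case e of (v, w) \<Rightarrow> 1 - generic w / generic v)"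
    if "e \<in> set es" for e
  proof -
    have "fst e \<in> labels es" "snd e \<in> labels es" using that by (auto simp: labels_def)
    then show ?thesis
      using generic_nonzero[OF nz] by (cases e) (simp add: edge_coord_u_eq)
  qed
  ultimately have "map edge_coord_u (edge_list (Planted r t)) = coords generic es"
    by (simp add: coords_def)
  then show ?thesis
    using anch arb const points_subnet[OF t] length_subnet[OF t] unfolding es_def by blast
qed

section \<open>Cancellation of the internal edges\<close>

text \<open>Positions in the edge list of the edges that join two internal vertices. Position 0 is
  the edge above; the first subtree begins at position 1 and the second at
  \<open>Suc (nedges s)\<close>.\<close>

fun inner :: "'r plane_tree \<Rightarrow> nat set" where
  "inner (Node [s, t]) = (if is_node s then {1} else {}) \<union> Suc ` inner s \<union>
     (if is_node t then {Suc (nedges s)} else {}) \<union> (\<lambda>j. Suc (nedges s + j)) ` inner t"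
| "inner _ = {}"

lemma inner_bounds: "trivalent t \<Longrightarrow> inner t \<subseteq> {1..<nedges t}"
proof (induction rule: trivalent_induct)
  case (Node s t)
  have "0 < nedges s" "0 < nedges t"
    using nedges_leaves[OF Node.hyps(1)] nedges_leaves[OF Node.hyps(2)]
      trivalent_leaves_nonempty[OF Node.hyps(1)] trivalent_leaves_nonempty[OF Node.hyps(2)] by (auto intro: gr0I)
  then show ?case using Node.IH by (auto split: if_splits)
qed simp

lemma sum_inner:
  assumes "trivalent s" "trivalent t"
  shows "(\<Sum>j\<in>inner (Node [s, t]). f j) = (if is_node s then f 1 else 0) + (\<Sum>j\<in>inner s. f (Suc j)) +
    (if is_node t then f (Suc (nedges s)) else 0) + (\<Sum>j\<in>inner t. f (Suc (nedges s + j)))"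
proof -
  note b = inner_bounds[OF assms(1)] inner_bounds[OF assms(2)]
  have fin: "finite (inner s)" "finite (inner t)" using b finite_subset by blast+
  have n: "0 < nedges s" by (cases s rule: nedges.cases) auto
  let ?A = "if is_node s then {1} else {} :: nat set" and ?B = "Suc ` inner s"
  let ?C = "if is_node t then {Suc (nedges s)} else {}" and ?D = "(\<lambda>j. Suc (nedges s + j)) ` inner t"
  have "(\<Sum>j\<in>inner (Node [s, t]). f j) = sum f ((?A \<union> ?B \<union> ?C) \<union> ?D)" by simp
  also have "\<dots> = sum f (?A \<union> ?B \<union> ?C) + sum f ?D"
    using fin b n by (intro sum.union_disjoint) (auto split: if_splits)
  also have "sum f (?A \<union> ?B \<union> ?C) = sum f (?A \<union> ?B) + sum f ?C"
    using fin b n by (intro sum.union_disjoint) (auto split: if_splits)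
  also have "sum f (?A \<union> ?B) = sum f ?A + sum f ?B"
    using fin b n by (intro sum.union_disjoint) (auto split: if_splits)
  also have "sum f ?B = (\<Sum>j\<in>inner s. f (Suc j))" by (simp add: sum.reindex)
  also have "sum f ?D = (\<Sum>j\<in>inner t. f (Suc (nedges s + j)))" by (simp add: sum.reindex inj_on_def)
  finally show ?thesis by simp
qed

text \<open>Imposing the face of an edge of the first subtree commutes with grafting.\<close>

lemma section_graft_left:
  assumes "\<And>z p. p \<in> X z \<Longrightarrow> j < length p"
  shows "section_at (Suc j) (graft X Y y) = graft (\<lambda>z. section_at j (X z)) Y y"
proof (intro equalityI subsetI)
  fix p assume "p \<in> section_at (Suc j) (graft X Y y)"
  then obtain z a b where z: "z \<noteq> 0" "a \<in> X z" "b \<in> Y z" "((1 - z / y) # a @ b) ! Suc j = 0"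
    "p = remove_nth (Suc j) ((1 - z / y) # a @ b)"
    by (auto simp: section_at_def graft_def)
  then have "a ! j = 0" "p = (1 - z / y) # remove_nth j a @ b"
    using assms[OF z(2)] by (auto simp: nth_append remove_nth_def)
  then show "p \<in> graft (\<lambda>z. section_at j (X z)) Y y"
    using z(1,2,3) unfolding graft_def section_at_def by blast
next
  fix p assume "p \<in> graft (\<lambda>z. section_at j (X z)) Y y"
  then obtain z a b where z: "z \<noteq> 0" "a \<in> X z" "a ! j = 0" "b \<in> Y z" "p = (1 - z / y) # remove_nth j a @ b"
    by (auto simp: section_at_def graft_def)
  then have "p = remove_nth (Suc j) ((1 - z / y) # a @ b)" "((1 - z / y) # a @ b) ! Suc j = 0"
    using assms[OF z(2)] by (auto simp: nth_append remove_nth_def)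
  then show "p \<in> section_at (Suc j) (graft X Y y)"
    using z(1,2,4) unfolding graft_def section_at_def by blast
qed

lemma section_graft_right:
  assumes "\<And>z p. p \<in> X z \<Longrightarrow> length p = n"
  shows "section_at (Suc (n + j)) (graft X Y y) = graft X (\<lambda>z. section_at j (Y z)) y"
proof (intro equalityI subsetI)
  fix p assume "p \<in> section_at (Suc (n + j)) (graft X Y y)"
  then obtain z a b where z: "z \<noteq> 0" "a \<in> X z" "b \<in> Y z" "((1 - z / y) # a @ b) ! Suc (n + j) = 0"
    "p = remove_nth (Suc (n + j)) ((1 - z / y) # a @ b)"
    by (auto simp: section_at_def graft_def)
  then have "b ! j = 0" "p = (1 - z / y) # a @ remove_nth j b"
    using assms[OF z(2)] by (auto simp: nth_append remove_nth_def)
  then show "p \<in> graft X (\<lambda>z. section_at j (Y z)) y"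
    using z(1,2,3) unfolding graft_def section_at_def by blast
next
  fix p assume "p \<in> graft X (\<lambda>z. section_at j (Y z)) y"
  then obtain z a b where z: "z \<noteq> 0" "a \<in> X z" "b ! j = 0" "b \<in> Y z" "p = (1 - z / y) # a @ remove_nth j b"
    by (auto simp: section_at_def graft_def)
  then have "p = remove_nth (Suc (n + j)) ((1 - z / y) # a @ b)" "((1 - z / y) # a @ b) ! Suc (n + j) = 0"
    using assms[OF z(2)] by (auto simp: nth_append remove_nth_def)
  then show "p \<in> section_at (Suc (n + j)) (graft X Y y)"
    using z(1,2,4) unfolding graft_def section_at_def by blast
qed

text \<open>The root edge has coordinate 0 exactly if \<open>z = y\<close>, and then both subtrees
  hang on \<open>y\<close> directly.\<close>

lemma section_graft_root:
  assumes "y \<noteq> 0"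
  shows "section_at 0 (graft X Y y) = concat_points (X y) (Y y)"
proof -
  have "1 - z / y = 0 \<longleftrightarrow> z = y" for z using assms by (auto simp: field_simps)
  note root = this
  show ?thesis
  proof (intro equalityI subsetI)
    fix p assume "p \<in> section_at 0 (graft X Y y)"
    then obtain z a b where "a \<in> X z" "b \<in> Y z" "1 - z / y = 0" "p = a @ b"
      by (auto simp: section_at_def graft_def remove_nth_def)
    then show "p \<in> concat_points (X y) (Y y)"
      using root by (auto simp: concat_points_def)
  next
    fix p assume "p \<in> concat_points (X y) (Y y)"
    then obtain a b where "a \<in> X y" "b \<in> Y y" "p = remove_nth 0 ((1 - y / y) # a @ b)"
      by (auto simp: concat_points_def remove_nth_def)
    moreover have "((1 - y / y) # a @ b) ! 0 = 0" using assms by simp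
    ultimately show "p \<in> section_at 0 (graft X Y y)"
      unfolding section_at_def graft_def using assms by blast
  qed
qed

lemma graft_cong:
  assumes "\<And>z. z \<noteq> 0 \<Longrightarrow> X z = X' z" "\<And>z. z \<noteq> 0 \<Longrightarrow> Y z = Y' z"
  shows "graft X Y = graft X' Y'"
  by (intro ext) (simp add: graft_def assms cong: conj_cong)

text \<open>Three subtrees at one vertex of valency 4: the two sides are what is left of the two
  ways to resolve it.\<close>

lemma graft_concat_assoc:
  "graft (\<lambda>z. concat_points (X z) (Y z)) Z = graft X (\<lambda>z. concat_points (Y z) (Z z))"
  by (rule ext) (auto simp: graft_def concat_points_def, (metis append_assoc)+)

section \<open>Sums over trivalent trees with a given word of leaves\<close>

definition trees_with :: "'r list \<Rightarrow> 'r plane_tree set" where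
  "trees_with ys = {t. trivalent t \<and> leaves t = ys}"

lemma finite_trees_with: "finite (trees_with ys)"
proof (rule finite_surj[OF finite_trivalent_trees, of _ body])
  fix r :: 'a
  show "trees_with ys \<subseteq> body ` trivalent_trees (ys @ [undefined])"
  proof
    fix t assume "t \<in> trees_with ys"
    then have "Planted undefined t \<in> trivalent_trees (ys @ [undefined])"
      by (simp add: trees_with_def trivalent_trees_def)
    then show "t \<in> body ` trivalent_trees (ys @ [undefined])" by force
  qed
qed

definition tree_pairs :: "'r list \<Rightarrow> ('r plane_tree \<times> 'r plane_tree) set" where
  "tree_pairs ys = {(a, b). trivalent a \<and> trivalent b \<and> leaves a @ leaves b = ys}"

definition splittings :: "'r list \<Rightarrow> ('r list \<times> 'r list) set" where
  "splittings ys = {(us, vs). us @ vs = ys}"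

lemma finite_splittings: "finite (splittings ys)"
proof (rule finite_subset)
  show "splittings ys \<subseteq> (\<lambda>i. (take i ys, drop i ys)) ` {..length ys}"
  proof
    fix p assume "p \<in> splittings ys"
    then obtain us vs where p: "p = (us, vs)" "us @ vs = ys" by (auto simp: splittings_def)
    then have "p = (\<lambda>i. (take i ys, drop i ys)) (length us)" "length us \<in> {..length ys}" by auto
    then show "p \<in> (\<lambda>i. (take i ys, drop i ys)) ` {..length ys}" by blast
  qed
qed simp

lemma finite_tree_pairs: "finite (tree_pairs ys)"
proof (rule finite_subset)
  show "tree_pairs ys \<subseteq> (\<Union>(us, vs)\<in>splittings ys. trees_with us \<times> trees_with vs)"
    by (auto simp: tree_pairs_def splittings_def trees_with_def)
  show "finite (\<Union>(us, vs)\<in>splittings ys. trees_with us \<times> trees_with vs)"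
    by (auto simp: case_prod_beta intro!: finite_UN_I finite_splittings finite_cartesian_product finite_trees_with)
qed

text \<open>Once the place where the leaves are divided is fixed, the two subtrees are independent,
  so one can be summed over while the other is kept.\<close>

lemma sum_tree_pairs:
  "(\<Sum>p\<in>tree_pairs ys. F p) = (\<Sum>(us, vs)\<in>splittings ys. \<Sum>a\<in>trees_with us. \<Sum>b\<in>trees_with vs. F (a, b))"
proof -
  let ?g = "\<lambda>(a, b). (leaves a, leaves b)"
  have "?g ` tree_pairs ys \<subseteq> splittings ys" by (auto simp: tree_pairs_def splittings_def)
  from sum.group[OF finite_tree_pairs finite_splittings this, of F]
  have "(\<Sum>p\<in>tree_pairs ys. F p) = (\<Sum>q\<in>splittings ys. \<Sum>p\<in>{p \<in> tree_pairs ys. ?g p = q}. F p)"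
    by simp
  also have "\<dots> = (\<Sum>q\<in>splittings ys. \<Sum>p\<in>trees_with (fst q) \<times> trees_with (snd q). F p)"
    by (intro sum.cong refl) (auto simp: tree_pairs_def trees_with_def splittings_def)
  also have "\<dots> = (\<Sum>(us, vs)\<in>splittings ys. \<Sum>a\<in>trees_with us. \<Sum>b\<in>trees_with vs. F (a, b))"
    by (simp add: sum.cartesian_product case_prod_beta)
  finally show ?thesis .
qed

lemma trees_with_pairs:
  assumes "length ys \<noteq> 1"
  shows "trees_with ys = (\<lambda>(a, b). Node [a, b]) ` tree_pairs ys"
proof (intro equalityI subsetI)
  fix t assume t: "t \<in> trees_with ys"
  then have "trivalent t" "leaves t = ys" by (auto simp: trees_with_def)
  then show "t \<in> (\<lambda>(a, b). Node [a, b]) ` tree_pairs ys"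
    using assms trivalent_cases[of t] by (force simp: tree_pairs_def)
qed (auto simp: tree_pairs_def trees_with_def)

lemma trees_with_singleton: "length ys = 1 \<Longrightarrow> t \<in> trees_with ys \<Longrightarrow> \<exists>x. t = Leaf x"
proof -
  assume ys: "length ys = 1" and t: "t \<in> trees_with ys"
  then have t: "trivalent t" "length (leaves t) = 1" by (auto simp: trees_with_def)
  then show ?thesis
  proof (induction rule: trivalent_induct)
    case (Node s t)
    have "0 < length (leaves s)" "0 < length (leaves t)"
      using Node.hyps trivalent_leaves_nonempty by blast+
    then show ?case using Node.prems by (simp del: length_greater_0_conv)
  qed simp
qed

text \<open>Contracting the left or the right internal edge at a vertex of a trivalent tree gives the same
  tree with a vertex of valency 4, and the canonical orientations give opposite signs.\<close>

lemma inner_cancel: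
  fixes \<Psi> :: "('a::field mpoly fract \<Rightarrow> 'a mpoly fract list set) \<Rightarrow> ('x \<Rightarrow>\<^sub>0 rat)"
  shows "(\<Sum>t\<in>trees_with ys. \<Sum>j\<in>inner t. scale ((- 1) ^ j) (\<Psi> (\<lambda>y. section_at j (tree_points t y)))) = 0"
\<comment> \<open>\<open>\<Psi>\<close> is the surrounding tree as a function of the points of a
  subtree. For a shorter word it is used with one more graft, so it must vary in the
  induction.\<close>
proof (induction "length ys" arbitrary: ys \<Psi> rule: less_induct)
  case less
  let ?P = tree_points
  define S where "S = (\<lambda>j t. scale ((- 1) ^ j) (\<Psi> (\<lambda>y. section_at j (?P t y))))"
  show ?case
  proof (cases "length ys = 1")
    case True
    then have "inner t = {}" if "t \<in> trees_with ys" for t using trees_with_singleton[OF True that] by auto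
    then show ?thesis by simp
  next
    case False
    have len: "length p = nedges t" if "trivalent t" "p \<in> ?P t z" for t p z
      using length_tree_points that by blast
    \<comment> \<open>The source of the opposite signs: passing the root edge changes the sign, and
      passing the first subtree with its odd number of edges changes it back.\<close>
    have odd: "odd (nedges t)" if "trivalent t" for t :: "'a plane_tree"
      using nedges_leaves[OF that] by presburger
    have left: "S (Suc j) (Node [a, b]) = - scale ((- 1) ^ j) (\<Psi> (graft (\<lambda>z. section_at j (?P a z)) (?P b)))"
      if "trivalent a" "j < nedges a" for j a b
    proof -
      have "(\<lambda>y. section_at (Suc j) (?P (Node [a, b]) y)) = graft (\<lambda>z. section_at j (?P a z)) (?P b)"
        using section_graft_left[of "?P a" j] len[OF that(1)] that(2) by (simp add: fun_eq_iff)
      then show ?thesis by (simp add: S_def)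
    qed
    have right: "S (Suc (nedges a + j)) (Node [a, b]) = scale ((- 1) ^ j) (\<Psi> (graft (?P a) (\<lambda>z. section_at j (?P b z))))"
      if "trivalent a" for j a b
    proof -
      have "(\<lambda>y. section_at (Suc (nedges a + j)) (?P (Node [a, b]) y)) = graft (?P a) (\<lambda>z. section_at j (?P b z))"
        using section_graft_right[of "?P a" "nedges a"] len[OF that(1)] by (simp add: fun_eq_iff)
      then show ?thesis using odd[OF that] by (simp add: S_def power_add)
    qed
    have n_pos: "0 < nedges t" for t :: "'a plane_tree" by (cases t rule: nedges.cases) auto
    \<comment> \<open>\<open>A\<close> and \<open>C\<close> collect the edges from the top vertex to
      an internal vertex on the left and on the right, \<open>B\<close> and \<open>D\<close> the
      edges inside the two subtrees. The latter sums vanish by induction.\<close>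
    define A where "A = (\<lambda>(a, b). if is_node a then S 1 (Node [a, b]) else 0)"
    define B where "B = (\<lambda>(a, b). \<Sum>j\<in>inner a. S (Suc j) (Node [a, b]))"
    define C where "C = (\<lambda>(a, b). if is_node b then S (Suc (nedges a)) (Node [a, b]) else 0)"
    define D where "D = (\<lambda>(a, b). \<Sum>j\<in>inner b. S (Suc (nedges a + j)) (Node [a, b]))"
    have "(\<Sum>t\<in>trees_with ys. \<Sum>j\<in>inner t. S j t) = (\<Sum>(a, b)\<in>tree_pairs ys. \<Sum>j\<in>inner (Node [a, b]). S j (Node [a, b]))"
      unfolding trees_with_pairs[OF False]
      by (subst sum.reindex) (auto simp: inj_on_def intro!: sum.cong)
    also have "\<dots> = (\<Sum>p\<in>tree_pairs ys. A p + B p + C p + D p)"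
      by (intro sum.cong refl) (auto simp: tree_pairs_def sum_inner A_def B_def C_def D_def simp del: inner.simps One_nat_def)
    also have "\<dots> = (\<Sum>p\<in>tree_pairs ys. A p) + (\<Sum>p\<in>tree_pairs ys. B p) + (\<Sum>p\<in>tree_pairs ys. C p) + (\<Sum>p\<in>tree_pairs ys. D p)"
      by (simp add: sum.distrib)
    also have "(\<Sum>p\<in>tree_pairs ys. B p) = 0"
      unfolding sum_tree_pairs
    proof (rule sum.neutral, rule ballI, clarify)
      fix us vs assume sp: "(us, vs) \<in> splittings ys"
      show "(\<Sum>a\<in>trees_with us. \<Sum>b\<in>trees_with vs. B (a, b)) = 0"
      proof (subst sum.swap, rule sum.neutral, rule ballI)
        fix b assume b: "b \<in> trees_with vs"
        then have "vs \<noteq> []" using trivalent_leaves_nonempty by (auto simp: trees_with_def)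
        then have "length us < length ys" using sp by (auto simp: splittings_def)
        from less[OF this, of "\<lambda>Y. \<Psi> (graft Y (?P b))"]
        have "0 = (\<Sum>a\<in>trees_with us. \<Sum>j\<in>inner a. - scale ((- 1) ^ j) (\<Psi> (graft (\<lambda>y. section_at j (?P a y)) (?P b))))"
          by (simp add: sum_negf)
        also have "\<dots> = (\<Sum>a\<in>trees_with us. B (a, b))"
        proof (rule sum.cong[OF refl])
          fix a assume "a \<in> trees_with us"
          then have a: "trivalent a" by (simp add: trees_with_def)
          show "(\<Sum>j\<in>inner a. - scale ((- 1) ^ j) (\<Psi> (graft (\<lambda>y. section_at j (?P a y)) (?P b)))) = B (a, b)"
            unfolding B_def using inner_bounds[OF a] left[OF a] by (auto intro!: sum.cong)
        qed
        finally show "(\<Sum>a\<in>trees_with us. B (a, b)) = 0" by simp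
      qed
    qed
    also have "(\<Sum>p\<in>tree_pairs ys. D p) = 0"
      unfolding sum_tree_pairs
    proof (rule sum.neutral, rule ballI, clarify)
      fix us vs assume sp: "(us, vs) \<in> splittings ys"
      show "(\<Sum>a\<in>trees_with us. \<Sum>b\<in>trees_with vs. D (a, b)) = 0"
      proof (rule sum.neutral, rule ballI)
        fix a assume a: "a \<in> trees_with us"
        then have "us \<noteq> []" "trivalent a" using trivalent_leaves_nonempty by (auto simp: trees_with_def)
        then have "length vs < length ys" using sp by (auto simp: splittings_def)
        from less[OF this, of "\<lambda>Y. \<Psi> (graft (?P a) Y)"]
        show "(\<Sum>b\<in>trees_with vs. D (a, b)) = 0"
          by (simp add: D_def right[OF \<open>trivalent a\<close>])
      qed
    qed
    also have "(\<Sum>p\<in>tree_pairs ys. A p) + 0 + (\<Sum>p\<in>tree_pairs ys. C p) + 0 = 0"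
    proof -
      \<comment> \<open>Both \<open>A\<close> and \<open>C\<close> become sums over triples of
        subtrees at a vertex of valency 4: \<open>A\<close> resolves it by joining the first two,
        \<open>C\<close> by joining the last two.\<close>
      let ?T = "{(a, b, c). trivalent a \<and> trivalent b \<and> trivalent c \<and> leaves a @ leaves b @ leaves c = ys}"
      define G where "G = (\<lambda>(a, b, c). \<Psi> (graft (?P a) (\<lambda>z. concat_points (?P b z) (?P c z))))"
      have "(\<Sum>p\<in>tree_pairs ys. A p) = (\<Sum>p\<in>{p \<in> tree_pairs ys. is_node (fst p)}. A p)"
        using finite_tree_pairs[of ys] by (intro sum.mono_neutral_right) (auto simp: A_def split: if_splits)
      also have "\<dots> = (\<Sum>p\<in>?T. - G p)"
      proof (rule sum.reindex_bij_witness[where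
            j = "\<lambda>(n, c). (case n of Node [a, b] \<Rightarrow> (a, b, c))" and i = "\<lambda>(a, b, c). (Node [a, b], c)"])
        fix p assume p: "p \<in> {p \<in> tree_pairs ys. is_node (fst p)}"
        obtain n c where nc: "p = (n, c)" by fastforce
        have n: "trivalent n" "is_node n" "trivalent c" "leaves n @ leaves c = ys" using p nc by (auto simp: tree_pairs_def)
        obtain a b where ab: "n = Node [a, b]" "trivalent a" "trivalent b"
          using n(1,2) trivalent_cases[of n] by auto
        show "(\<lambda>(a, b, c). (Node [a, b], c)) ((\<lambda>(n, c). (case n of Node [a, b] \<Rightarrow> (a, b, c))) p) = p"
          using nc ab by simp
        show "(\<lambda>(n, c). (case n of Node [a, b] \<Rightarrow> (a, b, c))) p \<in> ?T"
          using nc ab n by simp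
        have "S 1 (Node [n, c]) = - \<Psi> (graft (\<lambda>z. section_at 0 (?P n z)) (?P c))"
          using left[OF n(1) n_pos, of c] by simp
        also have "graft (\<lambda>z. section_at 0 (?P n z)) (?P c) = graft (\<lambda>z. concat_points (?P a z) (?P b z)) (?P c)"
          by (rule graft_cong) (simp_all add: ab section_graft_root)
        also have "\<dots> = graft (?P a) (\<lambda>z. concat_points (?P b z) (?P c z))" by (rule graft_concat_assoc)
        finally show "- G ((\<lambda>(n, c). (case n of Node [a, b] \<Rightarrow> (a, b, c))) p) = A p"
          using nc ab by (simp add: A_def G_def)
      qed (auto simp: tree_pairs_def)
      finally have A: "(\<Sum>p\<in>tree_pairs ys. A p) = - (\<Sum>p\<in>?T. G p)" by (simp add: sum_negf)
      have "(\<Sum>p\<in>tree_pairs ys. C p) = (\<Sum>p\<in>{p \<in> tree_pairs ys. is_node (snd p)}. C p)"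
        using finite_tree_pairs[of ys] by (intro sum.mono_neutral_right) (auto simp: C_def split: if_splits)
      also have "\<dots> = (\<Sum>p\<in>?T. G p)"
      proof (rule sum.reindex_bij_witness[where
            j = "\<lambda>(a, n). (case n of Node [b, c] \<Rightarrow> (a, b, c))" and i = "\<lambda>(a, b, c). (a, Node [b, c])"])
        fix p assume p: "p \<in> {p \<in> tree_pairs ys. is_node (snd p)}"
        obtain a n where an: "p = (a, n)" by fastforce
        have n: "trivalent n" "is_node n" "trivalent a" "leaves a @ leaves n = ys" using p an by (auto simp: tree_pairs_def)
        obtain b c where bc: "n = Node [b, c]" "trivalent b" "trivalent c"
          using n(1,2) trivalent_cases[of n] by auto
        show "(\<lambda>(a, b, c). (a, Node [b, c])) ((\<lambda>(a, n). (case n of Node [b, c] \<Rightarrow> (a, b, c))) p) = p"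
          using an bc by simp
        show "(\<lambda>(a, n). (case n of Node [b, c] \<Rightarrow> (a, b, c))) p \<in> ?T"
          using an bc n by simp
        have "S (Suc (nedges a)) (Node [a, n]) = \<Psi> (graft (?P a) (\<lambda>z. section_at 0 (?P n z)))"
          using right[OF n(3), of 0 n] by simp
        also have "graft (?P a) (\<lambda>z. section_at 0 (?P n z)) = graft (?P a) (\<lambda>z. concat_points (?P b z) (?P c z))"
          by (rule graft_cong) (simp_all add: bc section_graft_root)
        finally show "G ((\<lambda>(a, n). (case n of Node [b, c] \<Rightarrow> (a, b, c))) p) = C p"
          using an bc by (simp add: C_def G_def)
      qed (auto simp: tree_pairs_def)
      finally show ?thesis using A by simp
    qed
    finally show ?thesis by (simp add: S_def)
  qed
qed

section \<open>Decomposability of the other boundary terms\<close>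

lemma section_leaf:
  assumes "y \<noteq> 0"
  shows "section_at 0 (tree_points (Leaf x) y) = (if y = fconst x then {[]} else {})"
proof -
  have "1 - fconst x / y = 0 \<longleftrightarrow> y = fconst x" using assms by (auto simp: field_simps)
  then show ?thesis by (auto simp: section_at_def remove_nth_def)
qed

text \<open>The shape that \<open>leaf_section\<close> takes when the part containing the root is a
  single edge with coordinate \<open>c\<close>.\<close>

lemma insert_after_singleton:
  "{A @ B @ C | A B C. length A = 1 \<and> A @ C \<in> {[c]} \<and> B \<in> Q} = {c # q | q. q \<in> Q}"
proof (intro equalityI subsetI)
  fix p assume "p \<in> {A @ B @ C | A B C. length A = 1 \<and> A @ C \<in> {[c]} \<and> B \<in> Q}"
  then obtain A B C where A: "length A = 1" "A @ C = [c]" "B \<in> Q" "p = A @ B @ C" by blast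
  then have "A = [c]" "C = []" by (cases A; simp)+
  then show "p \<in> {c # q | q. q \<in> Q}" using A by simp
next
  fix p assume "p \<in> {c # q | q. q \<in> Q}"
  then obtain q where "p = [c] @ q @ []" "q \<in> Q" by auto
  moreover have "length [c] = 1" "[c] @ [] \<in> {[c]}" by simp_all
  ultimately show "p \<in> {A @ B @ C | A B C. length A = 1 \<and> A @ C \<in> {[c]} \<and> B \<in> Q}" by blast
qed

text \<open>Contracting the edge at a leaf \<open>x\<close> turns its inner vertex into a vertex decorated by \<open>x\<close>, at
  which the tree falls apart: \<open>s\<close> is the part containing the root and \<open>b\<close> hangs on the root \<open>x\<close>.\<close>

lemma leaf_section:
  fixes t :: "'a::field plane_tree"
  assumes "trivalent t" "0 \<notin> set (leaves t)" "j < nedges t" "0 < j" "j \<notin> inner t"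
  shows "\<exists>s b x l. trivalent s \<and> trivalent b \<and> mset (leaves s) + mset (leaves b) = mset (leaves t) \<and>
    x \<in> set (leaves s) \<and> nedges s + nedges b = nedges t - 1 \<and> l \<le> nedges s \<and>
    (\<forall>y. section_at j (tree_points t y) =
      {A @ B @ C | A B C. length A = l \<and> A @ C \<in> tree_points s y \<and> B \<in> tree_points b (fconst x)})"
  using assms
proof (induction arbitrary: j rule: trivalent_induct)
  case (Leaf x)
  then show ?case by simp
next
  case (Node t1 t2)
  let ?P = tree_points
  have len: "length p = nedges t" if "trivalent t" "p \<in> ?P t z" for t p z
    using length_tree_points that by blast
  have pos: "0 < nedges t" for t :: "'a plane_tree" by (cases t rule: nedges.cases) auto
  show ?case
  proof (cases "j < Suc (nedges t1)")
    case True
    then obtain i where i: "j = Suc i" "i < nedges t1" using \<open>0 < j\<close> by (cases j) auto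
    have sec: "section_at j (?P (Node [t1, t2]) y) = graft (\<lambda>z. section_at i (?P t1 z)) (?P t2) y" for y
      using section_graft_left[of "?P t1" i] len[OF Node.hyps(1)] i by simp
    show ?thesis
    proof (cases "i = 0")
      case True
      then have "\<not> is_node t1" using Node.prems(4) i(1) by auto
      then obtain x where x: "t1 = Leaf x" using trivalent_cases[OF Node.hyps(1)] by auto
      then have "fconst x \<noteq> 0" using Node.prems(1) by auto
      \<comment> \<open>Contracting the edge at the first child \<open>x\<close> gives the vertex
        the value \<open>x\<close>: the root edge becomes the edge of the tree
        \<open>Leaf x\<close>, and the sibling hangs on the new root \<open>x\<close>.\<close>
      have "section_at j (?P (Node [t1, t2]) y) =
          {A @ B @ C | A B C. length A = 1 \<and> A @ C \<in> ?P (Leaf x) y \<and> B \<in> ?P t2 (fconst x)}" for y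
      proof -
        have "section_at j (?P (Node [t1, t2]) y) = graft (\<lambda>z. if z = fconst x then {[]} else {}) (?P t2) y"
          unfolding sec unfolding True x
          by (rule fun_cong[OF graft_cong]) (rule refl | rule section_leaf, assumption)+
        also have "\<dots> = {(1 - fconst x / y) # q | q. q \<in> ?P t2 (fconst x)}"
          using \<open>fconst x \<noteq> 0\<close> by (auto simp: graft_def split: if_splits)
        finally show ?thesis by (simp only: tree_points.simps insert_after_singleton)
      qed
      then show ?thesis
        using x Node.hyps by (intro exI[of _ "Leaf x"] exI[of _ t2] exI[of _ x] exI[of _ 1]) simp
    next
      case False
      then have "i \<notin> inner t1" "0 < i" "0 \<notin> set (leaves t1)" using Node.prems i(1) by auto
      then obtain s b x l where s: "trivalent s" "trivalent b" "mset (leaves s) + mset (leaves b) = mset (leaves t1)"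
        "x \<in> set (leaves s)" "nedges s + nedges b = nedges t1 - 1" "l \<le> nedges s"
        and ih: "\<And>y. section_at i (?P t1 y) =
          {A @ B @ C | A B C. length A = l \<and> A @ C \<in> ?P s y \<and> B \<in> ?P b (fconst x)}"
        using Node.IH(1)[of i] i(2) by blast
      have "section_at j (?P (Node [t1, t2]) y) =
        {A @ B @ C | A B C. length A = Suc l \<and> A @ C \<in> ?P (Node [s, t2]) y \<and> B \<in> ?P b (fconst x)}" for y
        unfolding sec ih
      proof (intro equalityI subsetI)
        fix p assume "p \<in> graft (\<lambda>z. {A @ B @ C | A B C. length A = l \<and> A @ C \<in> ?P s z \<and> B \<in> ?P b (fconst x)}) (?P t2) y"
        then obtain z A B C q where z: "z \<noteq> 0" "length A = l" "A @ C \<in> ?P s z" "B \<in> ?P b (fconst x)" "q \<in> ?P t2 z"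
          "p = (1 - z / y) # (A @ B @ C) @ q" unfolding graft_def by blast
        have "(1 - z / y) # (A @ C) @ q \<in> ?P (Node [s, t2]) y"
          using z unfolding tree_points.simps graft_def by blast
        then have "((1 - z / y) # A) @ (C @ q) \<in> ?P (Node [s, t2]) y" by simp
        moreover have "p = ((1 - z / y) # A) @ B @ (C @ q)" using z(6) by simp
        ultimately show "p \<in> {A @ B @ C | A B C. length A = Suc l \<and> A @ C \<in> ?P (Node [s, t2]) y \<and> B \<in> ?P b (fconst x)}"
          using z(2,4) by (intro CollectI exI[of _ "(1 - z / y) # A"] exI[of _ B] exI[of _ "C @ q"]) simp
      next
        fix p assume "p \<in> {A @ B @ C | A B C. length A = Suc l \<and> A @ C \<in> ?P (Node [s, t2]) y \<and> B \<in> ?P b (fconst x)}"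
        then obtain A B C where A: "length A = Suc l" "A @ C \<in> ?P (Node [s, t2]) y" "B \<in> ?P b (fconst x)" "p = A @ B @ C"
          by blast
        then obtain z p1 q where z: "z \<noteq> 0" "p1 \<in> ?P s z" "q \<in> ?P t2 z" "A @ C = (1 - z / y) # p1 @ q"
          unfolding tree_points.simps graft_def by blast
        obtain A' where A': "A = (1 - z / y) # A'" "A' @ C = p1 @ q" "length A' = l"
          using A(1) z(4) by (cases A) auto
        \<comment> \<open>The place where \<open>B\<close> is inserted lies within the coordinates
          of the first subtree, so those of the second stay together.\<close>
        have l: "l \<le> length p1" using len[OF s(1) z(2)] s(6) by simp
        have "take l (A' @ C) = take l (p1 @ q)" "drop l (A' @ C) = drop l (p1 @ q)" using A'(2) by simp_all
        then have "A' = take l p1" "C = drop l p1 @ q" using A'(3) l by simp_all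
        then have "p = (1 - z / y) # (A' @ B @ drop l p1) @ q" "A' @ drop l p1 \<in> ?P s z"
          using A(4) A'(1) z(2) by simp_all
        then show "p \<in> graft (\<lambda>z. {A @ B @ C | A B C. length A = l \<and> A @ C \<in> ?P s z \<and> B \<in> ?P b (fconst x)}) (?P t2) y"
          using z(1,3) A(3) A'(3) unfolding graft_def by blast
      qed
      then show ?thesis
        using s Node.hyps i(2) by (intro exI[of _ "Node [s, t2]"] exI[of _ b] exI[of _ x] exI[of _ "Suc l"])
          (auto simp: add_ac simp flip: s(3))
    qed
  next
    case False
    then obtain i where i: "j = Suc (nedges t1 + i)" "i < nedges t2"
      using Node.prems(2) less_eqE[of "Suc (nedges t1)" j] by auto
    have sec: "section_at j (?P (Node [t1, t2]) y) = graft (?P t1) (\<lambda>z. section_at i (?P t2 z)) y" for y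
      using section_graft_right[of "?P t1" "nedges t1" i] len[OF Node.hyps(1)] i by simp
    show ?thesis
    proof (cases "i = 0")
      case True
      then have "\<not> is_node t2" using Node.prems(4) i(1) by auto
      then obtain x where x: "t2 = Leaf x" using trivalent_cases[OF Node.hyps(2)] by auto
      then have "fconst x \<noteq> 0" using Node.prems(1) by auto
      have "section_at j (?P (Node [t1, t2]) y) =
          {A @ B @ C | A B C. length A = 1 \<and> A @ C \<in> ?P (Leaf x) y \<and> B \<in> ?P t1 (fconst x)}" for y
      proof -
        have "section_at j (?P (Node [t1, t2]) y) = graft (?P t1) (\<lambda>z. if z = fconst x then {[]} else {}) y"
          unfolding sec unfolding True x
          by (rule fun_cong[OF graft_cong]) (rule refl | rule section_leaf, assumption)+
        also have "\<dots> = {(1 - fconst x / y) # q | q. q \<in> ?P t1 (fconst x)}"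
          using \<open>fconst x \<noteq> 0\<close> by (auto simp: graft_def split: if_splits)
        finally show ?thesis by (simp only: tree_points.simps insert_after_singleton)
      qed
      then show ?thesis
        using x Node.hyps by (intro exI[of _ "Leaf x"] exI[of _ t1] exI[of _ x] exI[of _ 1]) simp
    next
      case False
      then have "i \<notin> inner t2" "0 < i" "0 \<notin> set (leaves t2)" using Node.prems i(1) by auto
      then obtain s b x l where s: "trivalent s" "trivalent b" "mset (leaves s) + mset (leaves b) = mset (leaves t2)"
        "x \<in> set (leaves s)" "nedges s + nedges b = nedges t2 - 1" "l \<le> nedges s"
        and ih: "\<And>y. section_at i (?P t2 y) =
          {A @ B @ C | A B C. length A = l \<and> A @ C \<in> ?P s y \<and> B \<in> ?P b (fconst x)}"
        using Node.IH(2)[of i] i(2) by blast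
      have "section_at j (?P (Node [t1, t2]) y) =
        {A @ B @ C | A B C. length A = Suc (nedges t1 + l) \<and> A @ C \<in> ?P (Node [t1, s]) y \<and> B \<in> ?P b (fconst x)}" for y
        unfolding sec ih
      proof (intro equalityI subsetI)
        fix p assume "p \<in> graft (?P t1) (\<lambda>z. {A @ B @ C | A B C. length A = l \<and> A @ C \<in> ?P s z \<and> B \<in> ?P b (fconst x)}) y"
        then obtain z A B C q where z: "z \<noteq> 0" "length A = l" "A @ C \<in> ?P s z" "B \<in> ?P b (fconst x)" "q \<in> ?P t1 z"
          "p = (1 - z / y) # q @ (A @ B @ C)" unfolding graft_def by blast
        have "(1 - z / y) # q @ (A @ C) \<in> ?P (Node [t1, s]) y"
          using z unfolding tree_points.simps graft_def by blast
        then have "((1 - z / y) # q @ A) @ C \<in> ?P (Node [t1, s]) y" by simp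
        moreover have "p = ((1 - z / y) # q @ A) @ B @ C" using z(6) by simp
        ultimately show "p \<in> {A @ B @ C | A B C. length A = Suc (nedges t1 + l) \<and> A @ C \<in> ?P (Node [t1, s]) y \<and> B \<in> ?P b (fconst x)}"
          using z(2,4) len[OF Node.hyps(1) z(5)]
          by (intro CollectI exI[of _ "(1 - z / y) # q @ A"] exI[of _ B] exI[of _ C]) simp
      next
        fix p assume "p \<in> {A @ B @ C | A B C. length A = Suc (nedges t1 + l) \<and> A @ C \<in> ?P (Node [t1, s]) y \<and> B \<in> ?P b (fconst x)}"
        then obtain A B C where A: "length A = Suc (nedges t1 + l)" "A @ C \<in> ?P (Node [t1, s]) y" "B \<in> ?P b (fconst x)" "p = A @ B @ C"
          by blast
        then obtain z p1 q where z: "z \<noteq> 0" "q \<in> ?P t1 z" "p1 \<in> ?P s z" "A @ C = (1 - z / y) # q @ p1"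
          unfolding tree_points.simps graft_def by blast
        obtain A' where A': "A = (1 - z / y) # A'" "A' @ C = q @ p1" "length A' = nedges t1 + l"
          using A(1) z(4) by (cases A) auto
        have "take (length q + l) (A' @ C) = take (length q + l) (q @ p1)"
          "drop (length q + l) (A' @ C) = drop (length q + l) (q @ p1)" using A'(2) by simp_all
        then have "A' = q @ take l p1" "C = drop l p1" using A'(3) len[OF Node.hyps(1) z(2)] by simp_all
        moreover have "l \<le> length p1" using len[OF s(1) z(3)] s(6) by simp
        ultimately have "p = (1 - z / y) # q @ (take l p1 @ B @ drop l p1)" "take l p1 @ drop l p1 \<in> ?P s z"
          "length (take l p1) = l"
          using A(4) A'(1) z(3) by simp_all
        then show "p \<in> graft (?P t1) (\<lambda>z. {A @ B @ C | A B C. length A = l \<and> A @ C \<in> ?P s z \<and> B \<in> ?P b (fconst x)}) y"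
          using z(1,2) A(3) unfolding graft_def by blast
      qed
      then show ?thesis
        using s Node.hyps i(2) by (intro exI[of _ "Node [t1, s]"] exI[of _ b] exI[of _ x] exI[of _ "Suc (nedges t1 + l)"])
          (auto simp: add_ac simp flip: s(3))
    qed
  qed
qed

text \<open>The root edge and the leaf edges lead to the same shape, a part with the old root and a
  part with root \<open>x\<close>, where \<open>x\<close> is \<open>r\<close> for the root edge.
  Both parts have distinct decorations again, so \<open>dec_cycle_product\<close> applies.\<close>

lemma dec_cycle_section:
  fixes t :: "'a::field plane_tree"
  assumes t: "trivalent t" and r: "distinct (r # leaves t)" "0 \<notin> set (r # leaves t)"
    and j: "j < nedges t" "j \<notin> inner t"
  shows "dec_cycle (point_cycle (nedges t - 1) (section_at j (tree_points t (fconst r))))"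
proof (cases "section_at j (tree_points t (fconst r)) = {}")
  case True
  then show ?thesis by (simp add: point_cycle_def dec_cycle_0)
next
  case False
  have "r \<noteq> 0" using r(2) by auto
  \<comment> \<open>A tree with a single edge is excluded: its two decorations differ, so its only
    face at 0 is empty.\<close>
  obtain t1 t2 where t12: "t = Node [t1, t2]" "trivalent t1" "trivalent t2"
  proof (cases "\<exists>x. t = Leaf x")
    case True
    then obtain x where "t = Leaf x" by blast
    then have "section_at j (tree_points t (fconst r)) = {}"
      using j r \<open>r \<noteq> 0\<close> section_leaf[of "fconst r" x] by auto
    then show ?thesis using False by contradiction
  qed (use trivalent_cases[OF t] that in blast)
  have pos: "0 < nedges t" for t :: "'a plane_tree" by (cases t rule: nedges.cases) auto
  have "\<exists>s b x l. trivalent s \<and> trivalent b \<and> distinct (r # leaves s) \<and> 0 \<notin> set (r # leaves s) \<and>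
    distinct (x # leaves b) \<and> 0 \<notin> set (x # leaves b) \<and> nedges s + nedges b = nedges t - 1 \<and> l \<le> nedges s \<and>
    section_at j (tree_points t (fconst r)) =
      {A @ B @ C | A B C. length A = l \<and> A @ C \<in> tree_points s (fconst r) \<and> B \<in> tree_points b (fconst x)}"
  proof (cases "j = 0")
    case True
    have "section_at j (tree_points t (fconst r)) = concat_points (tree_points t1 (fconst r)) (tree_points t2 (fconst r))"
      using True \<open>r \<noteq> 0\<close> by (simp add: t12(1) section_graft_root)
    also have "\<dots> = {A @ B @ C | A B C. length A = nedges t1 \<and> A @ C \<in> tree_points t1 (fconst r) \<and> B \<in> tree_points t2 (fconst r)}"
    proof (intro equalityI subsetI)
      fix p assume "p \<in> concat_points (tree_points t1 (fconst r)) (tree_points t2 (fconst r))"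
      then obtain A B where "A \<in> tree_points t1 (fconst r)" "B \<in> tree_points t2 (fconst r)" "p = A @ B"
        by (auto simp: concat_points_def)
      then show "p \<in> {A @ B @ C | A B C. length A = nedges t1 \<and> A @ C \<in> tree_points t1 (fconst r) \<and> B \<in> tree_points t2 (fconst r)}"
        using length_tree_points[OF t12(2)] by (intro CollectI exI[of _ A] exI[of _ B] exI[of _ "[]"]) simp
    next
      fix p assume "p \<in> {A @ B @ C | A B C. length A = nedges t1 \<and> A @ C \<in> tree_points t1 (fconst r) \<and> B \<in> tree_points t2 (fconst r)}"
      then obtain A B C where A: "length A = nedges t1" "A @ C \<in> tree_points t1 (fconst r)" "B \<in> tree_points t2 (fconst r)" "p = A @ B @ C"
        by blast
      then have "C = []" using length_tree_points[OF t12(2) A(2)] by simp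
      then show "p \<in> concat_points (tree_points t1 (fconst r)) (tree_points t2 (fconst r))"
        using A by (auto simp: concat_points_def)
    qed
    finally show ?thesis
      using t12(2,3) r unfolding t12(1)
      by (intro exI[of _ t1] exI[of _ t2] exI[of _ r] exI[of _ "nedges t1"] conjI) simp_all
  next
    case False
    then obtain s b x l where s: "trivalent s" "trivalent b" "mset (leaves s) + mset (leaves b) = mset (leaves t)"
      "x \<in> set (leaves s)" "nedges s + nedges b = nedges t - 1" "l \<le> nedges s"
      "section_at j (tree_points t (fconst r)) =
        {A @ B @ C | A B C. length A = l \<and> A @ C \<in> tree_points s (fconst r) \<and> B \<in> tree_points b (fconst x)}"
      using leaf_section[OF t _ j(1) _ j(2)] r(2) by auto
    \<comment> \<open>As \<open>x\<close> is a leaf of \<open>s\<close>, it is not among the leaves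
      of \<open>b\<close>; hence \<open>b\<close> with root \<open>x\<close> has distinct
      decorations.\<close>
    have ms: "mset (leaves s @ leaves b) = mset (leaves t)" using s(3) by simp
    then have "set (leaves s) \<union> set (leaves b) = set (leaves t)" by (metis set_append set_mset_mset)
    moreover have "distinct (leaves s @ leaves b)"
      using mset_eq_imp_distinct_iff[OF ms] r(1) by simp
    ultimately have "distinct (r # leaves s)" "0 \<notin> set (r # leaves s)" "distinct (x # leaves b)" "0 \<notin> set (x # leaves b)"
      using s(4) r by auto
    then show ?thesis using s by blast
  qed
  then obtain s b x l where s: "trivalent s" "distinct (r # leaves s)" "0 \<notin> set (r # leaves s)"
    and b: "trivalent b" "distinct (x # leaves b)" "0 \<notin> set (x # leaves b)"
    and l: "nedges s + nedges b = nedges t - 1" "l \<le> nedges s"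
    and sec: "section_at j (tree_points t (fconst r)) =
      {A @ B @ C | A B C. length A = l \<and> A @ C \<in> tree_points s (fconst r) \<and> B \<in> tree_points b (fconst x)}"
    by (elim exE conjE) (rule that; assumption)
  obtain es where es: "length es = nedges t" "points es = tree_points t (fconst r)" "anchored es" "arborescence r {} es"
    using tree_network[OF t r] by blast
  obtain es1 where es1: "length es1 = nedges s" "points es1 = tree_points s (fconst r)" "anchored es1"
    "arborescence r {} es1" "constants es1 - {r} = set (leaves s)"
    using tree_network[OF s] by blast
  obtain es2 where es2: "length es2 = nedges b" "points es2 = tree_points b (fconst x)" "anchored es2"
    "arborescence x {} es2" "constants es2 - {x} = set (leaves b)"
    using tree_network[OF b] by blast
  have "2 \<le> length es" using es(1) pos[of t1] by (simp add: t12(1))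
  then obtain es' where es': "length es' = nedges t - 1" "anchored es'" "arborescence r {} es'"
    "points es' = section_at j (tree_points t (fconst r))"
    using face_zero[OF es(3,4), of j] j(1) False unfolding es(1,2) by blast
  have "dec_cycle (Poly_Mapping.single (length es', net_ideal es') 1)"
  proof (rule dec_cycle_product[OF es'(2,3) es1(3,4) _ es2(3,4)])
    show "constants es1 - {r} \<noteq> {}" "constants es2 - {x} \<noteq> {}"
      using es1(5) es2(5) trivalent_leaves_nonempty[OF s(1)] trivalent_leaves_nonempty[OF b(1)] by simp_all
    show "length es' = length es1 + length es2" "l \<le> length es1" "0 < length es1" "0 < length es2"
      using es'(1) es1(1) es2(1) l pos[of s] pos[of b] by simp_all
    show "points es' = {A @ B @ C | A B C. length A = l \<and> A @ C \<in> points es1 \<and> B \<in> points es2}"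
      unfolding es'(4) es1(2) es2(2) by (rule sec)
  qed
  then show ?thesis
    using False es' by (simp add: point_cycle_def net_ideal_def)
qed

theorem proposition5p3:
  fixes xs :: "'a::field list"
  assumes "length xs \<ge> 2" and "distinct xs" and "0 \<notin> set xs"
  shows "admissible_cycle (Phi (tree_sum xs)) \<and>
         decomposable (nc_class (boundary (Phi (tree_sum xs))))"
proof -
  define r where "r = last xs"
  define ls where "ls = butlast xs"
  have "xs \<noteq> []" using assms(1) by auto
  then have xs: "xs = ls @ [r]" by (simp add: r_def ls_def)
  have r: "distinct (r # ls)" "0 \<notin> set (r # ls)" using assms(2,3) xs by auto
  have "ls \<noteq> []" using assms(1) xs by auto
  \<comment> \<open>The number of edges, hence the dimension of the cube, is the same for all
    trivalent trees with these leaves.\<close>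
  define k where "k = 2 * length ls - 1"
  have k: "nedges t = k" if "t \<in> trees_with ls" for t
    using nedges_leaves[of t] that by (simp add: trees_with_def k_def)
  have trees: "trivalent_trees xs = Planted r ` trees_with ls"
  proof (intro equalityI subsetI)
    fix T assume T: "T \<in> trivalent_trees xs"
    obtain q t where "T = Planted q t" by (cases T)
    then show "T \<in> Planted r ` trees_with ls"
      using T by (auto simp: trivalent_trees_def trees_with_def r_def ls_def)
  qed (auto simp: trivalent_trees_def trees_with_def r_def ls_def)
  define Q where "Q t es \<longleftrightarrow> length es = nedges t \<and> points es = tree_points t (fconst r) \<and> anchored es \<and>
    arborescence r {} es \<and> constants es - {r} = set (leaves t) \<and>
    map edge_coord_u (edge_list (Planted r t)) = coords generic es" for t and es :: "'a network"
  define E where "E t = (SOME es. Q t es)" for t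
  have Q: "Q t (E t)" if t: "t \<in> trees_with ls" for t
  proof -
    have "trivalent t" "leaves t = ls" using t by (simp_all add: trees_with_def)
    then have "\<exists>es. Q t es" unfolding Q_def using r by (intro tree_network) simp_all
    then show ?thesis unfolding E_def by (rule someI_ex)
  qed
  have E: "length (E t) = k" "points (E t) = tree_points t (fconst r)" "anchored (E t)" "arborescence r {} (E t)"
    "constants (E t) - {r} = set ls" "map edge_coord_u (edge_list (Planted r t)) = coords generic (E t)"
    if t: "t \<in> trees_with ls" for t
    using Q[OF t] k[OF t] t unfolding Q_def trees_with_def by (simp_all del: edge_list.simps)
  have param: "parametrized_cycle (map edge_coord_u (edge_list (Planted r t))) = Poly_Mapping.single (k, net_ideal (E t)) 1"
    if t: "t \<in> trees_with ls" for t
  proof -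
    have "Cst 0 \<notin> labels (E t)" using E(3)[OF t] by (simp add: anchored_def)
    then have "net_ideal (E t) = {f \<in> carrier (cube_ring k). peval (\<lambda>c. Fract (Const c) 1) (\<lambda>i. coords generic (E t) ! i) f = 0}"
      using E(1)[OF t] by (auto simp: mem_net_ideal fconst_def[abs_def])
    then show ?thesis
      using E(1,6)[OF t] by (simp add: parametrized_cycle_def del: edge_list.simps)
  qed
  have Phi: "Phi (tree_sum xs) = (\<Sum>t\<in>trees_with ls. Poly_Mapping.single (k, net_ideal (E t)) 1)"
  proof -
    have "Phi (tree_sum xs) = (\<Sum>T\<in>Planted r ` trees_with ls. parametrized_cycle (map edge_coord_u (edge_list T)))"
      by (simp add: Phi_def tree_sum_def lin_ext_sum lin_ext_single trees)
    also have "\<dots> = (\<Sum>t\<in>trees_with ls. parametrized_cycle (map edge_coord_u (edge_list (Planted r t))))"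
      by (subst sum.reindex) (auto simp: inj_on_def simp del: edge_list.simps)
    finally show ?thesis by (simp add: param del: edge_list.simps cong: sum.cong)
  qed
  have "k > 0" using \<open>ls \<noteq> []\<close> by (cases ls) (simp_all add: k_def)
  have adm: "admissible_subvariety k (length ls) (net_ideal (E t))" if t: "t \<in> trees_with ls" for t
    using admissible_net_ideal[OF E(3,4)[OF t]] E(1,5)[OF t] \<open>k > 0\<close> r(1)
    by (simp add: distinct_card)
  have "Phi (tree_sum xs) \<in> cycle_group (length ls) k"
  proof -
    have "p \<in> {(k, net_ideal (E t)) | t. t \<in> trees_with ls}" if "p \<in> Poly_Mapping.keys (Phi (tree_sum xs))" for p
    proof -
      have "Poly_Mapping.lookup (Phi (tree_sum xs)) p \<noteq> 0" using that by (simp add: in_keys_iff)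
      then obtain t where "t \<in> trees_with ls" "Poly_Mapping.lookup (Poly_Mapping.single (k, net_ideal (E t)) (1::rat)) p \<noteq> 0"
        unfolding Phi lookup_sum by (metis (no_types, lifting) sum.neutral)
      then show ?thesis by (auto simp: lookup_single when_def split: if_splits)
    qed
    then show ?thesis using adm unfolding cycle_group_def by fastforce
  qed
  moreover have "decomposable (nc_class (boundary (Phi (tree_sum xs))))"
  proof -
    define S where "S = (\<lambda>t j. scale ((- 1) ^ j) (point_cycle (k - 1) (section_at j (tree_points t (fconst r)))))"
    have bd: "boundary (Poly_Mapping.single (k, net_ideal (E t)) 1) = (\<Sum>j<k. S t j)" if t: "t \<in> trees_with ls" for t
    proof -
      \<comment> \<open>For two decorations the only tree is an edge between different constants,
        which has no face at 0; otherwise there are at least three edges.\<close>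
      have "2 \<le> k \<or> (\<forall>i<k. section_at i (tree_points t (fconst r)) = {})"
      proof (cases "length ls = 1")
        case True
        then obtain x where x: "t = Leaf x" using trees_with_singleton t by blast
        then have "x \<noteq> r" "x \<noteq> 0" "k = 1" using t r k[OF t] by (auto simp: trees_with_def)
        then show ?thesis using section_leaf[of "fconst r" x] x r(2) by auto
      next
        case False
        moreover have "0 < length ls" using \<open>ls \<noteq> []\<close> by simp
        ultimately have "2 \<le> k" unfolding k_def by linarith
        then show ?thesis by simp
      qed
      then show ?thesis
        using boundary_net_ideal[OF E(3,4)[OF t]] E(1,2)[OF t] by (simp add: S_def)
    qed
    have split: "(\<Sum>j<k. S t j) = (\<Sum>j\<in>inner t. S t j) + (\<Sum>j\<in>{..<k} - inner t. S t j)" if t: "t \<in> trees_with ls" for t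
    proof -
      have "inner t \<subseteq> {..<k}" using inner_bounds[of t] t k[OF t] by (auto simp: trees_with_def)
      then show ?thesis by (simp add: sum.subset_diff add.commute)
    qed
    have "boundary (Phi (tree_sum xs)) = (\<Sum>t\<in>trees_with ls. \<Sum>j<k. S t j)"
      unfolding Phi using bd by (simp add: boundary_def lin_ext_sum cong: sum.cong)
    also have "\<dots> = (\<Sum>t\<in>trees_with ls. \<Sum>j\<in>inner t. S t j) + (\<Sum>t\<in>trees_with ls. \<Sum>j\<in>{..<k} - inner t. S t j)"
      by (simp add: split sum.distrib cong: sum.cong)
    \<comment> \<open>The outermost context \<open>\<Psi>\<close> evaluates the points at the value
      of the root and forms their cycle.\<close>
    also have "(\<Sum>t\<in>trees_with ls. \<Sum>j\<in>inner t. S t j) = 0"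
      unfolding S_def by (rule inner_cancel[of "\<lambda>Y. point_cycle (k - 1) (Y (fconst r))"])
    finally have "boundary (Phi (tree_sum xs)) = (\<Sum>t\<in>trees_with ls. \<Sum>j\<in>{..<k} - inner t. S t j)" by simp
    moreover have "dec_cycle (S t j)" if "t \<in> trees_with ls" "j \<in> {..<k} - inner t" for t j
    proof -
      have t: "trivalent t" "leaves t = ls" using that(1) by (simp_all add: trees_with_def)
      then show ?thesis
        using dec_cycle_section[of t r j] r that(2) k[OF that(1)] unfolding S_def by (intro dec_cycle_scale) auto
    qed
    ultimately show ?thesis by (auto intro!: dec_cycle_decomposable dec_cycle_sum)
  qed
  ultimately show ?thesis unfolding admissible_cycle_def by blast
qed

end
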